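(* Fix a parity for framed 4-graphs with one unicursal component (for example, the Gaussian parity). Let $K$ be a framed 4-graph with one unicursal component such that all vertices (chords) of $K$ are odd and no decreasing second Reidemeister move can be applied to $K$. Then $K$ is a minimal diagram of the corresponding free knot in the following strong sense: for any framed 4-graph $K'$ equivalent to $K$ as a free knot there is a smoothing of $K'$ (at some set of vertices) isomorphic to the framed 4-graph $K$.
   Context: A framed 4-graph is a finite 4-valent graph (loops and multiple edges allowed, as well as components homeomorphic to a circle without vertices) in which at each vertex the four emanating half-edges are split into two pairs, called pairs of (formally) opposite half-edges. Isomorphisms respect the framing. Passing at each vertex from a half-edge to the opposite one decomposes the graph into unicursal components. Reidemeister moves. (1) Addition/removal of a vertex carrying a loop whose two half-edges are non-opposite at that vertex (on removal the other two half-edges are merged into one edge). (2) Addition/removal of a bigon: two vertices $u,v$ joined by two edges that are non-opposite both at $u$ and at $v$; on removal $u,v$ disappear and, for each of the two bigon edges $e$, the half-edge opposite to $e$ at $u$ is joined with the half-edge opposite to $e$ at $v$. The removal is the decreasing second move. (3) Three vertices pairwise joined by the edges of a triangle, the two triangle edges being non-opposite at each of the three vertices; the move pulls one strand through the crossing of the other two, i.e. each of the three strands passes its two crossings in the opposite order. A free link is an equivalence class of framed 4-graphs modulo these moves; a free knot is a free link with one unicursal component. A framed 4-graph with one unicursal component is encoded by its chord (Gauss) diagram: a circle traversing the unicursal component, with one chord per vertex joining the two preimages of the vertex. Two chords are linked if the ends of one lie in different components of the circle minus the ends of the other. A parity is a rule declaring every vertex of every framed 4-graph with one unicursal component even or odd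 (invariantly under framed isomorphisms) such that: the vertex added/removed by a first Reidemeister move is even; the two vertices added/removed by a second move have the same parity; among the three vertices participating in a third move the number of odd ones is even, and each of these three vertices has the same parity before and after the move; vertices not participating in a move keep their parity. The Gaussian parity declares a vertex even if its chord is linked with an even number of other chords, and odd otherwise. Smoothing at a vertex $v$ with half-edges $a,b,c,d$, where $a$ is opposite to $c$ and $b$ is opposite to $d$: remove $v$ and reconnect either $a$ with $b$ and $c$ with $d$, or $a$ with $d$ and $b$ with $c$; the rest of the graph with its framing is unchanged. A smoothing of a graph is the result of smoothing at several (possibly zero) vertices. *)

theory Defs
  imports Main "HOL-Combinatorics.Transposition"
begin

text \<open>
  Every framed 4-graph is finite, so up to isomorphism its vertices and half-edges are natural
  numbers. \<open>opp\<close> is the framing, \<open>mate\<close> sends a half-edge to the other half of its edge, and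
  \<open>circles\<close> counts the components homeomorphic to a circle without vertices.
\<close>

record fgraph =
  verts :: "nat set"
  halves :: "nat set"
  vertex :: "nat \<Rightarrow> nat"
  opp :: "nat \<Rightarrow> nat"
  mate :: "nat \<Rightarrow> nat"
  circles :: nat

definition halves_at :: "fgraph \<Rightarrow> nat set \<Rightarrow> nat set" where
  "halves_at G S = {d \<in> halves G. vertex G d \<in> S}"

definition pairing_on :: "'a set \<Rightarrow> ('a \<Rightarrow> 'a) \<Rightarrow> bool" where
  "pairing_on A s \<longleftrightarrow> (\<forall>d\<in>A. s d \<in> A \<and> s d \<noteq> d \<and> s (s d) = d)"

definition framed_4_graph :: "fgraph \<Rightarrow> bool" where
  "framed_4_graph G \<longleftrightarrow>
     finite (verts G) \<and> finite (halves G) \<and>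
     (\<forall>d\<in>halves G. vertex G d \<in> verts G) \<and>
     (\<forall>v\<in>verts G. card (halves_at G {v}) = 4 \<and> pairing_on (halves_at G {v}) (opp G)) \<and>
     pairing_on (halves G) (mate G)"

text \<open>The values of the functions outside \<open>halves\<close> play no role in an isomorphism.\<close>

definition graph_iso :: "(nat \<Rightarrow> nat) \<Rightarrow> (nat \<Rightarrow> nat) \<Rightarrow> fgraph \<Rightarrow> fgraph \<Rightarrow> bool" where
  "graph_iso f g G H \<longleftrightarrow>
     bij_betw f (verts G) (verts H) \<and> bij_betw g (halves G) (halves H) \<and>
     (\<forall>d\<in>halves G. vertex H (g d) = f (vertex G d) \<and>
                   opp H (g d) = g (opp G d) \<and> mate H (g d) = g (mate G d)) \<and>
     circles G = circles H"

definition isomorphic :: "fgraph \<Rightarrow> fgraph \<Rightarrow> bool" where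
  "isomorphic G H \<longleftrightarrow> (\<exists>f g. graph_iso f g G H)"

definition unicursal_rel :: "fgraph \<Rightarrow> (nat \<times> nat) set" where
  "unicursal_rel G = {(d, mate G d) | d. d \<in> halves G} \<union> {(d, opp G d) | d. d \<in> halves G}"

definition unicursal_components :: "fgraph \<Rightarrow> nat" where
  "unicursal_components G = card (halves G // (unicursal_rel G)\<^sup>*) + circles G"

definition knot_graph :: "fgraph \<Rightarrow> bool" where
  "knot_graph G \<longleftrightarrow> framed_4_graph G \<and> unicursal_components G = 1"

text \<open>
  Removal of the vertices in \<open>S\<close>, the half-edges at \<open>S\<close> being reconnected by the pairing \<open>s\<close>.
  The classes of \<open>(arc_rel S s G)\<^sup>*\<close> on the half-edges of \<open>G\<close> are the arcs of the resulting
  curves: such a class either contains exactly two of the surviving half-edges, which then form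
  an edge of the new graph, or it contains none and is a new circle without vertices.
\<close>

definition arc_rel :: "nat set \<Rightarrow> (nat \<Rightarrow> nat) \<Rightarrow> fgraph \<Rightarrow> (nat \<times> nat) set" where
  "arc_rel S s G = {(d, mate G d) | d. d \<in> halves G} \<union> {(d, s d) | d. d \<in> halves_at G S}"

definition splice :: "nat set \<Rightarrow> (nat \<Rightarrow> nat) \<Rightarrow> fgraph \<Rightarrow> fgraph" where
  "splice S s G = G\<lparr>
     verts := verts G - S,
     halves := halves G - halves_at G S,
     mate := (\<lambda>d. THE d'. d' \<in> halves G - halves_at G S \<and> d' \<noteq> d \<and> (d, d') \<in> (arc_rel S s G)\<^sup>*),
     circles := circles G + card {C \<in> halves G // (arc_rel S s G)\<^sup>*. C \<subseteq> halves_at G S}\<rparr>"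

text \<open>
  The first two moves are given in the decreasing direction. Both reconnect the removed vertices
  by the framing itself. For a loop \<open>e\<close> at \<open>v\<close> the strand \<open>opp e, e, mate e, opp (mate e)\<close> is then
  replaced by one edge, so that the two half-edges not on the loop are merged. For a bigon edge
  with half \<open>e\<close> at \<open>u\<close> and half \<open>mate e\<close> at \<open>v\<close> the same strand runs through \<open>u\<close> and \<open>v\<close>, so that
  the half-edge opposite to the bigon edge at \<open>u\<close> is joined with the one opposite to it at \<open>v\<close>.
\<close>

definition move1 :: "nat \<Rightarrow> fgraph \<Rightarrow> fgraph \<Rightarrow> bool" where
  "move1 v G H \<longleftrightarrow>
     (\<exists>e\<in>halves G. vertex G e = v \<and> vertex G (mate G e) = v \<and> mate G e \<noteq> opp G e) \<and>
     H = splice {v} (opp G) G"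

definition bigon :: "fgraph \<Rightarrow> nat \<Rightarrow> nat \<Rightarrow> bool" where
  "bigon G u v \<longleftrightarrow> u \<noteq> v \<and>
     (\<exists>e\<in>halves G. \<exists>f\<in>halves G. e \<noteq> f \<and>
        vertex G e = u \<and> vertex G f = u \<and> f \<noteq> opp G e \<and>
        vertex G (mate G e) = v \<and> vertex G (mate G f) = v \<and> mate G f \<noteq> opp G (mate G e))"

definition move2 :: "nat \<Rightarrow> nat \<Rightarrow> fgraph \<Rightarrow> fgraph \<Rightarrow> bool" where
  "move2 u v G H \<longleftrightarrow> bigon G u v \<and> H = splice {u, v} (opp G) G"

text \<open>
  The half-edges \<open>a\<close>, \<open>b\<close>, \<open>c\<close> at \<open>u\<close>, \<open>v\<close>, \<open>w\<close> start the edges of the triangle from \<open>u\<close> to \<open>v\<close>,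
  from \<open>v\<close> to \<open>w\<close> and from \<open>w\<close> to \<open>u\<close>.
\<close>

definition triangle :: "fgraph \<Rightarrow> nat \<Rightarrow> nat \<Rightarrow> nat \<Rightarrow> nat \<Rightarrow> nat \<Rightarrow> nat \<Rightarrow> bool" where
  "triangle G u v w a b c \<longleftrightarrow>
     u \<noteq> v \<and> v \<noteq> w \<and> w \<noteq> u \<and>
     a \<in> halves G \<and> vertex G a = u \<and> vertex G (mate G a) = v \<and>
     b \<in> halves G \<and> vertex G b = v \<and> vertex G (mate G b) = w \<and>
     c \<in> halves G \<and> vertex G c = w \<and> vertex G (mate G c) = u \<and>
     a \<noteq> opp G (mate G c) \<and> b \<noteq> opp G (mate G a) \<and> c \<noteq> opp G (mate G b)"

text \<open>
  The strand through the triangle edge \<open>a\<close> enters at \<open>opp a\<close> and leaves at \<open>opp (mate a)\<close>. It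
  passes its two crossings in the opposite order once whatever was attached to these two outer
  half-edges has been interchanged, and similarly for \<open>b\<close> and \<open>c\<close>. Conjugating \<open>mate\<close> also gives
  the right result when outer half-edges are attached to each other; the triangle edges stay.
\<close>

definition outer_swap :: "fgraph \<Rightarrow> nat \<Rightarrow> nat \<Rightarrow> nat \<Rightarrow> nat \<Rightarrow> nat" where
  "outer_swap G a b c =
     transpose (opp G a) (opp G (mate G a)) \<circ>
     transpose (opp G b) (opp G (mate G b)) \<circ>
     transpose (opp G c) (opp G (mate G c))"

definition move3 :: "nat \<Rightarrow> nat \<Rightarrow> nat \<Rightarrow> fgraph \<Rightarrow> fgraph \<Rightarrow> bool" where
  "move3 u v w G H \<longleftrightarrow>
     (\<exists>a b c. triangle G u v w a b c \<and>
        H = G\<lparr>mate := outer_swap G a b c \<circ> mate G \<circ> outer_swap G a b c\<rparr>)"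

definition move_step :: "fgraph \<Rightarrow> fgraph \<Rightarrow> bool" where
  "move_step G H \<longleftrightarrow> framed_4_graph G \<and> framed_4_graph H \<and>
     (isomorphic G H \<or> (\<exists>v. move1 v G H) \<or> (\<exists>u v. move2 u v G H) \<or> (\<exists>u v w. move3 u v w G H))"

definition free_equivalent :: "fgraph \<Rightarrow> fgraph \<Rightarrow> bool" where
  "free_equivalent = equivclp move_step"

text \<open>Here \<open>odd_at G v\<close> says that the vertex \<open>v\<close> of \<open>G\<close> is odd.\<close>

definition parity :: "(fgraph \<Rightarrow> nat \<Rightarrow> bool) \<Rightarrow> bool" where
  "parity odd_at \<longleftrightarrow>
     (\<forall>G H f g. knot_graph G \<and> knot_graph H \<and> graph_iso f g G H \<longrightarrow>
        (\<forall>x\<in>verts G. odd_at H (f x) = odd_at G x)) \<and>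
     (\<forall>G H v. knot_graph G \<and> knot_graph H \<and> move1 v G H \<longrightarrow>
        \<not> odd_at G v \<and>
        (\<forall>x\<in>verts G - {v}. odd_at H x = odd_at G x)) \<and>
     (\<forall>G H u v. knot_graph G \<and> knot_graph H \<and> move2 u v G H \<longrightarrow>
        odd_at G u = odd_at G v \<and>
        (\<forall>x\<in>verts G - {u, v}. odd_at H x = odd_at G x)) \<and>
     (\<forall>G H u v w. knot_graph G \<and> knot_graph H \<and> move3 u v w G H \<longrightarrow>
        even (card {x \<in> {u, v, w}. odd_at G x}) \<and>
        (\<forall>x\<in>verts G. odd_at H x = odd_at G x))"

text \<open>
  Of the three pairings of the four half-edges at a vertex, the two that avoid the framing are
  the two smoothings.
\<close>

definition smoothing_pairing :: "fgraph \<Rightarrow> nat set \<Rightarrow> (nat \<Rightarrow> nat) \<Rightarrow> bool" where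
  "smoothing_pairing G S s \<longleftrightarrow>
     (\<forall>v\<in>S. pairing_on (halves_at G {v}) s \<and> (\<forall>d\<in>halves_at G {v}. s d \<noteq> opp G d))"

definition smoothing_of :: "fgraph \<Rightarrow> fgraph \<Rightarrow> bool" where
  "smoothing_of H G \<longleftrightarrow>
     (\<exists>S s. S \<subseteq> verts G \<and> smoothing_pairing G S s \<and> H = splice S s G)"

end

theory Submission
  imports Defs "HOL-Library.FuncSet"
begin

text \<open>
  Count modulo 2 the states of a diagram \<open>G\<close> that give \<open>K\<close>, where in a state every even vertex is
  smoothed and every odd vertex is either smoothed or kept. For \<open>G = K\<close> only the state keeping all
  vertices counts. The count is invariant under the moves. Indeed, \<open>K\<close> has no vertex removable by a
  first move, since it would be even, and no bigon, so states showing one of these contribute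
  nothing; the other states match or cancel in pairs. In a third move some vertex is even and the
  other two have equal parity: one smoothing of the even vertex yields a tangle symmetric under
  the move, the other one yields a bigon, for which the sum over the states of its two vertices was
  found for the second move. Hence the count of \<open>K'\<close> is odd, and some state of \<open>K'\<close> gives \<open>K\<close>.
\<close>

section \<open>Arcs and contractions\<close>

text \<open>Two constraints fix which states are counted. Odd vertices may also be smoothed, because
  a removed bigon is accounted for by the state that smooths both of its vertices across it. Even
  vertices are always smoothed, because this is what reduces a triangle to tangles with two
  vertices. The count is taken modulo 2 because two different pairs of smoothings of a bigon give
  the same diagram, and so do the two surviving states that keep exactly one of its vertices. The
  obstacle is that the two sides of a move have states on different graphs, and that
  \<open>splice\<close> reconnects through a transitive closure and a definite description. States
  are therefore not turned into graphs until the very end: a state is a set of links next to the set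
  of edges, and contracting one link at a time only renames half-edges. Passing straight through a
  vertex is one more kind of link, so a diagram after a decreasing move is described by states of
  the diagram before it, with a common exterior.\<close>

definition adj :: "nat set set \<Rightarrow> (nat \<times> nat) set" where
  "adj X = {(x, y). {x, y} \<in> X}"

abbreviation conn :: "nat set set \<Rightarrow> (nat \<times> nat) set" where
  "conn X \<equiv> (adj X)\<^sup>*"

text \<open>A class without surviving half-edges is a circle created by contracting the links. This
  is the number that \<open>splice\<close> adds to \<open>circles\<close>.\<close>

definition closed_arcs :: "nat set set \<Rightarrow> nat set set \<Rightarrow> nat" where
  "closed_arcs E L = card {Q \<in> \<Union>E // conn (E \<union> L). Q \<subseteq> \<Union>L}"

lemma conn_sym: "(x, y) \<in> conn X \<Longrightarrow> (y, x) \<in> conn X"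
proof -
  have "sym (adj X)" by (auto simp: sym_def adj_def insert_commute)
  then show "(x, y) \<in> conn X \<Longrightarrow> (y, x) \<in> conn X" by (meson symE sym_rtrancl)
qed

lemma conn_edge: "{x, y} \<in> X \<Longrightarrow> (x, y) \<in> conn X"
  by (auto simp: adj_def)

lemma conn_mono: "X \<subseteq> Y \<Longrightarrow> (x, y) \<in> conn X \<Longrightarrow> (x, y) \<in> conn Y"
  by (rule set_mp[OF rtrancl_mono]) (auto simp: adj_def)

lemma conn_map:
  assumes "(x, y) \<in> conn X" and "\<And>a b. {a, b} \<in> X \<Longrightarrow> (h a, h b) \<in> conn Y"
  shows "(h x, h y) \<in> conn Y"
  using assms(1)
proof (induction rule: rtrancl_induct)
  case (step y z)
  then have "(h y, h z) \<in> conn Y" using assms(2) by (auto simp: adj_def)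
  then show ?case using step by (meson rtrancl_trans)
qed simp

lemma conn_cases: "(x, y) \<in> conn X \<Longrightarrow> x = y \<or> x \<in> \<Union>X \<and> y \<in> \<Union>X"
  by (induction rule: rtrancl_induct) (auto simp: adj_def)

lemma conn_Union: "(x, y) \<in> conn X \<Longrightarrow> x \<in> \<Union>X \<Longrightarrow> y \<in> \<Union>X"
  using conn_cases by blast

lemma conn_class_eq: "(x, y) \<in> conn X \<Longrightarrow> conn X `` {x} = conn X `` {y}"
  by (auto intro: rtrancl_trans conn_sym)

section \<open>Comparing contractions through maps of half-edges\<close>

lemma image_id_on:
  assumes "\<And>x. x \<in> \<Union>L \<Longrightarrow> h x = x"
  shows "image h ` L = L"
proof -
  have "h ` e = id e" if "e \<in> L" for e
  proof -
    have "h ` e = id ` e" using assms that by (intro image_cong) auto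
    then show ?thesis by simp
  qed
  then show ?thesis using image_cong[OF refl, of L "image h" id] by simp
qed

lemma image_image_id:
  assumes "\<And>x. x \<in> \<Union>(\<Union>C) \<Longrightarrow> h x = x"
  shows "image (image h) ` C = C"
proof -
  have "image h ` c = id c" if "c \<in> C" for c
    unfolding id_apply by (rule image_id_on) (use assms that in auto)
  then show ?thesis using image_cong[OF refl, of C "image (image h)" id] by simp
qed

text \<open>Used in pairs, with \<open>r\<close> and \<open>t\<close> exchanged: the two maps are
  then inverse to each other up to moving along arcs, and truly inverse on surviving half-edges.
  Linked half-edges may be identified, which is what a contraction does.\<close>

definition half_equiv ::
  "(nat \<Rightarrow> nat) \<Rightarrow> (nat \<Rightarrow> nat) \<Rightarrow> nat set set \<Rightarrow> nat set set \<Rightarrow> nat set set \<Rightarrow> nat set set \<Rightarrow> bool" where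
  "half_equiv r t E L E' L' \<longleftrightarrow>
     finite (\<Union>E) \<and> \<Union>L \<subseteq> \<Union>E \<and>
     (\<forall>x y. {x, y} \<in> E \<union> L \<longrightarrow> (r x, r y) \<in> conn (E' \<union> L')) \<and>
     (\<forall>x\<in>\<Union>E. r x \<in> \<Union>E' \<and> (t (r x), x) \<in> conn (E \<union> L)) \<and>
     (\<forall>x\<in>\<Union>E - \<Union>L. r x \<in> \<Union>E' - \<Union>L' \<and> t (r x) = x)"

lemma half_equivI:
  assumes "finite (\<Union>E)" "\<Union>L \<subseteq> \<Union>E"
    and "\<And>x y. {x, y} \<in> E \<union> L \<Longrightarrow> (r x, r y) \<in> conn (E' \<union> L')"
    and "\<And>x. x \<in> \<Union>E \<Longrightarrow> r x \<in> \<Union>E'" "\<And>x. x \<in> \<Union>E \<Longrightarrow> (t (r x), x) \<in> conn (E \<union> L)"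
    and "\<And>x. x \<in> \<Union>E \<Longrightarrow> x \<notin> \<Union>L \<Longrightarrow> r x \<notin> \<Union>L' \<and> t (r x) = x"
  shows "half_equiv r t E L E' L'"
  using assms unfolding half_equiv_def by blast

text \<open>The map \<open>r\<close> induces a map on arcs. It is injective because \<open>t\<close>
  pulls connections back, and closed arcs stay closed because survivors are pulled back to
  survivors.\<close>

lemma closed_arcs_le:
  assumes h1: "half_equiv r t E L E' L'" and h2: "half_equiv t r E' L' E L"
  shows "closed_arcs E L \<le> closed_arcs E' L'"
proof -
  let ?R = "conn (E \<union> L)" and ?R' = "conn (E' \<union> L')"
  define F where "F = (\<lambda>Q. ?R' `` (r ` Q))"
  have rm: "(r x, r y) \<in> ?R'" if "(x, y) \<in> ?R" for x y
    using that conn_map[of x y "E \<union> L" r "E' \<union> L'"] h1 by (auto simp: half_equiv_def)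
  have tm: "(t x, t y) \<in> ?R" if "(x, y) \<in> ?R'" for x y
    using that conn_map[of x y "E' \<union> L'" t "E \<union> L"] h2 by (auto simp: half_equiv_def)
  have tr: "(t (r x), x) \<in> ?R" and rD: "r x \<in> \<Union>E'" if "x \<in> \<Union>E" for x
    using that h1 by (auto simp: half_equiv_def)
  have F: "F (?R `` {x}) = ?R' `` {r x}" for x
    unfolding F_def using rm by (auto intro: rtrancl_trans)
  \<comment> \<open>\<open>t\<close> undoes \<open>r\<close> only up to moving along an arc, which
    suffices here.\<close>
  have pull: "(x, t y) \<in> ?R" if "x \<in> \<Union>E" "(r x, y) \<in> ?R'" for x y
    using tr[OF that(1)] tm[OF that(2)] by (meson conn_sym rtrancl_trans)
  have D': "\<Union>L' \<subseteq> \<Union>E'" using h2 by (auto simp: half_equiv_def)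
  show ?thesis
    unfolding closed_arcs_def
  proof (rule card_inj_on_le[where f = F])
    show "inj_on F {Q \<in> \<Union>E // ?R. Q \<subseteq> \<Union>L}"
    proof (rule inj_onI)
      fix Q1 Q2 assume a: "Q1 \<in> {Q \<in> \<Union>E // ?R. Q \<subseteq> \<Union>L}" "Q2 \<in> {Q \<in> \<Union>E // ?R. Q \<subseteq> \<Union>L}" "F Q1 = F Q2"
      then obtain x y where xy: "x \<in> \<Union>E" "Q1 = ?R `` {x}" "y \<in> \<Union>E" "Q2 = ?R `` {y}"
        by (auto elim!: quotientE)
      then have "(r x, r y) \<in> ?R'" using a(3) F by auto
      then have "(x, y) \<in> ?R" using pull[OF xy(1)] tr[OF xy(3)] by (meson rtrancl_trans)
      then show "Q1 = Q2" using xy conn_class_eq by auto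
    qed
    show "F ` {Q \<in> \<Union>E // ?R. Q \<subseteq> \<Union>L} \<subseteq> {Q \<in> \<Union>E' // ?R'. Q \<subseteq> \<Union>L'}"
    proof clarify
      fix Q assume a: "Q \<in> \<Union>E // ?R" "Q \<subseteq> \<Union>L"
      then obtain x where x: "x \<in> \<Union>E" "Q = ?R `` {x}" by (auto elim!: quotientE)
      \<comment> \<open>A survivor in the image class would be carried by \<open>t\<close> to a
        survivor in the closed class \<open>Q\<close>.\<close>
      have "s \<in> \<Union>L'" if s: "(r x, s) \<in> ?R'" for s
      proof (rule ccontr)
        assume n: "s \<notin> \<Union>L'"
        have "s \<in> \<Union>(E' \<union> L')" using conn_Union[OF s] rD[OF x(1)] by auto
        then have "s \<in> \<Union>E' - \<Union>L'" using D' n by auto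
        then have "t s \<in> \<Union>E - \<Union>L" using h2 by (auto simp: half_equiv_def)
        moreover have "t s \<in> Q" using pull[OF x(1) s] x by auto
        ultimately show False using a by auto
      qed
      then show "F Q \<in> \<Union>E' // ?R' \<and> F Q \<subseteq> \<Union>L'"
        using x F rD[OF x(1)] by (auto intro: quotientI)
    qed
    show "finite {Q \<in> \<Union>E' // ?R'. Q \<subseteq> \<Union>L'}"
    proof -
      have "finite (\<Union>E')" using h2 by (auto simp: half_equiv_def)
      then have "finite (\<Union>E' // ?R')" unfolding quotient_def by (intro finite_UN_I) auto
      then show ?thesis by simp
    qed
  qed
qed

definition links :: "nat set \<Rightarrow> (nat \<Rightarrow> nat) \<Rightarrow> nat set set" where
  "links A s = (\<lambda>d. {d, s d}) ` A"

definition edges :: "fgraph \<Rightarrow> nat set set" where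
  "edges G = links (halves G) (mate G)"

definition crossing :: "fgraph \<Rightarrow> nat \<Rightarrow> nat set set" where
  "crossing G v = links (halves_at G {v}) (opp G)"

text \<open>
  Edges, and the links made by smoothing a vertex, are two-element sets of half-edges. A crossing
  is the set of its two pairs of opposite half-edges, so that vertices need no names. The predicate
  \<open>realizes K E L C n\<close> says that contracting the links \<open>L\<close> in the edges \<open>E\<close>, in the presence of the
  kept crossings \<open>C\<close> and of \<open>n\<close> circles, gives \<open>K\<close>.
\<close>

definition realizes :: "fgraph \<Rightarrow> nat set set \<Rightarrow> nat set set \<Rightarrow> nat set set set \<Rightarrow> nat \<Rightarrow> bool" where
  "realizes K E L C n \<longleftrightarrow>
     (\<exists>g. bij_betw g (halves K) (\<Union>E - \<Union>L) \<and>
        (\<lambda>v. image g ` crossing K v) ` verts K = C \<and>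
        (\<forall>d\<in>halves K. (g d, g (mate K d)) \<in> conn (E \<union> L)) \<and>
        n + closed_arcs E L = circles K)"

lemma realizes_transfer_half:
  assumes h1: "half_equiv r t E L E' L'" and h2: "half_equiv t r E' L' E L"
    and "realizes K E L C n"
  shows "realizes K E' L' (image (image r) ` C) n"
proof -
  obtain g where g: "bij_betw g (halves K) (\<Union>E - \<Union>L)"
    "(\<lambda>v. image g ` crossing K v) ` verts K = C"
    "\<forall>d\<in>halves K. (g d, g (mate K d)) \<in> conn (E \<union> L)" "n + closed_arcs E L = circles K"
    using assms(3) by (auto simp: realizes_def)
  have c: "closed_arcs E L = closed_arcs E' L'"
    using closed_arcs_le[OF h1 h2] closed_arcs_le[OF h2 h1] by simp
  have "bij_betw r (\<Union>E - \<Union>L) (\<Union>E' - \<Union>L')"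
    by (rule bij_betw_byWitness[where f' = t]) (use h1 h2 in \<open>auto simp: half_equiv_def\<close>)
  then have b: "bij_betw (r \<circ> g) (halves K) (\<Union>E' - \<Union>L')" using g(1) bij_betw_trans by blast
  have "\<forall>d\<in>halves K. ((r \<circ> g) d, (r \<circ> g) (mate K d)) \<in> conn (E' \<union> L')"
    using g(3) h1 conn_map[where X = "E \<union> L" and h = r and Y = "E' \<union> L'"]
    unfolding half_equiv_def by (metis comp_apply)
  moreover have "(\<lambda>v. image (r \<circ> g) ` crossing K v) ` verts K = image (image r) ` C"
    by (subst g(2)[symmetric]) (simp add: image_image image_comp)
  ultimately show ?thesis using b g(4) c unfolding realizes_def by metis
qed

text \<open>Kept crossings consist of survivors, on which \<open>t\<close> inverts \<open>r\<close>;
  so transferring there and back restores \<open>C\<close>.\<close>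

lemma realizes_transfer:
  assumes h1: "half_equiv r t E L E' L'" and h2: "half_equiv t r E' L' E L"
    and C: "\<Union>(\<Union>C) \<subseteq> \<Union>E - \<Union>L"
  shows "realizes K E L C n \<longleftrightarrow> realizes K E' L' (image (image r) ` C) n"
proof
  assume "realizes K E' L' (image (image r) ` C) n"
  from realizes_transfer_half[OF h2 h1 this]
  have *: "realizes K E L (image (image t) ` image (image r) ` C) n" .
  have "t (r x) = x" if "x \<in> \<Union>E - \<Union>L" for x using h1 that by (auto simp: half_equiv_def)
  then have "image (image (\<lambda>x. t (r x))) ` C = C" using C by (intro image_image_id) blast
  then have "image (image t) ` image (image r) ` C = C" by (simp add: image_image)
  then show "realizes K E L C n" using * by simp
qed (rule realizes_transfer_half[OF h1 h2])


text \<open>The invariant for local computations: links stay inside the half-edges of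
  \<open>E\<close>, and kept crossings use only half-edges untouched by links, so contractions leave
  them intact up to names.\<close>

definition diagram :: "nat set set \<Rightarrow> nat set set \<Rightarrow> nat set set set \<Rightarrow> bool" where
  "diagram E L C \<longleftrightarrow> finite (\<Union>E) \<and> (\<forall>e\<in>L. \<exists>a b. e = {a, b}) \<and> \<Union>L \<subseteq> \<Union>E \<and>
     \<Union>(\<Union>C) \<subseteq> \<Union>E - \<Union>L"

text \<open>The effect of shrinking an edge with ends \<open>x\<close>, \<open>y\<close> along a
  link from \<open>x\<close> to \<open>p\<close>: whatever was attached to \<open>y\<close> becomes
  attached to \<open>p\<close>.\<close>

definition relabel :: "nat \<Rightarrow> nat \<Rightarrow> nat \<Rightarrow> nat" where
  "relabel y p z = (if z = y then p else z)"

lemma relabel_simps: "relabel y p y = p" "z \<noteq> y \<Longrightarrow> relabel y p z = z"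
  by (simp_all add: relabel_def)

lemma relabel_id:
  "y \<notin> \<Union>L \<Longrightarrow> image (relabel y p) ` L = L"
  "y \<notin> \<Union>(\<Union>C) \<Longrightarrow> image (image (relabel y p)) ` C = C"
  by (rule image_id_on image_image_id, rule relabel_simps(2), rule notI, simp only:)+

text \<open>The half-edges \<open>x\<close>, \<open>y\<close>, \<open>p\<close> lie on one arc, and
  nothing else is attached to \<open>x\<close> or \<open>p\<close>. Edge and link can thus be
  dropped once \<open>p\<close> takes over the role of \<open>y\<close>.\<close>

lemma realizes_contract_link:
  assumes dia: "diagram (insert {x, y} E) (insert {x, p} L) C"
    and xy: "x \<noteq> y" "x \<notin> \<Union>E" "y \<notin> \<Union>E" and p: "p \<in> \<Union>E" and xL: "x \<notin> \<Union>L" "p \<notin> \<Union>L"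
  shows "realizes K (insert {x, y} E) (insert {x, p} L) C n \<longleftrightarrow>
    realizes K E (image (relabel y p) ` L) (image (image (relabel y p)) ` C) n"
proof -
  let ?E = "insert {x, y} E" and ?L = "insert {x, p} L" and ?L' = "image (relabel y p) ` L"
  define r where "r = (id :: nat \<Rightarrow> nat)(x := p, y := p)"
  \<comment> \<open>Before the contraction \<open>p\<close> is linked, so it does not survive; if
    \<open>p\<close> survives afterwards, it stands for \<open>y\<close>.\<close>
  define t where "t = (id :: nat \<Rightarrow> nat)(p := y)"
  have fin: "finite (\<Union>E)" and dbl: "\<And>e. e \<in> L \<Longrightarrow> \<exists>a b. e = {a, b}"
    and L: "\<Union>?L \<subseteq> \<Union>?E" and C: "\<Union>(\<Union>C) \<subseteq> \<Union>?E - \<Union>?L"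
    using dia by (simp_all add: diagram_def)
  have ne: "p \<noteq> x" "p \<noteq> y" using xy p by blast+
  have rt: "r z = relabel y p z" if "z \<noteq> x" for z using that by (simp add: r_def relabel_def)
  have rid: "r a = a" if "a \<in> \<Union>E" for a
  proof -
    have "a \<noteq> x" "a \<noteq> y" using that xy by blast+
    then show ?thesis by (simp add: r_def)
  qed
  have UL': "\<Union>?L' = relabel y p ` \<Union>L" by (rule image_Union[symmetric])
  have rL: "r ` e = relabel y p ` e" if "e \<in> L" for e
    by (rule image_cong[OF refl], rule rt) (use that xL in blast)
  have s1: "(r a, r b) \<in> conn (E \<union> ?L')" if ab: "{a, b} \<in> ?E \<union> ?L" for a b
  proof -
    consider "{a, b} = {x, y}" | "{a, b} = {x, p}" | "{a, b} \<in> E" | "{a, b} \<in> L"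
      using ab by blast
    then show ?thesis
    proof cases
      case 3
      then have "a \<in> \<Union>E" "b \<in> \<Union>E" by auto
      then show ?thesis using rid 3 by (auto intro!: conn_edge)
    next
      case 4
      have "{r a, r b} = r ` {a, b}" by simp
      also have "\<dots> = relabel y p ` {a, b}" by (rule rL[OF 4])
      finally have "{r a, r b} \<in> ?L'" using 4 by (metis imageI)
      then show ?thesis by (intro conn_edge) simp
    qed (auto simp: doubleton_eq_iff r_def)
  qed
  have xp: "(x, p) \<in> conn (?E \<union> ?L)"
    and xy': "(x, y) \<in> conn (?E \<union> ?L)" by (auto intro!: conn_edge)
  have yp: "(y, p) \<in> conn (?E \<union> ?L)" using xp xy' by (meson conn_sym rtrancl_trans)
  have tc: "(t a, a) \<in> conn (?E \<union> ?L)" for a using yp by (simp add: t_def)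
  have rc: "(r a, a) \<in> conn (?E \<union> ?L)" for a
    using conn_sym[OF xp] conn_sym[OF yp] by (simp add: r_def)
  have s2: "(t a, t b) \<in> conn (?E \<union> ?L)" if ab: "{a, b} \<in> E \<union> ?L'" for a b
  proof -
    have "(a, b) \<in> conn (?E \<union> ?L)"
    proof (cases "{a, b} \<in> E")
      case False
      then obtain e where e: "e \<in> L" "{a, b} = relabel y p ` e" using ab by auto
      obtain c d where cd: "e = {c, d}" using dbl[OF e(1)] by (elim exE)
      have "{a, b} = r ` e" by (rule trans[OF e(2) rL[OF e(1), symmetric]])
      then have "{a, b} = {r c, r d}" unfolding cd by (simp only: image_insert image_empty)
      moreover have "(c, d) \<in> conn (?E \<union> ?L)" using e(1) cd by (intro conn_edge) simp
      then have "(r c, r d) \<in> conn (?E \<union> ?L)" using rc by (meson conn_sym rtrancl_trans)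
      ultimately show ?thesis using conn_sym unfolding doubleton_eq_iff by (elim disjE conjE) simp_all
    qed (auto intro!: conn_edge)
    then show ?thesis using tc by (meson conn_sym rtrancl_trans)
  qed
  have h1: "half_equiv r t ?E ?L E ?L'"
  proof (rule half_equivI)
    show "(r a, r b) \<in> conn (E \<union> ?L')" if "{a, b} \<in> ?E \<union> ?L" for a b
      by (rule s1[OF that])
    show "(t (r a), a) \<in> conn (?E \<union> ?L)" for a
      using tc rc by (meson rtrancl_trans)
    show "\<Union>?L \<subseteq> \<Union>?E" by (rule L)
    show "finite (\<Union>?E)" using fin by simp
    show "r a \<in> \<Union>E" if "a \<in> \<Union>?E" for a
    proof (cases "a \<in> {x, y}")
      case False
      then have "a \<in> \<Union>E" using that by simp
      then show ?thesis using rid by simp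
    qed (use p in \<open>auto simp: r_def\<close>)
    show "r a \<notin> \<Union>?L' \<and> t (r a) = a" if a: "a \<in> \<Union>?E" "a \<notin> \<Union>?L" for a
    proof (cases "a = y")
      case True
      have "y \<notin> \<Union>L" using a True by simp
      then have "p \<notin> relabel y p ` \<Union>L" using xL(2) by (auto simp: relabel_def split: if_splits)
      then show ?thesis unfolding UL' using True by (simp add: r_def t_def)
    next
      case False
      have "a \<noteq> x" "a \<noteq> p" "a \<notin> \<Union>L" using a by simp_all
      then have "a \<notin> relabel y p ` \<Union>L" by (auto simp: relabel_def split: if_splits)
      then show ?thesis unfolding UL' using False \<open>a \<noteq> x\<close> \<open>a \<noteq> p\<close> by (simp add: r_def t_def)
    qed
  qed
  have h2: "half_equiv t r E ?L' ?E ?L"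
  proof (rule half_equivI)
    show "(t a, t b) \<in> conn (?E \<union> ?L)" if "{a, b} \<in> E \<union> ?L'" for a b
      by (rule s2[OF that])
    have rt': "r (t a) = a" if "a \<in> \<Union>E" for a
    proof -
      have "a \<noteq> x" "a \<noteq> y" using that xy by blast+
      then show ?thesis using ne by (simp add: t_def r_def)
    qed
    then show "(r (t a), a) \<in> conn (E \<union> ?L')" if "a \<in> \<Union>E" for a using that by simp
    show "t a \<in> \<Union>?E" if "a \<in> \<Union>E" for a using that by (simp add: t_def)
    show "finite (\<Union>E)" by (rule fin)
    show "\<Union>?L' \<subseteq> \<Union>E"
    proof
      fix a assume "a \<in> \<Union>?L'"
      then obtain b where b: "b \<in> \<Union>L" "a = relabel y p b" unfolding UL' by (elim imageE)
      have "b \<in> \<Union>?E" using L b(1) by blast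
      moreover have "b \<noteq> x" using b(1) xL by blast
      ultimately have "b = y \<or> b \<in> \<Union>E" by simp
      then show "a \<in> \<Union>E" using b(2) p by (simp add: relabel_def split: if_splits)
    qed
    show "t a \<notin> \<Union>?L \<and> r (t a) = a" if a: "a \<in> \<Union>E" "a \<notin> \<Union>?L'" for a
    proof -
      have "t a \<notin> \<Union>L" "t a \<noteq> p"
      proof -
        show "t a \<noteq> p" using ne by (simp add: t_def)
        have "a \<noteq> y" using a(1) xy by blast
        then have "relabel y p (t a) = a" by (simp add: t_def relabel_def)
        then show "t a \<notin> \<Union>L" using a(2) unfolding UL' by (metis imageI)
      qed
      moreover have "t a \<noteq> x" using a(1) xy by (metis fun_upd_apply id_apply t_def)
      ultimately show ?thesis using rt'[OF a(1)] by simp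
    qed
  qed
  have "image (image r) ` C = image (image (relabel y p)) ` C"
  proof (intro image_cong refl)
    fix c e z assume "c \<in> C" "e \<in> c" "z \<in> e"
    then have "z \<in> \<Union>(\<Union>C)" by auto
    then have "z \<notin> \<Union>?L" using C by blast
    then have "z \<noteq> x" by simp
    then show "r z = relabel y p z" by (rule rt)
  qed
  then show ?thesis using realizes_transfer[OF h1 h2 C] by simp
qed

text \<open>Here \<open>E'\<close> is the result of contracting \<open>T\<close> in
  \<open>E\<close>. The links of \<open>L\<close> end at survivors of \<open>T\<close>, so they cut
  a path into pieces within \<open>E\<close> and \<open>T\<close>, and a piece between two survivors
  is trivial or an edge of \<open>E'\<close>.\<close>

lemma conn_contract:
  assumes U: "\<Union>E' = \<Union>E - \<Union>T" and L: "\<Union>L \<subseteq> \<Union>E'"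
    and E': "\<And>d d'. d \<in> \<Union>E' \<Longrightarrow> d' \<in> \<Union>E' \<Longrightarrow> (d, d') \<in> conn (E \<union> T) \<longleftrightarrow> d = d' \<or> {d, d'} \<in> E'"
    and d: "d \<in> \<Union>E'" "d' \<in> \<Union>E'"
  shows "(d, d') \<in> conn (E \<union> (T \<union> L)) \<longleftrightarrow> (d, d') \<in> conn (E' \<union> L)"
proof
  \<comment> \<open>The invariant along the path: \<open>e\<close> is the survivor after which only
    edges of \<open>E\<close> and links of \<open>T\<close> were used, and up to \<open>e\<close>
    the path is already contracted.\<close>
  have reach: "\<exists>e\<in>\<Union>E'. (d, e) \<in> conn (E' \<union> L) \<and> (e, z) \<in> conn (E \<union> T)"
    if "(d, z) \<in> conn (E \<union> (T \<union> L))" for z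
    using that
  proof (induction rule: rtrancl_induct)
    case (step z z')
    then obtain e where e: "e \<in> \<Union>E'" "(d, e) \<in> conn (E' \<union> L)" "(e, z) \<in> conn (E \<union> T)" by auto
    show ?case
    proof (cases "{z, z'} \<in> E \<union> T")
      case True
      then have "(e, z') \<in> conn (E \<union> T)" using e(3) by (meson conn_edge rtrancl_trans)
      then show ?thesis using e by auto
    next
      case False
      then have l: "{z, z'} \<in> L" using step by (auto simp: adj_def)
      then have z: "z \<in> \<Union>E'" "z' \<in> \<Union>E'" using L by auto
      then have "e = z \<or> {e, z} \<in> E'" using E' e by blast
      then have "(e, z) \<in> conn (E' \<union> L)" by (auto intro: conn_edge)
      moreover have "(z, z') \<in> conn (E' \<union> L)" using l by (auto intro: conn_edge)
      ultimately show ?thesis using e z by (meson rtrancl_trans rtrancl.rtrancl_refl)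
    qed
  qed (use d in auto)
  then show "(d, d') \<in> conn (E' \<union> L)" if dd: "(d, d') \<in> conn (E \<union> (T \<union> L))"
  proof -
    obtain e where e: "e \<in> \<Union>E'" "(d, e) \<in> conn (E' \<union> L)" "(e, d') \<in> conn (E \<union> T)"
      using reach[OF dd] by blast
    then have "e = d' \<or> {e, d'} \<in> E'" using E' d by blast
    then have "(e, d') \<in> conn (E' \<union> L)" by (auto intro: conn_edge)
    then show ?thesis using e by (meson rtrancl_trans)
  qed
  show "(d, d') \<in> conn (E \<union> (T \<union> L))" if "(d, d') \<in> conn (E' \<union> L)"
  proof -
    have "(id a, id b) \<in> conn (E \<union> (T \<union> L))" if ab: "{a, b} \<in> E' \<union> L" for a b
    proof (cases "{a, b} \<in> L")
      case False
      then have "{a, b} \<in> E'" using ab by auto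
      then have "(a, b) \<in> conn (E \<union> T)" using E' by blast
      then show ?thesis using conn_mono[of "E \<union> T" "E \<union> (T \<union> L)" a b] by auto
    qed (auto intro: conn_edge)
    from conn_map[OF that this] show ?thesis by simp
  qed
qed

text \<open>The closed arcs are of two kinds. Those missing all half-edges of \<open>E'\<close> are
  the circles already created by \<open>T\<close>; the others correspond, by intersection with these
  half-edges, to the closed arcs of the second contraction.\<close>

lemma closed_arcs_contract:
  assumes fin: "finite (\<Union>E)" and T: "\<Union>T \<subseteq> \<Union>E"
    and U: "\<Union>E' = \<Union>E - \<Union>T" and L: "\<Union>L \<subseteq> \<Union>E'"
    and E': "\<And>d d'. d \<in> \<Union>E' \<Longrightarrow> d' \<in> \<Union>E' \<Longrightarrow> (d, d') \<in> conn (E \<union> T) \<longleftrightarrow> d = d' \<or> {d, d'} \<in> E'"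
  shows "closed_arcs E (T \<union> L) = closed_arcs E T + closed_arcs E' L"
proof -
  let ?R = "conn (E \<union> (T \<union> L))" and ?R' = "conn (E' \<union> L)" and ?RT = "conn (E \<union> T)"
  note agree = conn_contract[OF U L E']
  let ?X = "{Q \<in> \<Union>E // ?R. Q \<subseteq> \<Union>(T \<union> L)}"
  let ?Y = "{Q \<in> ?X. Q \<inter> \<Union>E' = {}}" and ?Z = "{Q \<in> ?X. Q \<inter> \<Union>E' \<noteq> {}}"
  have finX: "finite ?X"
  proof -
    have "finite (\<Union>E // ?R)" unfolding quotient_def using fin by (intro finite_UN_I) auto
    then show ?thesis by simp
  qed
  have dom: "y \<in> \<Union>E" if "(x, y) \<in> ?R" "x \<in> \<Union>E" for x y
    using conn_Union[OF that(1)] that(2) T L U by auto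
  have sub: "?RT `` {x} \<subseteq> ?R `` {x}" for x
    using conn_mono[of "E \<union> T" "E \<union> (T \<union> L)"] by auto
  \<comment> \<open>An arc that stays inside the links of \<open>T\<close> never meets a link of
    \<open>L\<close>, so adding \<open>L\<close> does not enlarge it.\<close>
  have same: "?R `` {x} = ?RT `` {x}" if "?RT `` {x} \<subseteq> \<Union>T" for x
  proof -
    have "(x, y) \<in> ?RT" if "(x, y) \<in> ?R" for y
      using that
    proof (induction rule: rtrancl_induct)
      case (step y z)
      then have "y \<in> \<Union>T" using \<open>?RT `` {x} \<subseteq> \<Union>T\<close> by auto
      then have "{y, z} \<notin> L" using L U by auto
      then have "(y, z) \<in> ?RT" using step by (auto simp: adj_def)
      then show ?case using step by (meson rtrancl_trans)
    qed simp
    then show ?thesis using sub by auto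
  qed
  have "?Y = {Q \<in> \<Union>E // ?RT. Q \<subseteq> \<Union>T}" (is "_ = ?W")
  proof (intro equalityI subsetI)
    fix Q assume "Q \<in> ?Y"
    then obtain x where x: "x \<in> \<Union>E" "Q = ?R `` {x}" "Q \<subseteq> \<Union>(T \<union> L)" "Q \<inter> \<Union>E' = {}"
      by (auto elim!: quotientE)
    then have T: "Q \<subseteq> \<Union>T" using L unfolding Union_Un_distrib by blast
    then have "Q = ?RT `` {x}" using x(2) same[of x] sub[of x] by blast
    then show "Q \<in> ?W" using T quotientI[OF x(1), of ?RT] by simp
  next
    fix Q assume "Q \<in> ?W"
    then obtain x where x: "x \<in> \<Union>E" "Q = ?RT `` {x}" "Q \<subseteq> \<Union>T" by (auto elim!: quotientE)
    then have "Q = ?R `` {x}" using same by auto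
    then show "Q \<in> ?Y" using quotientI[OF x(1), of ?R] x(3) U by auto
  qed
  then have cY: "card ?Y = closed_arcs E T" by (simp add: closed_arcs_def)
  have cl: "?R `` {x} \<inter> \<Union>E' = ?R' `` {x}" if "x \<in> \<Union>E'" for x
  proof -
    have "y \<in> \<Union>E'" if "(x, y) \<in> ?R'" for y
      using conn_Union[OF that] \<open>x \<in> \<Union>E'\<close> L by auto
    then show ?thesis using agree that by auto
  qed
  have rep: "\<exists>x\<in>\<Union>E'. Q = ?R `` {x}" if Q: "Q \<in> ?Z" for Q
  proof -
    obtain x y where x: "x \<in> \<Union>E" "Q = ?R `` {x}" "y \<in> Q" "y \<in> \<Union>E'"
      using Q by (auto elim!: quotientE)
    then have "(x, y) \<in> ?R" by auto
    then show ?thesis using x conn_class_eq by metis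
  qed
  have "bij_betw (\<lambda>Q. Q \<inter> \<Union>E') ?Z {Q \<in> \<Union>E' // ?R'. Q \<subseteq> \<Union>L}" (is "bij_betw ?f _ ?V")
    unfolding bij_betw_def
  proof
    show "inj_on ?f ?Z"
    proof (rule inj_onI)
      fix Q1 Q2 assume a: "Q1 \<in> ?Z" "Q2 \<in> ?Z" "Q1 \<inter> \<Union>E' = Q2 \<inter> \<Union>E'"
      obtain x y where x: "x \<in> \<Union>E'" "Q1 = ?R `` {x}" "Q2 = ?R `` {y}"
        using rep[OF a(1)] rep[OF a(2)] by auto
      then have "x \<in> Q2" using a(3) by auto
      then have "(y, x) \<in> ?R" using x by auto
      then show "Q1 = Q2" using x conn_class_eq by metis
    qed
    show "?f ` ?Z = ?V"
    proof (intro equalityI subsetI)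
      fix P assume "P \<in> ?f ` ?Z"
      then obtain Q where Q: "Q \<in> ?Z" "P = Q \<inter> \<Union>E'" by auto
      obtain x where x: "x \<in> \<Union>E'" "Q = ?R `` {x}" using rep[OF Q(1)] by auto
      have "P = ?R' `` {x}" using Q x cl by auto
      moreover have "P \<subseteq> \<Union>L" using Q U by auto
      ultimately show "P \<in> ?V" using x by (auto intro: quotientI)
    next
      fix P assume "P \<in> ?V"
      then obtain x where x: "x \<in> \<Union>E'" "P = ?R' `` {x}" "P \<subseteq> \<Union>L" by (auto elim!: quotientE)
      have P: "P = ?f (?R `` {x})" using x cl by auto
      have xE: "x \<in> \<Union>E" using x U by auto
      have "?R `` {x} \<subseteq> \<Union>E" using dom xE by auto
      then have "?R `` {x} \<subseteq> \<Union>(T \<union> L)" using P x(3) U by auto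
      moreover have "x \<in> ?R `` {x}" by simp
      ultimately have "?R `` {x} \<in> ?Z" using x(1) xE by (auto intro: quotientI)
      then show "P \<in> ?f ` ?Z" using P by blast
    qed
  qed
  then have cZ: "card ?Z = closed_arcs E' L" unfolding closed_arcs_def by (rule bij_betw_same_card)
  have "?X = ?Y \<union> ?Z" "?Y \<inter> ?Z = {}" by auto
  then have "card ?X = card ?Y + card ?Z" using finX by (metis (no_types, lifting) card_Un_disjoint finite_Un)
  then show ?thesis using cY cZ by (simp add: closed_arcs_def)
qed

text \<open>Both sides have the same survivors and the same connections among them; the circles made
  by \<open>T\<close> move into the explicit count.\<close>

lemma realizes_contract:
  assumes fin: "finite (\<Union>E)" and T: "\<Union>T \<subseteq> \<Union>E"
    and U: "\<Union>E' = \<Union>E - \<Union>T" and L: "\<Union>L \<subseteq> \<Union>E'" and wfK: "\<forall>d\<in>halves K. mate K d \<in> halves K"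
    and E': "\<And>d d'. d \<in> \<Union>E' \<Longrightarrow> d' \<in> \<Union>E' \<Longrightarrow> (d, d') \<in> conn (E \<union> T) \<longleftrightarrow> d = d' \<or> {d, d'} \<in> E'"
  shows "realizes K E (T \<union> L) C n \<longleftrightarrow> realizes K E' L C (n + closed_arcs E T)"
proof -
  have D: "\<Union>E - \<Union>(T \<union> L) = \<Union>E' - \<Union>L" using U by auto
  have key: "(g d, g (mate K d)) \<in> conn (E \<union> (T \<union> L)) \<longleftrightarrow> (g d, g (mate K d)) \<in> conn (E' \<union> L)"
    if g: "bij_betw g (halves K) (\<Union>E' - \<Union>L)" and d: "d \<in> halves K" for g d
  proof -
    have "g d \<in> \<Union>E'" "g (mate K d) \<in> \<Union>E'"
      using bij_betwE[OF g] d wfK by blast+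
    then show ?thesis using conn_contract[OF U L E'] by simp
  qed
  have c: "closed_arcs E (T \<union> L) = closed_arcs E T + closed_arcs E' L"
    by (rule closed_arcs_contract[OF fin T U L E'])
  show ?thesis
    unfolding realizes_def D by (simp add: c key add.assoc cong: conj_cong)
qed

text \<open>This complements \<open>realizes_contract_link\<close>: the link joins the two ends of
  its own edge. Edge and link are then the same two-element set, present in both \<open>E\<close>
  and \<open>L\<close>, and they close up to one circle.\<close>

lemma realizes_contract_circle:
  assumes fin: "finite (\<Union>E)" and L: "\<Union>L \<subseteq> \<Union>E" and wfK: "\<forall>d\<in>halves K. mate K d \<in> halves K"
    and xy: "x \<notin> \<Union>E" "y \<notin> \<Union>E" and E: "\<And>d d'. (d, d') \<in> conn E \<longleftrightarrow> d = d' \<or> {d, d'} \<in> E"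
  shows "realizes K (insert {x, y} E) (insert {x, y} L) C n \<longleftrightarrow> realizes K E L C (Suc n)"
proof -
  let ?E = "insert {x, y} E" and ?T = "{{x, y}}"
  have ET: "?E \<union> ?T = insert {x, y} E" by auto
  have c1: "d' \<in> {x, y}" if "(d, d') \<in> conn ?E" "d \<in> {x, y}" for d d'
    using that(1)
  proof (induction rule: rtrancl_induct)
    case (step y z) then show ?case using xy by (auto simp: adj_def doubleton_eq_iff)
  qed (use that in auto)
  have c2: "(d, d') \<in> conn E" if "(d, d') \<in> conn ?E" "d \<in> \<Union>E" for d d'
    using that(1)
  proof (induction rule: rtrancl_induct)
    case (step y z)
    then have "y \<in> \<Union>E" using that(2) conn_Union by blast
    then have "{y, z} \<in> E" using step xy by (auto simp: adj_def doubleton_eq_iff)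
    then show ?case using step by (meson conn_edge rtrancl_trans)
  qed simp
  have mono: "(d, d') \<in> conn E \<Longrightarrow> (d, d') \<in> conn ?E" for d d' using conn_mono[of E ?E] by auto
  have x: "conn ?E `` {x} = {x, y}" using c1 by (auto intro: conn_edge)
  moreover have "conn ?E `` {y} = {x, y}" using c1 by (auto intro: conn_edge simp: insert_commute)
  moreover have "conn ?E `` {d} \<subseteq> {x, y} \<longleftrightarrow> d \<in> {x, y}" for d using c1 by auto
  ultimately have "{Q \<in> \<Union>?E // conn (?E \<union> ?T). Q \<subseteq> \<Union>?T} = {{x, y}}"
    unfolding ET quotient_def by auto
  then have c: "closed_arcs ?E ?T = 1" by (simp add: closed_arcs_def)
  have "realizes K ?E (?T \<union> L) C n \<longleftrightarrow> realizes K E L C (n + closed_arcs ?E ?T)"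
  proof (rule realizes_contract)
    show "(d, d') \<in> conn (?E \<union> ?T) \<longleftrightarrow> d = d' \<or> {d, d'} \<in> E" if "d \<in> \<Union>E" for d d'
      unfolding ET using c2[OF _ that] mono E by blast
    show "\<Union>E = \<Union>?E - \<Union>?T" using xy by auto
  qed (use fin L wfK in auto)
  then show ?thesis using c by simp
qed

section \<open>Matchings and splicing\<close>

definition matching :: "nat set set \<Rightarrow> bool" where
  "matching X \<longleftrightarrow> (\<forall>e\<in>X. \<exists>x y. x \<noteq> y \<and> e = {x, y}) \<and> (\<forall>x y z. {x, y} \<in> X \<longrightarrow> {x, z} \<in> X \<longrightarrow> y = z)"

lemma matchingI:
  assumes "\<And>e. e \<in> X \<Longrightarrow> \<exists>x y. x \<noteq> y \<and> e = {x, y}"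
    and "\<And>x y z. {x, y} \<in> X \<Longrightarrow> {x, z} \<in> X \<Longrightarrow> y = z"
  shows "matching X"
  using assms by (simp add: matching_def)

lemma matching_doubleton: "matching X \<Longrightarrow> e \<in> X \<Longrightarrow> \<exists>x y. x \<noteq> y \<and> e = {x, y}"
  by (simp add: matching_def)

lemma matching_unique: "matching X \<Longrightarrow> {x, y} \<in> X \<Longrightarrow> {x, z} \<in> X \<Longrightarrow> y = z"
  by (simp add: matching_def)

lemma matching_neq: "matching X \<Longrightarrow> {x, y} \<in> X \<Longrightarrow> x \<noteq> y"
  using matching_doubleton[of X "{x, y}"] by auto

lemma matching_at:
  assumes "matching X" "e \<in> X" "x \<in> e"
  obtains y where "e = {x, y}" "x \<noteq> y"
proof -
  obtain a b where ab: "a \<noteq> b" "e = {a, b}" using matching_doubleton[OF assms(1,2)] by auto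
  with assms(3) have "x = a \<or> x = b" by simp
  then show thesis
  proof
    assume "x = b"
    then show thesis using that[of a] ab by (simp add: insert_commute)
  qed (use that[of b] ab in simp)
qed

lemma matching_partner:
  assumes "matching X" "x \<in> \<Union>X"
  obtains y where "{x, y} \<in> X" "x \<noteq> y"
  using assms matching_at[OF assms(1)] by (metis UnionE)

lemma conn_matching:
  assumes "matching X"
  shows "(d, d') \<in> conn X \<longleftrightarrow> d = d' \<or> {d, d'} \<in> X"
proof
  show "d = d' \<or> {d, d'} \<in> X" if "(d, d') \<in> conn X"
    using that
  proof (induction rule: rtrancl_induct)
    case (step y z)
    then have z: "{y, z} \<in> X" by (simp add: adj_def)
    show ?case
    proof (cases "d = y")
      case False
      then have "{y, d} \<in> X" using step by (simp add: insert_commute)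
      then show ?thesis using matching_unique[OF assms] z by blast
    qed (use z in auto)
  qed simp
qed (auto intro: conn_edge)

lemma matching_subset: "matching X \<Longrightarrow> Y \<subseteq> X \<Longrightarrow> matching Y"
  unfolding matching_def by (meson subsetD)

lemma matching_insert:
  assumes "matching X" "x \<noteq> y" "x \<notin> \<Union>X" "y \<notin> \<Union>X"
  shows "matching (insert {x, y} X)"
proof (rule matchingI)
  show "\<exists>a b. a \<noteq> b \<and> e = {a, b}" if "e \<in> insert {x, y} X" for e
    using that assms(2) matching_doubleton[OF assms(1)] by auto
  fix a b c assume bc: "{a, b} \<in> insert {x, y} X" "{a, c} \<in> insert {x, y} X"
  show "b = c"
  proof (cases "a \<in> {x, y}")
    case True
    then have "{a, b} \<notin> X" "{a, c} \<notin> X" using assms by auto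
    then have "{a, b} = {x, y}" "{a, c} = {x, y}" using bc by auto
    then show ?thesis using assms(2) by (metis doubleton_eq_iff)
  next
    case False
    then have "{a, b} \<noteq> {x, y}" "{a, c} \<noteq> {x, y}" by auto
    then show ?thesis using matching_unique[OF assms(1), of a b c] bc by simp
  qed
qed

lemma matching_disjoint:
  assumes m: "matching X" and e: "e \<in> X" "x \<in> e"
  shows "x \<notin> \<Union>(X - {e})"
proof
  assume "x \<in> \<Union>(X - {e})"
  then obtain f where f: "f \<in> X" "f \<noteq> e" "x \<in> f" by auto
  obtain y where "e = {x, y}" using matching_at[OF m e] .
  moreover obtain z where "f = {x, z}" using matching_at[OF m f(1,3)] .
  ultimately show False using matching_unique[OF m, of x y z] e f by simp
qed

lemma matching_remove_Union:
  assumes "matching X" "e \<in> X"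
  shows "\<Union>(X - {e}) = \<Union>X - e"
  using matching_disjoint[OF assms] by blast

text \<open>Links are contracted one by one. This produces the matching \<open>E'\<close> that the
  contraction lemmas take as given, and later shows that \<open>splice\<close> pairs the
  survivors.\<close>

lemma exists_contraction:
  assumes "finite T" "matching T" "matching E" "\<Union>T \<subseteq> \<Union>E"
  shows "\<exists>E'. matching E' \<and> \<Union>E' = \<Union>E - \<Union>T \<and>
    (\<forall>d\<in>\<Union>E'. \<forall>d'\<in>\<Union>E'. (d, d') \<in> conn (E \<union> T) \<longleftrightarrow> d = d' \<or> {d, d'} \<in> E')"
  using assms
proof (induction T arbitrary: E rule: finite_induct)
  case empty
  then show ?case by (intro exI[of _ E]) (auto simp: conn_matching)
next
  case (insert e T)
  have mT: "matching T" by (rule matching_subset[OF insert.prems(1)]) auto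
  obtain x p where e: "e = {x, p}" "x \<noteq> p"
    using matching_doubleton[OF insert.prems(1), of e] by auto
  have UT: "x \<notin> \<Union>T" "p \<notin> \<Union>T"
    using matching_disjoint[OF insert.prems(1), of e] insert.hyps(2) e by auto
  have xE: "x \<in> \<Union>E" "p \<in> \<Union>E" using insert.prems(3) e by auto
  obtain y where y: "{x, y} \<in> E" "x \<noteq> y" using matching_partner[OF insert.prems(2) xE(1)] .
  obtain z where z: "{p, z} \<in> E" "p \<noteq> z" using matching_partner[OF insert.prems(2) xE(2)] .
  obtain E1 where E1: "matching E1" "\<Union>E1 = \<Union>E - {x, p}"
    "\<And>d d'. d \<in> \<Union>E1 \<Longrightarrow> d' \<in> \<Union>E1 \<Longrightarrow>
      (d, d') \<in> conn (E \<union> insert e T) \<longleftrightarrow> (d, d') \<in> conn (E1 \<union> T)"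
  proof (cases "y = p")
    \<comment> \<open>The link joins the ends of one edge: the edge becomes a circle and
      disappears.\<close>
    case True
    define E1 where "E1 = E - {{x, p}}"
    define r where "r = (id :: nat \<Rightarrow> nat)(p := x)"
    have m: "matching E1" unfolding E1_def by (rule matching_subset[OF insert.prems(2)]) auto
    have U: "\<Union>E1 = \<Union>E - {x, p}"
      unfolding E1_def using matching_remove_Union[OF insert.prems(2)] y True by blast
    have rid: "r a = a" if "a \<noteq> p" for a using that by (simp add: r_def)
    have map: "(r a, r b) \<in> conn (E1 \<union> T)" if ab: "{a, b} \<in> E \<union> insert e T" for a b
    proof (cases "{a, b} = {x, p}")
      case True
      then have "r a = r b" using e by (auto simp: r_def doubleton_eq_iff)
      then show ?thesis by simp
    next
      case False
      then have ab': "{a, b} \<in> E1 \<union> T" using ab e by (auto simp: E1_def)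
      have "p \<notin> \<Union>(E1 \<union> T)" using U UT by auto
      then have "a \<noteq> p" "b \<noteq> p" using ab' by blast+
      then show ?thesis using rid ab' by (auto intro: conn_edge)
    qed
    have "(d, d') \<in> conn (E \<union> insert e T) \<longleftrightarrow> (d, d') \<in> conn (E1 \<union> T)"
      if d: "d \<in> \<Union>E1" "d' \<in> \<Union>E1" for d d'
    proof
      assume "(d, d') \<in> conn (E \<union> insert e T)"
      then have "(r d, r d') \<in> conn (E1 \<union> T)" by (rule conn_map) (rule map)
      moreover have "d \<noteq> p" "d' \<noteq> p" using d U by auto
      ultimately show "(d, d') \<in> conn (E1 \<union> T)" using rid by simp
    next
      show "(d, d') \<in> conn (E1 \<union> T) \<Longrightarrow> (d, d') \<in> conn (E \<union> insert e T)"
        by (rule conn_mono) (auto simp: E1_def)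
    qed
    then show thesis using that m U by blast
  next
    case False
    \<comment> \<open>The link joins two different edges, which merge into one edge between their
      far ends \<open>y\<close> and \<open>z\<close>.\<close>
    define E0 where "E0 = E - {{x, y}} - {{p, z}}"
    define E1 where "E1 = insert {y, z} E0"
    define r where "r = (id :: nat \<Rightarrow> nat)(x := y, p := z)"
    have zx: "z \<noteq> x"
      using z y False matching_unique[OF insert.prems(2), of x y p] by (auto simp: insert_commute)
    have yz: "y \<noteq> z"
      using z y e matching_unique[OF insert.prems(2), of y x p] by (auto simp: insert_commute)
    have m0: "matching (E - {{x, y}})" by (rule matching_subset[OF insert.prems(2)]) auto
    have U0: "\<Union>E0 = \<Union>E - {x, y, p, z}"
    proof -
      have "{p, z} \<in> E - {{x, y}}" using z zx e by (auto simp: doubleton_eq_iff)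
      then have "\<Union>E0 = \<Union>(E - {{x, y}}) - {p, z}"
        unfolding E0_def by (rule matching_remove_Union[OF m0])
      then show ?thesis using matching_remove_Union[OF insert.prems(2) y(1)] by auto
    qed
    have m: "matching E1" unfolding E1_def
    proof (rule matching_insert)
      show "matching E0" unfolding E0_def by (rule matching_subset[OF m0]) auto
    qed (use U0 yz in auto)
    have U: "\<Union>E1 = \<Union>E - {x, p}"
      using U0 y z zx False e unfolding E1_def by auto
    have rid: "r a = a" if "a \<noteq> x" "a \<noteq> p" for a using that by (simp add: r_def)
    have rx: "r x = y" "r p = z" "r y = y" "r z = z"
      using e y(2) z(2) zx False by (auto simp: r_def)
    have map: "(r a, r b) \<in> conn (E1 \<union> T)" if ab: "{a, b} \<in> E \<union> insert e T" for a b
    proof -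
      have yz1: "(y, z) \<in> conn (E1 \<union> T)" "(z, y) \<in> conn (E1 \<union> T)"
        by (auto intro!: conn_edge simp: E1_def insert_commute)
      consider "{a, b} = {x, p}" | "{a, b} = {x, y}" | "{a, b} = {p, z}" | "{a, b} \<in> E0 \<union> T"
        using ab e unfolding E0_def by blast
      then show ?thesis
      proof cases
        case 4
        have "x \<notin> \<Union>(E0 \<union> T)" "p \<notin> \<Union>(E0 \<union> T)" using U0 UT by auto
        then have "a \<noteq> x" "b \<noteq> x" "a \<noteq> p" "b \<noteq> p" using 4 by blast+
        then show ?thesis using rid 4 by (auto intro!: conn_edge simp: E1_def)
      qed (use yz1 in \<open>auto simp: doubleton_eq_iff rx\<close>)
    qed
    have yz2: "(y, z) \<in> conn (E \<union> insert e T)"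
    proof -
      have "(y, x) \<in> conn (E \<union> insert e T)" "(x, p) \<in> conn (E \<union> insert e T)" "(p, z) \<in> conn (E \<union> insert e T)"
        using y z e by (auto intro!: conn_edge simp: insert_commute)
      then show ?thesis by (meson rtrancl_trans)
    qed
    have map2: "(id a, id b) \<in> conn (E \<union> insert e T)" if ab: "{a, b} \<in> E1 \<union> T" for a b
    proof (cases "{a, b} = {y, z}")
      case True
      then show ?thesis using yz2 conn_sym[OF yz2] by (auto simp: doubleton_eq_iff)
    next
      case False
      then show ?thesis using ab by (auto intro!: conn_edge simp: E1_def E0_def)
    qed
    have "(d, d') \<in> conn (E \<union> insert e T) \<longleftrightarrow> (d, d') \<in> conn (E1 \<union> T)"
      if d: "d \<in> \<Union>E1" "d' \<in> \<Union>E1" for d d'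
    proof
      assume "(d, d') \<in> conn (E \<union> insert e T)"
      then have "(r d, r d') \<in> conn (E1 \<union> T)" by (rule conn_map) (rule map)
      moreover have "r d = d" "r d' = d'" using d U by (auto intro!: rid)
      ultimately show "(d, d') \<in> conn (E1 \<union> T)" by simp
    next
      assume "(d, d') \<in> conn (E1 \<union> T)"
      then have "(id d, id d') \<in> conn (E \<union> insert e T)" by (rule conn_map) (rule map2)
      then show "(d, d') \<in> conn (E \<union> insert e T)" by simp
    qed
    then show thesis using that m U by blast
  qed
  have sub: "\<Union>T \<subseteq> \<Union>E1" using E1(2) insert.prems(3) UT by auto
  obtain E' where E': "matching E'" "\<Union>E' = \<Union>E1 - \<Union>T"
    "\<forall>d\<in>\<Union>E'. \<forall>d'\<in>\<Union>E'. (d, d') \<in> conn (E1 \<union> T) \<longleftrightarrow> d = d' \<or> {d, d'} \<in> E'"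
    using insert.IH[OF mT E1(1) sub] by blast
  have "\<Union>E' = \<Union>E - \<Union>(insert e T)" using E'(2) E1(2) e by auto
  moreover have "\<forall>d\<in>\<Union>E'. \<forall>d'\<in>\<Union>E'. (d, d') \<in> conn (E \<union> insert e T) \<longleftrightarrow> d = d' \<or> {d, d'} \<in> E'"
  proof (intro ballI)
    fix d d' assume d: "d \<in> \<Union>E'" "d' \<in> \<Union>E'"
    then have "d \<in> \<Union>E1" "d' \<in> \<Union>E1" unfolding E'(2) by blast+
    then have "(d, d') \<in> conn (E \<union> insert e T) \<longleftrightarrow> (d, d') \<in> conn (E1 \<union> T)" by (rule E1(3))
    then show "(d, d') \<in> conn (E \<union> insert e T) \<longleftrightarrow> d = d' \<or> {d, d'} \<in> E'"
      using bspec[OF bspec[OF E'(3) d(1)] d(2)] by (rule trans)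
  qed
  ultimately show ?case using E'(1) by (intro exI[of _ E'] conjI)
qed

section \<open>Pairings, edges and crossings of framed graphs\<close>

lemma links_iff:
  assumes "pairing_on A s"
  shows "{x, y} \<in> links A s \<longleftrightarrow> x \<in> A \<and> y = s x"
  using assms by (auto simp: links_def pairing_on_def doubleton_eq_iff)

lemma Union_links: "pairing_on A s \<Longrightarrow> \<Union>(links A s) = A"
  by (auto simp: links_def pairing_on_def)

lemma matching_links:
  assumes "pairing_on A s"
  shows "matching (links A s)"
proof (rule matchingI)
  show "\<exists>x y. x \<noteq> y \<and> e = {x, y}" if "e \<in> links A s" for e
    using that assms unfolding links_def pairing_on_def by force
qed (simp add: links_iff[OF assms])

lemma framed_mate: "framed_4_graph G \<Longrightarrow> pairing_on (halves G) (mate G)"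
  by (simp add: framed_4_graph_def)

lemma framed_opp: "framed_4_graph G \<Longrightarrow> v \<in> verts G \<Longrightarrow> pairing_on (halves_at G {v}) (opp G)"
  by (simp add: framed_4_graph_def)

lemma framed_finite: "framed_4_graph G \<Longrightarrow> finite (verts G)" "framed_4_graph G \<Longrightarrow> finite (halves G)"
  by (simp_all add: framed_4_graph_def)

lemma framed_card: "framed_4_graph G \<Longrightarrow> v \<in> verts G \<Longrightarrow> card (halves_at G {v}) = 4"
  by (simp add: framed_4_graph_def)

lemma framed_vertex: "framed_4_graph G \<Longrightarrow> d \<in> halves G \<Longrightarrow> vertex G d \<in> verts G"
  by (simp add: framed_4_graph_def)

lemma Union_edges: "framed_4_graph G \<Longrightarrow> \<Union>(edges G) = halves G"
  by (simp add: edges_def Union_links framed_mate)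

lemma matching_edges: "framed_4_graph G \<Longrightarrow> matching (edges G)"
  by (simp add: edges_def matching_links framed_mate)

lemma edges_iff: "framed_4_graph G \<Longrightarrow> {x, y} \<in> edges G \<longleftrightarrow> x \<in> halves G \<and> y = mate G x"
  by (simp add: edges_def links_iff framed_mate)

lemma Union_crossing: "framed_4_graph G \<Longrightarrow> v \<in> verts G \<Longrightarrow> \<Union>(crossing G v) = halves_at G {v}"
  by (simp add: crossing_def Union_links framed_opp)

lemma crossing_iff:
  "framed_4_graph G \<Longrightarrow> v \<in> verts G \<Longrightarrow> {x, y} \<in> crossing G v \<longleftrightarrow> x \<in> halves_at G {v} \<and> y = opp G x"
  by (simp add: crossing_def links_iff framed_opp)

lemma halves_at_nonempty: "framed_4_graph G \<Longrightarrow> v \<in> verts G \<Longrightarrow> halves_at G {v} \<noteq> {}"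
  using framed_card by fastforce

lemma crossing_nonempty: "framed_4_graph G \<Longrightarrow> v \<in> verts G \<Longrightarrow> crossing G v \<noteq> {}"
  using halves_at_nonempty by (simp add: crossing_def links_def)

lemma pairing_on_halves_at:
  assumes "\<And>v. v \<in> S \<Longrightarrow> pairing_on (halves_at G {v}) s"
  shows "pairing_on (halves_at G S) s"
  unfolding pairing_on_def
proof
  fix d assume d: "d \<in> halves_at G S"
  then have "d \<in> halves_at G {vertex G d}" "vertex G d \<in> S" by (auto simp: halves_at_def)
  then have "s d \<in> halves_at G {vertex G d} \<and> s d \<noteq> d \<and> s (s d) = d"
    using assms unfolding pairing_on_def by blast
  then show "s d \<in> halves_at G S \<and> s d \<noteq> d \<and> s (s d) = d"
    using \<open>vertex G d \<in> S\<close> by (auto simp: halves_at_def)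
qed

text \<open>One setting for both uses of \<open>splice\<close>: decreasing moves, where
  \<open>s\<close> is the framing, and smoothings, where \<open>s\<close> avoids it.\<close>

locale splicing =
  fixes G S s
  assumes G: "framed_4_graph G" and S: "S \<subseteq> verts G"
    and s: "\<And>v. v \<in> S \<Longrightarrow> pairing_on (halves_at G {v}) s"
begin

abbreviation "H \<equiv> splice S s G"
abbreviation "T \<equiv> links (halves_at G S) s"

lemma pairing: "pairing_on (halves_at G S) s"
  using s by (rule pairing_on_halves_at)

lemma Union_T: "\<Union>T = halves_at G S"
  by (rule Union_links[OF pairing])

lemma arc_rel_adj: "arc_rel S s G = adj (edges G \<union> T)"
  using edges_iff[OF G] links_iff[OF pairing] by (auto simp: arc_rel_def adj_def)

lemma verts_H: "verts H = verts G - S" and halves_H: "halves H = halves G - halves_at G S"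
  and vertex_H: "vertex H = vertex G" and opp_H: "opp H = opp G"
  by (simp_all add: splice_def)

lemma halves_at_H: "v \<notin> S \<Longrightarrow> halves_at H {v} = halves_at G {v}"
  by (auto simp: halves_at_def halves_H vertex_H)

lemma crossing_H: "v \<notin> S \<Longrightarrow> crossing H v = crossing G v"
  by (simp add: crossing_def halves_at_H opp_H)

lemma circles_H: "circles H = circles G + closed_arcs (edges G) T"
  unfolding closed_arcs_def by (simp add: splice_def arc_rel_adj Union_T Union_edges[OF G])

text \<open>The matching from \<open>exists_contraction\<close> gives every survivor exactly one
  other survivor on its arc. Hence the definite description in \<open>splice\<close> denotes that
  partner.\<close>

lemma contraction:
  "pairing_on (halves H) (mate H)"
  "d \<in> halves H \<Longrightarrow> d' \<in> halves H \<Longrightarrow>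
    (d, d') \<in> conn (edges G \<union> T) \<longleftrightarrow> d = d' \<or> {d, d'} \<in> edges H"
proof -
  have "finite (halves_at G S)" using framed_finite[OF G] by (auto simp: halves_at_def)
  then have fT: "finite T" by (simp add: links_def)
  have "\<Union>T \<subseteq> \<Union>(edges G)" unfolding Union_T Union_edges[OF G] by (auto simp: halves_at_def)
  then obtain E' where E': "matching E'" "\<Union>E' = halves H"
    "\<forall>d\<in>\<Union>E'. \<forall>d'\<in>\<Union>E'. (d, d') \<in> conn (edges G \<union> T) \<longleftrightarrow> d = d' \<or> {d, d'} \<in> E'"
    using exists_contraction[OF fT matching_links[OF pairing] matching_edges[OF G]]
    unfolding Union_T Union_edges[OF G] halves_H by blast
  have m: "mate H d = d'" if "{d, d'} \<in> E'" for d d'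
  proof -
    have d: "d \<in> halves H" "d' \<in> halves H" using that E'(2) by auto
    have "mate H d = (THE d'. d' \<in> halves H \<and> d' \<noteq> d \<and> (d, d') \<in> conn (edges G \<union> T))"
      by (simp add: splice_def arc_rel_adj)
    also have "\<dots> = d'"
    proof (rule the_equality)
      show "d' \<in> halves H \<and> d' \<noteq> d \<and> (d, d') \<in> conn (edges G \<union> T)"
        using d E' that matching_neq[OF E'(1) that] by auto
      show "d'' = d'" if "d'' \<in> halves H \<and> d'' \<noteq> d \<and> (d, d'') \<in> conn (edges G \<union> T)" for d''
      proof -
        have "{d, d''} \<in> E'" using that E' d by auto
        then show ?thesis using matching_unique[OF E'(1)] \<open>{d, d'} \<in> E'\<close> by blast
      qed
    qed
    finally show ?thesis .
  qed
  have p: "{d, mate H d} \<in> E'" if "d \<in> halves H" for d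
    using that E'(2) m matching_partner[OF E'(1), of d] by metis
  show pm: "pairing_on (halves H) (mate H)"
    unfolding pairing_on_def
  proof
    fix d assume d: "d \<in> halves H"
    have "{mate H d, d} \<in> E'" using p[OF d] by (simp add: insert_commute)
    then have "mate H (mate H d) = d" "mate H d \<noteq> d" "mate H d \<in> \<Union>E'"
      using m matching_neq[OF E'(1)] by blast+
    then show "mate H d \<in> halves H \<and> mate H d \<noteq> d \<and> mate H (mate H d) = d" using E'(2) by simp
  qed
  have "{d, d'} \<in> edges H \<longleftrightarrow> {d, d'} \<in> E'" if "d \<in> halves H" for d d'
    unfolding edges_def links_iff[OF pm] using m p that by auto
  then show "d \<in> halves H \<Longrightarrow> d' \<in> halves H \<Longrightarrow>
    (d, d') \<in> conn (edges G \<union> T) \<longleftrightarrow> d = d' \<or> {d, d'} \<in> edges H"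
    using E'(2,3) by simp
qed

lemma framed_H: "framed_4_graph H"
  unfolding framed_4_graph_def
proof (intro conjI ballI)
  show "pairing_on (halves H) (mate H)" by (rule contraction(1))
  show "vertex H d \<in> verts H" if "d \<in> halves H" for d
    using that framed_vertex[OF G] by (auto simp: vertex_H verts_H halves_H halves_at_def)
  show "card (halves_at H {v}) = 4" "pairing_on (halves_at H {v}) (opp H)" if "v \<in> verts H" for v
    using that framed_card[OF G] framed_opp[OF G] by (auto simp: verts_H halves_at_H opp_H)
qed (use framed_finite[OF G] in \<open>auto simp: verts_H halves_H\<close>)

text \<open>Splicing contracts \<open>T\<close> in advance, and \<open>circles H\<close> already
  contains the circles this creates; only \<open>L\<close> remains to be contracted.\<close>

lemma realizes_splice:
  assumes "\<Union>L \<subseteq> halves H" "framed_4_graph K"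
  shows "realizes K (edges G) (T \<union> L) C (circles G) \<longleftrightarrow> realizes K (edges H) L C (circles H)"
  unfolding circles_H
proof (rule realizes_contract)
  show "\<And>d d'. d \<in> \<Union> (edges H) \<Longrightarrow> d' \<in> \<Union> (edges H) \<Longrightarrow>
    (d, d') \<in> conn (edges G \<union> T) \<longleftrightarrow> d = d' \<or> {d, d'} \<in> edges H"
    unfolding Union_edges[OF framed_H] by (rule contraction(2))
  show "\<forall>d\<in>halves K. mate K d \<in> halves K"
    using framed_mate[OF assms(2)] by (simp add: pairing_on_def)
  show "\<Union>T \<subseteq> \<Union>(edges G)" unfolding Union_T Union_edges[OF G] by (auto simp: halves_at_def)
qed (use assms(1) framed_finite[OF G] in
    \<open>simp_all add: Union_edges[OF framed_H] Union_edges[OF G] Union_T halves_H\<close>)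

end

lemma splicing_opp: "framed_4_graph G \<Longrightarrow> T \<subseteq> verts G \<Longrightarrow> splicing G T (opp G)"
  by unfold_locales (use framed_opp in auto)

text \<open>A vertex with the empty value is kept. Besides the two smoothings, the value
  \<open>crossing G v\<close> is allowed: it passes straight through \<open>v\<close> and removes
  it.\<close>

definition resolves :: "fgraph \<Rightarrow> fgraph \<Rightarrow> (nat \<Rightarrow> nat set set) \<Rightarrow> bool" where
  "resolves K G l \<longleftrightarrow> realizes K (edges G) (\<Union>(l ` verts G))
     (crossing G ` {v \<in> verts G. l v = {}}) (circles G)"

lemma links_Union: "links (\<Union>(A ` I)) s = \<Union>((\<lambda>i. links (A i) s) ` I)"
  by (auto simp: links_def)

lemma halves_at_Union: "halves_at G S = \<Union>((\<lambda>v. halves_at G {v}) ` S)"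
  by (auto simp: halves_at_def)

text \<open>Removing vertices along the framing is a contraction of their crossings. Resolutions of
  the smaller diagram in a decreasing move thus become resolutions of the larger one.\<close>

lemma resolves_splice:
  assumes G: "framed_4_graph G" and T: "T \<subseteq> verts G" and K: "framed_4_graph K"
    and l: "\<And>v. v \<in> verts G - T \<Longrightarrow> \<Union>(l v) \<subseteq> halves_at G {v}"
  shows "resolves K (splice T (opp G) G) l \<longleftrightarrow>
    resolves K G (\<lambda>v. if v \<in> T then crossing G v else l v)"
proof -
  interpret splicing G T "opp G" by (rule splicing_opp) fact+
  let ?l = "\<lambda>v. if v \<in> T then crossing G v else l v"
  have "links (halves_at G T) (opp G) = \<Union>(crossing G ` T)"
    by (subst halves_at_Union) (simp add: links_Union crossing_def)
  then have 1: "\<Union>(?l ` verts G) = links (halves_at G T) (opp G) \<union> \<Union>(l ` verts H)"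
    using T by (auto simp: verts_H)
  \<comment> \<open>A crossing is a nonempty set of links, so no vertex of \<open>T\<close> is
    mistaken for a kept one.\<close>
  have "{v \<in> verts G. ?l v = {}} = {v \<in> verts H. l v = {}}"
    using T crossing_nonempty[OF G] by (auto simp: verts_H)
  then have 2: "crossing G ` {v \<in> verts G. ?l v = {}} = crossing H ` {v \<in> verts H. l v = {}}"
    using crossing_H by (auto simp: verts_H image_def)
  have "\<Union>(\<Union>(l ` verts H)) \<subseteq> halves H"
    using l by (fastforce simp: verts_H halves_H halves_at_def)
  from realizes_splice[OF this K] show ?thesis
    unfolding resolves_def 1 2 by simp
qed

section \<open>Resolutions and smoothings\<close>

lemma resolves_cong:
  assumes "\<And>v. v \<in> verts G \<Longrightarrow> l v = l' v"
  shows "resolves K G l \<longleftrightarrow> resolves K G l'"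
proof -
  have "l ` verts G = l' ` verts G" "{v \<in> verts G. l v = {}} = {v \<in> verts G. l' v = {}}"
    using assms by auto
  then show ?thesis by (simp add: resolves_def)
qed

lemma graph_iso_sym:
  assumes "framed_4_graph G" "graph_iso f g G H"
  shows "graph_iso (inv_into (verts G) f) (inv_into (halves G) g) H G"
proof -
  let ?f = "inv_into (verts G) f" and ?g = "inv_into (halves G) g"
  have f: "bij_betw f (verts G) (verts H)" and g: "bij_betw g (halves G) (halves H)"
    and c: "circles G = circles H"
    and i: "\<And>d. d \<in> halves G \<Longrightarrow> vertex H (g d) = f (vertex G d) \<and>
      opp H (g d) = g (opp G d) \<and> mate H (g d) = g (mate G d)"
    using assms(2) by (auto simp: graph_iso_def)
  have "vertex G (?g e) = ?f (vertex H e) \<and> opp G (?g e) = ?g (opp H e) \<and> mate G (?g e) = ?g (mate H e)"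
    if e: "e \<in> halves H" for e
  proof -
    obtain d where d: "d \<in> halves G" "e = g d" using g e by (auto simp: bij_betw_def)
    have v: "vertex G d \<in> verts G" using framed_vertex[OF assms(1)] d by simp
    have "d \<in> halves_at G {vertex G d}" using d by (simp add: halves_at_def)
    then have "opp G d \<in> halves_at G {vertex G d}"
      using framed_opp[OF assms(1) v] unfolding pairing_on_def by simp
    then have o: "opp G d \<in> halves G" by (simp add: halves_at_def)
    have m: "mate G d \<in> halves G" using framed_mate[OF assms(1)] d by (simp add: pairing_on_def)
    show ?thesis
      using d v o m i[OF d(1)] f g by (simp add: bij_betw_inv_into_left)
  qed
  then show ?thesis
    using f g c by (simp add: graph_iso_def bij_betw_inv_into)
qed

text \<open>Without links no circles arise and arcs are edges, so \<open>g\<close> respects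
  \<open>mate\<close>. The vertex map is not part of \<open>realizes\<close> and has to be recovered
  from the kept crossings.\<close>

lemma realizes_isomorphic:
  assumes K: "framed_4_graph K" and H: "framed_4_graph H"
    and r: "realizes K (edges H) {} (crossing H ` verts H) (circles H)"
  shows "isomorphic K H"
proof -
  obtain g where g: "bij_betw g (halves K) (halves H)"
    and C: "(\<lambda>v. image g ` crossing K v) ` verts K = crossing H ` verts H"
    and e: "\<And>d. d \<in> halves K \<Longrightarrow> (g d, g (mate K d)) \<in> conn (edges H)"
    and c: "circles H + closed_arcs (edges H) {} = circles K"
    using r unfolding realizes_def by (auto simp: Union_edges[OF H])
  have inj: "inj_on g (halves K)" using g by (simp add: bij_betw_def)
  have "{Q \<in> \<Union>(edges H) // conn (edges H \<union> {}). Q \<subseteq> \<Union>{}} = {}"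
    by (auto elim!: quotientE)
  then have "closed_arcs (edges H) {} = 0" unfolding closed_arcs_def by (metis card.empty)
  then have c': "circles K = circles H" using c by simp
  have "\<exists>f. \<forall>v\<in>verts K. f v \<in> verts H \<and> image g ` crossing K v = crossing H (f v)"
  proof (rule bchoice, intro ballI)
    fix v assume "v \<in> verts K"
    then have "image g ` crossing K v \<in> crossing H ` verts H" unfolding C[symmetric] by (rule imageI)
    then show "\<exists>w. w \<in> verts H \<and> image g ` crossing K v = crossing H w" by auto
  qed
  then obtain f where f': "\<forall>v\<in>verts K. f v \<in> verts H \<and> image g ` crossing K v = crossing H (f v)"
    by (rule exE)
  note f = conjunct1[OF bspec[OF f']] conjunct2[OF bspec[OF f']]
  have h: "g ` halves_at K {v} = halves_at H {f v}" if "v \<in> verts K" for v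
  proof -
    have "\<Union>(image g ` crossing K v) = g ` \<Union>(crossing K v)" by auto
    then show ?thesis
      using f[OF that] Union_crossing[OF K that] Union_crossing[OF H f(1)[OF that]] by simp
  qed
  \<comment> \<open>Every vertex has half-edges, so it is determined by them.\<close>
  have ne: "v = w" if "halves_at X {v} = halves_at X {w}" "framed_4_graph X" "v \<in> verts X" for X v w
    using halves_at_nonempty[OF that(2,3)] that(1) by (fastforce simp: halves_at_def)
  have "inj_on f (verts K)"
  proof (rule inj_onI)
    fix v w assume v: "v \<in> verts K" "w \<in> verts K" "f v = f w"
    then have "g ` halves_at K {v} = g ` halves_at K {w}" using h by simp
    moreover have "halves_at K {v} \<subseteq> halves K" "halves_at K {w} \<subseteq> halves K"
      by (auto simp: halves_at_def)
    ultimately have "halves_at K {v} = halves_at K {w}" using inj_on_image_eq_iff[OF inj] by blast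
    then show "v = w" using ne[OF _ K v(1)] by blast
  qed
  moreover have "f ` verts K = verts H"
  proof (intro equalityI subsetI)
    fix w assume w: "w \<in> verts H"
    then have "crossing H w \<in> (\<lambda>v. image g ` crossing K v) ` verts K" unfolding C by (rule imageI)
    then obtain v where v: "v \<in> verts K" "crossing H w = image g ` crossing K v" by auto
    then have "\<Union>(crossing H w) = \<Union>(crossing H (f v))" using f by simp
    then have "halves_at H {w} = halves_at H {f v}"
      using Union_crossing[OF H] w f(1)[OF v(1)] by simp
    then show "w \<in> f ` verts K" using ne[OF _ H w] v(1) by blast
  qed (use f in auto)
  ultimately have bf: "bij_betw f (verts K) (verts H)" by (simp add: bij_betw_def)
  have "vertex H (g d) = f (vertex K d) \<and> opp H (g d) = g (opp K d) \<and> mate H (g d) = g (mate K d)"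
    if d: "d \<in> halves K" for d
  proof (intro conjI)
    let ?v = "vertex K d"
    have v: "?v \<in> verts K" using framed_vertex[OF K d] .
    have dv: "d \<in> halves_at K {?v}" using d by (simp add: halves_at_def)
    then have "g d \<in> halves_at H {f ?v}" using h[OF v] by blast
    then show "vertex H (g d) = f ?v" by (simp add: halves_at_def)
    have "{d, opp K d} \<in> crossing K ?v" using crossing_iff[OF K v] dv by simp
    then have "g ` {d, opp K d} \<in> crossing H (f ?v)" unfolding f(2)[OF v, symmetric] by (rule imageI)
    then have "{g d, g (opp K d)} \<in> crossing H (f ?v)" by simp
    then show "opp H (g d) = g (opp K d)" using crossing_iff[OF H f(1)[OF v]] by simp
    have md: "mate K d \<in> halves K" "mate K d \<noteq> d" using framed_mate[OF K] d by (auto simp: pairing_on_def)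
    then have "g d \<noteq> g (mate K d)" using inj d by (metis inj_onD)
    then have "{g d, g (mate K d)} \<in> edges H"
      using e[OF d] conn_matching[OF matching_edges[OF H]] by blast
    then show "mate H (g d) = g (mate K d)" using edges_iff[OF H] by simp
  qed
  then have "graph_iso f g K H" using bf g c' by (simp add: graph_iso_def)
  then show ?thesis unfolding isomorphic_def by blast
qed

text \<open>Link sets instead of pairings: pairings that differ away from the vertex give the same
  smoothing, which must be counted once.\<close>

definition smoothings :: "fgraph \<Rightarrow> nat \<Rightarrow> nat set set set" where
  "smoothings G v = {links (halves_at G {v}) s | s. pairing_on (halves_at G {v}) s \<and>
     (\<forall>d\<in>halves_at G {v}. s d \<noteq> opp G d)}"

lemma smoothingsE:
  assumes "L \<in> smoothings G v"
  obtains s where "L = links (halves_at G {v}) s" "pairing_on (halves_at G {v}) s"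
    "\<forall>d\<in>halves_at G {v}. s d \<noteq> opp G d"
  using assms unfolding smoothings_def by (elim CollectE exE conjE) rule

lemma smoothings_Union: "L \<in> smoothings G v \<Longrightarrow> \<Union>L = halves_at G {v}"
  by (erule smoothingsE) (simp only: Union_links)

lemma links_cong: "(\<And>d. d \<in> A \<Longrightarrow> s d = t d) \<Longrightarrow> links A s = links A t"
  unfolding links_def by (rule image_cong) auto

lemma pairing_on_cong: "(\<And>d. d \<in> A \<Longrightarrow> s d = t d) \<Longrightarrow> pairing_on A s \<longleftrightarrow> pairing_on A t"
  unfolding pairing_on_def by (metis (no_types, lifting))

text \<open>The way back from states to graphs: the pairings behind the nonempty values are glued to
  one pairing, and splicing by it carries out the state.\<close>

lemma resolves_smoothing:
  assumes K: "framed_4_graph K" and G: "framed_4_graph G" and r: "resolves K G l"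
    and l: "\<And>v. v \<in> verts G \<Longrightarrow> l v = {} \<or> l v \<in> smoothings G v"
  shows "\<exists>H. smoothing_of H G \<and> isomorphic H K"
proof -
  define S where "S = {v \<in> verts G. l v \<noteq> {}}"
  have S: "S \<subseteq> verts G" by (auto simp: S_def)
  have "\<exists>t. \<forall>v\<in>S. l v = links (halves_at G {v}) (t v) \<and> pairing_on (halves_at G {v}) (t v) \<and>
     (\<forall>d\<in>halves_at G {v}. t v d \<noteq> opp G d)"
  proof (rule bchoice, intro ballI)
    fix v assume "v \<in> S"
    then have "l v \<in> smoothings G v" using l unfolding S_def by blast
    then show "\<exists>t. l v = links (halves_at G {v}) t \<and> pairing_on (halves_at G {v}) t \<and>
     (\<forall>d\<in>halves_at G {v}. t d \<noteq> opp G d)"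
      by (rule smoothingsE) (intro exI conjI)
  qed
  then obtain t where t': "\<forall>v\<in>S. l v = links (halves_at G {v}) (t v) \<and>
     pairing_on (halves_at G {v}) (t v) \<and> (\<forall>d\<in>halves_at G {v}. t v d \<noteq> opp G d)"
    by (rule exE)
  note t = conjunct1[OF bspec[OF t']] conjunct1[OF conjunct2[OF bspec[OF t']]]
    bspec[OF conjunct2[OF conjunct2[OF bspec[OF t']]]]
  \<comment> \<open>The half-edges of distinct vertices are disjoint, so the chosen pairings combine
    without conflict.\<close>
  define s where "s = (\<lambda>d. t (vertex G d) d)"
  have st: "s d = t v d" if "d \<in> halves_at G {v}" for v d
    using that by (auto simp: s_def halves_at_def)
  have ps: "pairing_on (halves_at G {v}) s" if "v \<in> S" for v
    by (rule iffD2[OF pairing_on_cong t(2)[OF that]]) (rule st)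
  have ls: "l v = links (halves_at G {v}) s" if "v \<in> S" for v
    by (rule trans[OF t(1)[OF that] links_cong]) (rule st[symmetric])
  interpret splicing G S s
    using G S ps by unfold_locales auto
  have sm: "smoothing_of H G"
    unfolding smoothing_of_def smoothing_pairing_def
  proof (intro exI[of _ S] exI[of _ s] conjI ballI)
    show "s d \<noteq> opp G d" if "v \<in> S" "d \<in> halves_at G {v}" for v d
      using t(3)[OF that] st[OF that(2)] by simp
  qed (use S ps in auto)
  have "\<Union>(l ` verts G) = \<Union>(l ` S)" by (auto simp: S_def)
  also have "\<dots> = T" unfolding halves_at_Union[of G S] links_Union using ls by auto
  finally have 1: "\<Union>(l ` verts G) = T \<union> {}" by simp
  have "{v \<in> verts G. l v = {}} = verts H" unfolding verts_H by (auto simp: S_def)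
  then have 2: "crossing G ` {v \<in> verts G. l v = {}} = crossing H ` verts H"
    by (intro image_cong) (simp_all add: verts_H crossing_H)
  have "realizes K (edges H) {} (crossing H ` verts H) (circles H)"
    using r realizes_splice[of "{}" K] K unfolding resolves_def 1 2 by simp
  then have "isomorphic K H" using realizes_isomorphic[OF K framed_H] by blast
  then have "isomorphic H K" unfolding isomorphic_def using graph_iso_sym[OF K] by blast
  then show ?thesis using sm by blast
qed

text \<open>
  Connecting every vertex along the framing leaves one circle per unicursal component, so the
  invariance of their number is an instance of the same contraction lemmas, with a target without vertices.
\<close>

definition circle_graph :: "nat \<Rightarrow> fgraph" where
  "circle_graph n = \<lparr>verts = {}, halves = {}, vertex = id, opp = id, mate = id, circles = n\<rparr>"

lemma framed_circle_graph: "framed_4_graph (circle_graph n)"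
  by (simp add: circle_graph_def framed_4_graph_def pairing_on_def)

lemma unicursal_components_resolves:
  assumes G: "framed_4_graph G"
  shows "unicursal_components G = n \<longleftrightarrow> resolves (circle_graph n) G (crossing G)"
proof -
  interpret splicing G "verts G" "opp G" by (rule splicing_opp[OF G subset_refl])
  have all: "halves_at G (verts G) = halves G" using framed_vertex[OF G] by (auto simp: halves_at_def)
  have U: "unicursal_rel G = adj (edges G \<union> T)"
    unfolding arc_rel_adj[symmetric] by (simp add: unicursal_rel_def arc_rel_def all)
  have T: "T = \<Union>(crossing G ` verts G)"
    by (subst halves_at_Union) (simp add: links_Union crossing_def)
  have UT: "\<Union>(\<Union>(crossing G ` verts G)) = halves G"
    unfolding T[symmetric] by (rule trans[OF Union_T all])
  have UT': "\<Union>T = halves G" by (rule trans[OF Union_T all])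
  have UET: "\<Union>(edges G \<union> T) = halves G"
    unfolding Union_Un_distrib Union_edges[OF G] UT' by simp
  \<comment> \<open>Every half-edge is linked, hence every class is closed and
    \<open>closed_arcs\<close> counts all of them.\<close>
  have "Q \<subseteq> halves G" if Q: "Q \<in> halves G // conn (edges G \<union> T)" for Q
  proof -
    obtain x where x: "x \<in> halves G" "Q = conn (edges G \<union> T) `` {x}"
      using Q by (auto elim!: quotientE)
    have "y \<in> halves G" if "(x, y) \<in> conn (edges G \<union> T)" for y
      using conn_Union[OF that] x(1) unfolding UET by simp
    then show ?thesis using x(2) by blast
  qed
  then have "{Q \<in> halves G // conn (edges G \<union> T). Q \<subseteq> halves G} = halves G // conn (edges G \<union> T)"
    by blast
  then have "closed_arcs (edges G) T = card (halves G // (unicursal_rel G)\<^sup>*)"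
    unfolding closed_arcs_def U Union_edges[OF G] UT' by simp
  then have u: "unicursal_components G = circles G + closed_arcs (edges G) T"
    by (simp add: unicursal_components_def)
  have "{v \<in> verts G. crossing G v = {}} = {}" using crossing_nonempty[OF G] by auto
  then show ?thesis
    unfolding resolves_def realizes_def T[symmetric] u
    by (simp add: circle_graph_def Union_edges[OF G] UT' bij_betw_def)
qed

text \<open>It makes no difference whether the vertices of \<open>T\<close> are passed straight
  through first or together with all others.\<close>

lemma unicursal_components_splice:
  assumes G: "framed_4_graph G" and T: "T \<subseteq> verts G"
  shows "unicursal_components (splice T (opp G) G) = unicursal_components G"
proof -
  interpret splicing G T "opp G" by (rule splicing_opp) fact+
  have "resolves (circle_graph n) H (crossing H) \<longleftrightarrow> resolves (circle_graph n) G (crossing G)" for n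
  proof -
    have "resolves (circle_graph n) H (crossing H) \<longleftrightarrow> resolves (circle_graph n) H (crossing G)"
      by (rule resolves_cong) (simp add: verts_H crossing_H)
    also have "\<dots> \<longleftrightarrow> resolves (circle_graph n) G (\<lambda>v. if v \<in> T then crossing G v else crossing G v)"
      by (rule resolves_splice[OF G T framed_circle_graph]) (use Union_crossing[OF G] in auto)
    finally show ?thesis by simp
  qed
  then show ?thesis
    using unicursal_components_resolves[OF G] unicursal_components_resolves[OF framed_H] by blast
qed

lemma knot_graph_splice:
  "knot_graph G \<Longrightarrow> T \<subseteq> verts G \<Longrightarrow> knot_graph (splice T (opp G) G)"
proof -
  assume kG: "knot_graph G" and T: "T \<subseteq> verts G"
  then have fG: "framed_4_graph G" by (simp add: knot_graph_def)
  interpret splicing G T "opp G" by (rule splicing_opp) fact+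
  show ?thesis using kG framed_H unicursal_components_splice[OF fG T] by (simp add: knot_graph_def)
qed

section \<open>Renaming half-edges and isomorphic graphs\<close>

lemma realizes_rename:
  assumes fin: "finite (\<Union>E)" and L: "\<Union>L \<subseteq> \<Union>E" and C: "\<Union>(\<Union>C) \<subseteq> \<Union>E - \<Union>L"
    and h: "inj_on h (\<Union>E)"
  shows "realizes K E L C n \<longleftrightarrow>
    realizes K (image h ` E) (image h ` L) (image (image h) ` C) n"
proof -
  define k where "k = inv_into (\<Union>E) h"
  have k: "k (h x) = x" if "x \<in> \<Union>E" for x using that h by (simp add: k_def)
  have UE: "\<Union>(image h ` E) = h ` \<Union>E" and UL: "\<Union>(image h ` L) = h ` \<Union>L" by auto
  have hk: "\<exists>a\<in>\<Union>E. x = h a \<and> k x = a" if "x \<in> h ` \<Union>E" for x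
    using that by (rule imageE) (metis k)
  have s: "{k x, k y} \<in> E \<union> L" if "{x, y} \<in> image h ` E \<union> image h ` L" for x y
  proof -
    have "{x, y} \<in> image h ` (E \<union> L)" unfolding image_Un by (rule that)
    then obtain e where e: "{x, y} = h ` e" "e \<in> E \<union> L" by (rule imageE)
    have "e \<subseteq> \<Union>E" using e(2) L by auto
    then have "k ` h ` e = id ` e" unfolding image_image by (intro image_cong) (use k in auto)
    then have "k ` {x, y} = e" unfolding e(1) by simp
    then show ?thesis using e(2) by simp
  qed
  have s': "{h x, h y} \<in> image h ` E \<union> image h ` L" if "{x, y} \<in> E \<union> L" for x y
  proof -
    have "h ` {x, y} \<in> image h ` (E \<union> L)" using that by blast
    then show ?thesis by (simp add: image_Un)
  qed
  have disj: "h x \<notin> h ` \<Union>L" if "x \<in> \<Union>E" "x \<notin> \<Union>L" for x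
  proof
    assume "h x \<in> h ` \<Union>L"
    then obtain z where z: "z \<in> \<Union>L" "h x = h z" by auto
    then have "x = z" using inj_onD[OF h] that(1) L by blast
    then show False using z that by simp
  qed
  have 1: "half_equiv h k E L (image h ` E) (image h ` L)"
  proof (rule half_equivI)
    show "(h x, h y) \<in> conn (image h ` E \<union> image h ` L)" if "{x, y} \<in> E \<union> L" for x y
      using s'[OF that] by (rule conn_edge)
    show "h x \<notin> \<Union>(image h ` L) \<and> k (h x) = x" if "x \<in> \<Union>E" "x \<notin> \<Union>L" for x
      unfolding UL using disj[OF that] k[OF that(1)] by simp
    show "h x \<in> \<Union>(image h ` E)" if "x \<in> \<Union>E" for x
      unfolding UE using that by simp
  qed (use fin L k in simp_all)
  have 2: "half_equiv k h (image h ` E) (image h ` L) E L"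
  proof (rule half_equivI)
    show "(k x, k y) \<in> conn (E \<union> L)" if "{x, y} \<in> image h ` E \<union> image h ` L" for x y
      using s[OF that] by (rule conn_edge)
    show "finite (\<Union>(image h ` E))" "\<Union>(image h ` L) \<subseteq> \<Union>(image h ` E)"
      unfolding UE UL using fin L by (simp_all only: finite_imageI image_mono)
    show "k x \<in> \<Union>E" "(h (k x), x) \<in> conn (image h ` E \<union> image h ` L)"
      if "x \<in> \<Union>(image h ` E)" for x
      using that hk unfolding UE by (metis rtrancl.rtrancl_refl)+
    show "k x \<notin> \<Union>L \<and> h (k x) = x" if "x \<in> \<Union>(image h ` E)" "x \<notin> \<Union>(image h ` L)" for x
      using that hk unfolding UE UL by (metis imageI)
  qed
  show ?thesis by (rule realizes_transfer[OF 1 2 C])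
qed

lemma edges_iso:
  assumes "graph_iso f g G H"
  shows "edges H = image g ` edges G"
proof -
  have "halves H = g ` halves G" using assms by (auto simp: graph_iso_def bij_betw_def)
  moreover have "{g d, mate H (g d)} = g ` {d, mate G d}" if "d \<in> halves G" for d
    using assms that by (simp add: graph_iso_def)
  ultimately show ?thesis by (auto simp: edges_def links_def image_image)
qed

lemma halves_at_iso:
  assumes G: "framed_4_graph G" and i: "graph_iso f g G H" and v: "v \<in> verts G"
  shows "halves_at H {f v} = g ` halves_at G {v}"
proof -
  have f: "inj_on f (verts G)" and g: "halves H = g ` halves G"
    and vx: "\<And>d. d \<in> halves G \<Longrightarrow> vertex H (g d) = f (vertex G d)"
    using i by (auto simp: graph_iso_def bij_betw_def)
  have "f (vertex G d) = f v \<longleftrightarrow> vertex G d = v" if "d \<in> halves G" for d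
    using inj_on_eq_iff[OF f] framed_vertex[OF G that] v by blast
  then show ?thesis using vx unfolding halves_at_def g by auto
qed

lemma crossing_iso:
  assumes G: "framed_4_graph G" and i: "graph_iso f g G H" and v: "v \<in> verts G"
  shows "crossing H (f v) = image g ` crossing G v"
proof -
  have "{g d, opp H (g d)} = g ` {d, opp G d}" if "d \<in> halves_at G {v}" for d
    using i that by (auto simp: graph_iso_def halves_at_def)
  then show ?thesis
    unfolding crossing_def halves_at_iso[OF assms] links_def image_image by (rule image_cong[OF refl])
qed

lemma Union_kept_crossings:
  assumes G: "framed_4_graph G" and l: "\<And>v. v \<in> verts G \<Longrightarrow> \<Union>(l v) \<subseteq> halves_at G {v}"
  shows "\<Union>(\<Union>(crossing G ` {v \<in> verts G. l v = {}})) \<subseteq> \<Union>(edges G) - \<Union>(\<Union>(l ` verts G))"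
    and "\<Union>(\<Union>(l ` verts G)) \<subseteq> \<Union>(edges G)"
proof -
  show "\<Union>(\<Union>(l ` verts G)) \<subseteq> \<Union>(edges G)"
    using l unfolding Union_edges[OF G] by (fastforce simp: halves_at_def)
  show "\<Union>(\<Union>(crossing G ` {v \<in> verts G. l v = {}})) \<subseteq> \<Union>(edges G) - \<Union>(\<Union>(l ` verts G))"
  proof
    fix x assume "x \<in> \<Union>(\<Union>(crossing G ` {v \<in> verts G. l v = {}}))"
    then obtain v where v: "v \<in> verts G" "l v = {}" "x \<in> \<Union>(crossing G v)" by auto
    then have x: "x \<in> halves G" "vertex G x = v" using Union_crossing[OF G v(1)] by (auto simp: halves_at_def)
    have "x \<notin> \<Union>(l w)" if "w \<in> verts G" for w
    proof
      assume "x \<in> \<Union>(l w)"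
      then have "x \<in> halves_at G {w}" using l[OF that] by blast
      then have "w = v" using x by (simp add: halves_at_def)
      then show False using v(2) \<open>x \<in> \<Union>(l w)\<close> by simp
    qed
    then show "x \<in> \<Union>(edges G) - \<Union>(\<Union>(l ` verts G))" using x unfolding Union_edges[OF G] by blast
  qed
qed

lemma resolves_iso:
  assumes G: "framed_4_graph G" and i: "graph_iso f g G H"
    and l: "\<And>v. v \<in> verts G \<Longrightarrow> \<Union>(l v) \<subseteq> halves_at G {v}"
    and l': "\<And>v. v \<in> verts G \<Longrightarrow> l' (f v) = image g ` l v"
  shows "resolves K G l \<longleftrightarrow> resolves K H l'"
proof -
  have fv: "verts H = f ` verts G" and c: "circles H = circles G" and g: "inj_on g (halves G)"
    using i by (auto simp: graph_iso_def bij_betw_def)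
  have "l' ` verts H = image (image g) ` l ` verts G"
    unfolding fv image_image using l' by (intro image_cong) auto
  then have 1: "\<Union>(l' ` verts H) = image g ` \<Union>(l ` verts G)" by auto
  have "{v \<in> verts H. l' v = {}} = f ` {v \<in> verts G. l v = {}}"
    unfolding fv using l' by auto
  then have 2: "crossing H ` {v \<in> verts H. l' v = {}} = image (image g) ` crossing G ` {v \<in> verts G. l v = {}}"
    using crossing_iso[OF G i] by (auto simp: image_image)
  show ?thesis
    unfolding resolves_def 1 2 edges_iso[OF i] c
    by (rule realizes_rename)
      (use Union_kept_crossings[OF G l] g framed_finite[OF G] in \<open>simp_all add: Union_edges[OF G]\<close>)
qed

lemma unicursal_components_iso:
  assumes G: "framed_4_graph G" and H: "framed_4_graph H" and i: "graph_iso f g G H"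
  shows "unicursal_components G = unicursal_components H"
proof -
  have "resolves (circle_graph n) G (crossing G) \<longleftrightarrow> resolves (circle_graph n) H (crossing H)" for n
    by (rule resolves_iso[OF G i]) (use Union_crossing[OF G] crossing_iso[OF G i] in auto)
  then show ?thesis
    using unicursal_components_resolves[OF G] unicursal_components_resolves[OF H] by blast
qed

section \<open>Local states\<close>

text \<open>No link and no other edge touches \<open>p\<close> or \<open>q\<close>, so they form a
  whole arc. In \<open>K\<close> this arc must be an edge.\<close>

lemma realizes_edge:
  assumes g: "(g d, g (mate K d)) \<in> conn (insert {p, q} E \<union> L)" "g d = p"
    and K: "framed_4_graph K" and inj: "inj_on g (halves K)" and d: "d \<in> halves K"
    and pq: "p \<notin> \<Union>E" "q \<notin> \<Union>E" "p \<notin> \<Union>L" "q \<notin> \<Union>L"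
  shows "g (mate K d) = q"
proof -
  have "z \<in> {p, q}" if "(p, z) \<in> conn (insert {p, q} E \<union> L)" for z
    using that
  proof (induction rule: rtrancl_induct)
    case (step z w)
    have "{z, w} \<in> insert {p, q} E \<union> L" using step by (simp add: adj_def)
    moreover have "{z, w} \<notin> E" "{z, w} \<notin> L" using step.IH pq by blast+
    ultimately have "{z, w} = {p, q}" by simp
    then show ?case by (auto simp: doubleton_eq_iff)
  qed simp
  then have "g (mate K d) \<in> {p, q}" using g by simp
  moreover have "mate K d \<in> halves K" "mate K d \<noteq> d"
    using framed_mate[OF K] d by (simp_all add: pairing_on_def)
  then have "g (mate K d) \<noteq> p" using inj_onD[OF inj] d g(2) by metis
  ultimately show ?thesis by simp
qed

lemma realizes_crossing:
  assumes C: "(\<lambda>v. image g ` crossing K v) ` verts K = C" and K: "framed_4_graph K"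
    and c: "c \<in> C"
  obtains v where "v \<in> verts K" "c = image g ` crossing K v" "\<Union>c = g ` halves_at K {v}"
proof -
  obtain v where v: "v \<in> verts K" "c = image g ` crossing K v" using c unfolding C[symmetric] by auto
  have "\<Union>(image g ` crossing K v) = g ` \<Union>(crossing K v)" by auto
  then show thesis using that[OF v] v(2) Union_crossing[OF K v(1)] by simp
qed

text \<open>What the local computations use about \<open>K\<close>. Its odd vertices enter through
  \<open>no_loop\<close>: a loop on non-opposite half-edges could be removed by a first move, which
  makes its vertex even.\<close>

locale irreducible_knot =
  fixes K
  assumes knot: "knot_graph K"
    and no_loop: "\<And>e. e \<in> halves K \<Longrightarrow> vertex K (mate K e) = vertex K e \<Longrightarrow> mate K e = opp K e"
    and no_bigon: "\<And>u v. \<not> bigon K u v"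
begin

lemma framed: "framed_4_graph K"
  using knot by (simp add: knot_graph_def)

lemma mates: "\<forall>d\<in>halves K. mate K d \<in> halves K"
  using framed_mate[OF framed] by (simp add: pairing_on_def)

text \<open>An edge joining two non-opposite half-edges of a kept crossing would appear in
  \<open>K\<close> as a loop that \<open>no_loop\<close> forbids.\<close>

lemma not_realizes_loop:
  assumes pq: "p \<notin> \<Union>E" "q \<notin> \<Union>E" "p \<notin> \<Union>L" "q \<notin> \<Union>L"
    and c: "c \<in> C" "p \<in> \<Union>c" "q \<in> \<Union>c" "{p, q} \<notin> c"
  shows "\<not> realizes K (insert {p, q} E) L C n"
proof
  assume "realizes K (insert {p, q} E) L C n"
  then obtain g where g: "bij_betw g (halves K) (\<Union>(insert {p, q} E) - \<Union>L)"
    "(\<lambda>v. image g ` crossing K v) ` verts K = C"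
    "\<forall>d\<in>halves K. (g d, g (mate K d)) \<in> conn (insert {p, q} E \<union> L)"
    unfolding realizes_def by (elim exE conjE)
  have inj: "inj_on g (halves K)" using g(1) by (rule bij_betw_imp_inj_on)
  obtain v where v: "v \<in> verts K" "c = image g ` crossing K v" "\<Union>c = g ` halves_at K {v}"
    by (rule realizes_crossing[OF g(2) framed c(1)])
  obtain d where d: "d \<in> halves_at K {v}" "g d = p" using c(2) v(3) by auto
  obtain e where e: "e \<in> halves_at K {v}" "g e = q" using c(3) v(3) by auto
  have dK: "d \<in> halves K" "e \<in> halves K" "vertex K d = v" "vertex K e = v"
    using d e by (simp_all add: halves_at_def)
  have "g (mate K d) = q" using realizes_edge[OF bspec[OF g(3) dK(1)] d(2) framed inj dK(1) pq] .
  then have m: "mate K d = e" using inj_onD[OF inj, of "mate K d" e] e(2) dK mates by simp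
  then have "opp K d = e" using no_loop[OF dK(1)] dK by simp
  then have "{d, e} \<in> crossing K v" using crossing_iff[OF framed v(1)] d(1) by simp
  then have "g ` {d, e} \<in> c" unfolding v(2) by (rule imageI)
  then show False using c(4) d(2) e(2) by simp
qed

text \<open>Two untouched edges between two kept crossings, with non-opposite ends at both, would
  appear in \<open>K\<close> as a bigon.\<close>

lemma not_realizes_bigon:
  assumes pq: "p \<notin> \<Union>E" "q \<notin> \<Union>E" "r \<notin> \<Union>E" "s \<notin> \<Union>E" "p \<notin> \<Union>L" "q \<notin> \<Union>L" "r \<notin> \<Union>L" "s \<notin> \<Union>L"
    and dist: "distinct [p, q, r, s]"
    and c: "c \<in> C" "p \<in> \<Union>c" "r \<in> \<Union>c" "{p, r} \<notin> c"
    and c': "c' \<in> C" "q \<in> \<Union>c'" "s \<in> \<Union>c'" "{q, s} \<notin> c'" and ne: "c \<noteq> c'"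
  shows "\<not> realizes K (insert {p, q} (insert {r, s} E)) L C n"
proof
  let ?E = "insert {p, q} (insert {r, s} E)"
  assume "realizes K ?E L C n"
  then obtain g where g: "bij_betw g (halves K) (\<Union>?E - \<Union>L)"
    "(\<lambda>v. image g ` crossing K v) ` verts K = C"
    "\<forall>d\<in>halves K. (g d, g (mate K d)) \<in> conn (?E \<union> L)"
    unfolding realizes_def by (elim exE conjE)
  have inj: "inj_on g (halves K)" using g(1) by (rule bij_betw_imp_inj_on)
  obtain u where u: "u \<in> verts K" "c = image g ` crossing K u" "\<Union>c = g ` halves_at K {u}"
    by (rule realizes_crossing[OF g(2) framed c(1)])
  obtain v where v: "v \<in> verts K" "c' = image g ` crossing K v" "\<Union>c' = g ` halves_at K {v}"
    by (rule realizes_crossing[OF g(2) framed c'(1)])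
  obtain e where e: "e \<in> halves_at K {u}" "g e = p" using c(2) u(3) by auto
  obtain f where f: "f \<in> halves_at K {u}" "g f = r" using c(3) u(3) by auto
  obtain e' where e': "e' \<in> halves_at K {v}" "g e' = q" using c'(2) v(3) by auto
  obtain f' where f': "f' \<in> halves_at K {v}" "g f' = s" using c'(3) v(3) by auto
  have K: "e \<in> halves K" "f \<in> halves K" "e' \<in> halves K" "f' \<in> halves K"
    "vertex K e = u" "vertex K f = u" "vertex K e' = v" "vertex K f' = v"
    using e f e' f' by (simp_all add: halves_at_def)
  have "g (mate K e) = q"
    by (rule realizes_edge[OF bspec[OF g(3) K(1)] e(2) framed inj K(1)]) (use pq dist in simp_all)
  then have me: "mate K e = e'" using inj_onD[OF inj, of "mate K e" e'] e'(2) K mates by simp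
  have E2: "?E = insert {r, s} (insert {p, q} E)" by (rule insert_commute)
  have "g (mate K f) = s"
    by (rule realizes_edge[OF bspec[OF g(3)[unfolded E2] K(2)] f(2) framed inj K(2)])
      (use pq dist in simp_all)
  then have mf: "mate K f = f'" using inj_onD[OF inj, of "mate K f" f'] f'(2) K mates by simp
  have "f \<noteq> opp K e"
  proof
    assume "f = opp K e"
    then have "{e, f} \<in> crossing K u" using crossing_iff[OF framed u(1)] e(1) by simp
    then have "g ` {e, f} \<in> c" unfolding u(2) by (rule imageI)
    then show False using c(4) e(2) f(2) by simp
  qed
  moreover have "f' \<noteq> opp K e'"
  proof
    assume "f' = opp K e'"
    then have "{e', f'} \<in> crossing K v" using crossing_iff[OF framed v(1)] e'(1) by simp
    then have "g ` {e', f'} \<in> c'" unfolding v(2) by (rule imageI)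
    then show False using c'(4) e'(2) f'(2) by simp
  qed
  moreover have "u \<noteq> v" using ne u(2) v(2) by auto
  moreover have "e \<noteq> f" using e(2) f(2) dist by auto
  ultimately have "bigon K u v"
    unfolding bigon_def using K me mf by (intro conjI bexI[of _ e] bexI[of _ f]) simp_all
  then show False using no_bigon by simp
qed

text \<open>One circle already exhausts the single unicursal component of \<open>K\<close>. Then
  \<open>K\<close> has no half-edges, so nothing survives and the arc through \<open>x\<close> is a
  second circle.\<close>

lemma not_realizes_circle:
  assumes fin: "finite (\<Union>E)" and L: "\<Union>L \<subseteq> \<Union>E" and x: "x \<in> \<Union>E"
  shows "\<not> realizes K E L C (Suc n)"
proof
  assume "realizes K E L C (Suc n)"
  then obtain g where g: "bij_betw g (halves K) (\<Union>E - \<Union>L)" "Suc n + closed_arcs E L = circles K"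
    unfolding realizes_def by (elim exE conjE)
  have "card (halves K // (unicursal_rel K)\<^sup>*) + circles K = 1"
    using knot by (simp add: knot_graph_def unicursal_components_def)
  then have c: "card (halves K // (unicursal_rel K)\<^sup>*) = 0" "closed_arcs E L = 0" using g(2) by auto
  have "finite (halves K // (unicursal_rel K)\<^sup>*)"
    unfolding quotient_def using framed_finite[OF framed] by (intro finite_UN_I) auto
  then have "halves K // (unicursal_rel K)\<^sup>* = {}" using c(1) by simp
  then have "halves K = {}" by (simp add: quotient_def)
  then have "\<Union>E - \<Union>L = {}" using g(1) by (simp add: bij_betw_def)
  then have EL: "\<Union>E = \<Union>L" using L by (rule_tac equalityI) (simp_all add: Diff_eq_empty_iff)
  then have U: "\<Union>(E \<union> L) = \<Union>L" by (simp only: Union_Un_distrib Un_absorb)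
  let ?Q = "conn (E \<union> L) `` {x}"
  have "y \<in> \<Union>L" if "(x, y) \<in> conn (E \<union> L)" for y
    using conn_Union[OF that] x unfolding U EL by simp
  then have "?Q \<in> {Q \<in> \<Union>E // conn (E \<union> L). Q \<subseteq> \<Union>L}" using quotientI[OF x] by blast
  moreover have "finite (\<Union>E // conn (E \<union> L))"
    unfolding quotient_def using fin by (intro finite_UN_I) auto
  then have "finite {Q \<in> \<Union>E // conn (E \<union> L). Q \<subseteq> \<Union>L}" by simp
  ultimately show False using c(2) unfolding closed_arcs_def by (simp only: card_0_eq) blast
qed

end

text \<open>The open ends of a partial state: half-edges at which the crossings still to be resolved
  are attached.\<close>

definition free :: "nat set set \<Rightarrow> nat set set \<Rightarrow> nat set set set \<Rightarrow> nat set" where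
  "free E L C = \<Union>E - \<Union>L - \<Union>(\<Union>C)"

lemma diagramI:
  assumes "finite (\<Union>E)" "\<And>e. e \<in> L \<Longrightarrow> \<exists>a b. e = {a, b}" "\<Union>L \<subseteq> \<Union>E"
    and "\<Union>(\<Union>C) \<subseteq> \<Union>E - \<Union>L"
  shows "diagram E L C"
  using assms by (simp only: diagram_def) simp

lemma diagramD:
  assumes "diagram E L C"
  shows "finite (\<Union>E)" "\<Union>L \<subseteq> \<Union>E" "\<Union>(\<Union>C) \<subseteq> \<Union>E - \<Union>L" "\<And>x. x \<in> \<Union>L \<Longrightarrow> x \<in> \<Union>E"
    "\<And>x. x \<in> \<Union>(\<Union>C) \<Longrightarrow> x \<in> \<Union>E" and "\<And>e. e \<in> L \<Longrightarrow> \<exists>a b. e = {a, b}"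
proof -
  show *: "finite (\<Union>E)" "\<Union>L \<subseteq> \<Union>E" "\<Union>(\<Union>C) \<subseteq> \<Union>E - \<Union>L" "\<And>e. e \<in> L \<Longrightarrow> \<exists>a b. e = {a, b}"
    using assms by (simp_all add: diagram_def)
  show "\<And>x. x \<in> \<Union>L \<Longrightarrow> x \<in> \<Union>E" using *(2) by (rule subsetD)
  show "\<And>x. x \<in> \<Union>(\<Union>C) \<Longrightarrow> x \<in> \<Union>E" using *(3) by blast
qed

lemma freeD:
  assumes "x \<in> free E L C"
  shows "x \<in> \<Union>E" "x \<notin> \<Union>L" "x \<notin> \<Union>(\<Union>C)"
  using assms unfolding free_def by blast+

lemma free_subset: "free E L C \<subseteq> \<Union>E - \<Union>L" "free E L C \<subseteq> \<Union>E"
  unfolding free_def by blast+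

lemma diagram_insert_edge:
  assumes "diagram E L C"
  shows "diagram (insert {x, y} E) L C"
proof (rule diagramI)
  show "\<Union>L \<subseteq> \<Union>(insert {x, y} E)" "\<Union>(\<Union>C) \<subseteq> \<Union>(insert {x, y} E) - \<Union>L"
    using diagramD(2,3)[OF assms] unfolding Union_insert by blast+
qed (use diagramD(1,6)[OF assms] in \<open>simp_all\<close>)

lemma free_insert_edge:
  assumes "diagram E L C" "x \<notin> \<Union>E" "y \<notin> \<Union>E"
  shows "free (insert {x, y} E) L C = insert x (insert y (free E L C))"
proof -
  have "x \<notin> \<Union>L" "y \<notin> \<Union>L" "x \<notin> \<Union>(\<Union>C)" "y \<notin> \<Union>(\<Union>C)" using assms unfolding diagram_def by blast+
  then show ?thesis unfolding free_def Union_insert by blast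
qed

lemma diagram_insert_link:
  assumes d: "diagram E L C" and xy: "x \<in> free E L C" "y \<in> free E L C"
  shows "diagram E (insert {x, y} L) C"
proof (rule diagramI)
  show "\<Union>(insert {x, y} L) \<subseteq> \<Union>E" "\<Union>(\<Union>C) \<subseteq> \<Union>E - \<Union>(insert {x, y} L)"
    using diagramD(2,3)[OF d] xy[THEN freeD(1)] xy[THEN freeD(3)] unfolding Union_insert by blast+
  show "\<exists>a b. e = {a, b}" if "e \<in> insert {x, y} L" for e
    using that
  proof
    assume "e = {x, y}"
    then show ?thesis by (intro exI)
  qed (rule diagramD(6)[OF d])
qed (rule diagramD(1)[OF d])

lemma free_insert_link: "free E (insert {x, y} L) C = free E L C - {x, y}"
  unfolding free_def Union_insert by blast

lemma diagram_insert_crossing: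
  assumes d: "diagram E L C" and f: "{x, p, y, q} \<subseteq> free E L C"
  shows "diagram E L (insert {{x, p}, {y, q}} C)"
proof (rule diagramI)
  have "\<Union>(\<Union>(insert {{x, p}, {y, q}} C)) = {x, p, y, q} \<union> \<Union>(\<Union>C)"
    by (simp add: insert_commute)
  moreover have "{x, p, y, q} \<subseteq> \<Union>E - \<Union>L" using f free_subset(1) by (rule subset_trans)
  ultimately show "\<Union>(\<Union>(insert {{x, p}, {y, q}} C)) \<subseteq> \<Union>E - \<Union>L" using diagramD(3)[OF d] by simp
qed (use diagramD(1,2,6)[OF d] in simp_all)

lemma free_insert_crossing: "free E L (insert {{x, p}, {y, q}} C) = free E L C - {x, p, y, q}"
  unfolding free_def by (simp del: Union_iff) blast

text \<open>
  The states of a crossing with opposite pairs \<open>x\<close>, \<open>p\<close> and \<open>y\<close>, \<open>q\<close>: its two smoothings and, if it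
  is odd, the empty set of links, which keeps the crossing.
\<close>

definition choices :: "bool \<Rightarrow> nat \<Rightarrow> nat \<Rightarrow> nat \<Rightarrow> nat \<Rightarrow> nat set set set" where
  "choices b x p y q = {{{x, y}, {p, q}}, {{x, q}, {y, p}}} \<union> (if b then {{}} else {})"

definition kept :: "nat set set \<Rightarrow> nat set set \<Rightarrow> nat set set set" where
  "kept c X = (if c = {} then {X} else {})"

lemma sum_choices:
  fixes f :: "nat set set \<Rightarrow> nat"
  assumes "distinct [x, p, y, q]"
  shows "sum f (choices b x p y q) =
    f {{x, y}, {p, q}} + f {{x, q}, {y, p}} + (if b then f {} else 0)"
proof -
  have "{{x, y}, {p, q}} \<noteq> {{x, q}, {y, p}}"
  proof
    assume eq: "{{x, y}, {p, q}} = {{x, q}, {y, p}}"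
    have "{x, y} \<in> {{x, y}, {p, q}}" by simp
    then have "{x, y} \<in> {{x, q}, {y, p}}" unfolding eq .
    then show False using assms by (simp add: doubleton_eq_iff)
  qed
  then show ?thesis by (simp add: choices_def)
qed

lemma choices_cases:
  assumes "c \<in> choices b x p y q"
  obtains "c = {{x, y}, {p, q}}" | "c = {{x, q}, {y, p}}" | "b" "c = {}"
  using assms unfolding choices_def by (auto split: if_splits)

lemma choices_flip: "choices b p x y q = choices b x p y q"
  by (simp add: choices_def insert_commute)

text \<open>Every state of a crossing uses up exactly its four half-edges, by links or by keeping
  it, so states of disjoint crossings can be chosen independently.\<close>

lemma diagram_choice:
  assumes d: "diagram E L C" and f: "{x, p, y, q} \<subseteq> free E L C" "distinct [x, p, y, q]"
    and c: "c \<in> choices b x p y q"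
  shows "diagram E (c \<union> L) (kept c {{x, p}, {y, q}} \<union> C)"
    and "free E (c \<union> L) (kept c {{x, p}, {y, q}} \<union> C) = free E L C - {x, p, y, q}"
proof -
  show "diagram E (c \<union> L) (kept c {{x, p}, {y, q}} \<union> C)"
    using c
  proof (cases rule: choices_cases)
    case 1
    then show ?thesis using d f by (simp add: kept_def diagram_insert_link free_insert_link)
  next
    case 2
    then show ?thesis using d f by (simp add: kept_def diagram_insert_link free_insert_link)
  next
    case 3
    then show ?thesis using d f by (simp add: kept_def diagram_insert_crossing)
  qed
  show "free E (c \<union> L) (kept c {{x, p}, {y, q}} \<union> C) = free E L C - {x, p, y, q}"
    using c
  proof (cases rule: choices_cases)
    case 1
    then show ?thesis by (simp add: kept_def free_insert_link) blast
  next
    case 2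
    then show ?thesis by (simp add: kept_def free_insert_link) blast
  next
    case 3
    then show ?thesis by (simp add: kept_def free_insert_crossing)
  qed
qed

text \<open>The number of realizing states of two crossings of common parity \<open>b\<close> in a
  fixed exterior. The same sum occurs for the two vertices of a bigon and for a triangle whose even
  vertex is smoothed.\<close>

definition pair_sum ::
  "fgraph \<Rightarrow> bool \<Rightarrow> nat set set \<Rightarrow> nat set set \<Rightarrow> nat set set set \<Rightarrow> nat \<Rightarrow>
   nat \<Rightarrow> nat \<Rightarrow> nat \<Rightarrow> nat \<Rightarrow> nat \<Rightarrow> nat \<Rightarrow> nat \<Rightarrow> nat \<Rightarrow> nat" where
  "pair_sum K b E L C n x p y q x' r y' s =
     (\<Sum>c\<in>choices b x p y q. \<Sum>d\<in>choices b x' r y' s.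
        of_bool (realizes K E (c \<union> (d \<union> L)) (kept c {{x, p}, {y, q}} \<union> (kept d {{x', r}, {y', s}} \<union> C)) n))"

lemma pair_sum_swap:
  "pair_sum K b E L C n x p y q x' r y' s = pair_sum K b E L C n x' r y' s x p y q"
  unfolding pair_sum_def by (subst sum.swap) (simp only: Un_left_commute)

text \<open>Exchanging two opposite half-edges leaves the crossing unchanged and only interchanges
  its two smoothings.\<close>

lemma pair_sum_flip:
  "pair_sum K b E L C n p x y q x' r y' s = pair_sum K b E L C n x p y q x' r y' s"
  unfolding pair_sum_def choices_flip[of b p x y q] insert_commute[of p x] ..

lemma choices_image:
  "choices b (h x) (h p) (h y) (h q) = image (image h) ` choices b x p y q"
  by (simp add: choices_def)

lemma choices_subset: "\<Union>(\<Union>(choices b x p y q)) \<subseteq> {x, p, y, q}"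
  by (auto simp: choices_def)

lemma inj_choices:
  assumes "inj_on h {x, p, y, q}"
  shows "inj_on (image (image h)) (choices b x p y q)"
  by (intro inj_on_image inj_on_subset[OF assms] choices_subset)

text \<open>States correspond term by term under \<open>h\<close>, which need only be injective on
  each of the two crossings.\<close>

lemma pair_sum_map:
  assumes inj: "inj_on h {x, p, y, q}" "inj_on h {x', r, y', s}"
    and eq: "\<And>c d. c \<in> choices b x p y q \<Longrightarrow> d \<in> choices b x' r y' s \<Longrightarrow>
      realizes K E (c \<union> (d \<union> L)) (kept c {{x, p}, {y, q}} \<union> (kept d {{x', r}, {y', s}} \<union> C)) n \<longleftrightarrow>
      realizes K E' (image h ` (c \<union> d) \<union> L')
        (image (image h) ` (kept c {{x, p}, {y, q}} \<union> kept d {{x', r}, {y', s}}) \<union> C') n"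
  shows "pair_sum K b E L C n x p y q x' r y' s =
    pair_sum K b E' L' C' n (h x) (h p) (h y) (h q) (h x') (h r) (h y') (h s)"
proof -
  have k: "kept (image h ` c) {{h u, h v}, {h w, h z}} = image (image h) ` kept c {{u, v}, {w, z}}"
    for c u v w z by (simp add: kept_def)
  show ?thesis
    unfolding pair_sum_def choices_image sum.reindex[OF inj_choices[OF inj(1)]]
      sum.reindex[OF inj_choices[OF inj(2)]] comp_apply k
    by (intro sum.cong refl arg_cong[where f = of_bool]) (simp only: eq image_Un Un_assoc)
qed

text \<open>A smoothing of a neighbouring vertex links the far end \<open>z\<close> of the edge at
  \<open>x\<close> to \<open>t\<close>. Then \<open>t\<close> takes the place of \<open>x\<close> in
  its crossing, in all states simultaneously.\<close>

lemma pair_sum_contract: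
  assumes d: "diagram E L C" and f: "{t, p, y, q, x', r, y', s} \<subseteq> free E L C"
    and xz: "x \<notin> \<Union>E" "z \<notin> \<Union>E" "x \<noteq> z" and dist: "distinct [t, p, y, q, x', r, y', s]"
  shows "pair_sum K b (insert {z, x} E) (insert {z, t} L) C n x p y q x' r y' s =
    pair_sum K b E L C n t p y q x' r y' s"
proof -
  let ?E = "insert {z, x} E" and ?L = "insert {z, t} L"
  define h where "h = relabel x t"
  have xf: "x \<notin> {t, p, y, q, x', r, y', s}" and zf: "z \<notin> {t, p, y, q, x', r, y', s}"
    using subset_trans[OF f free_subset(2)] xz by blast+
  have nf: "x \<notin> free E L C" "z \<notin> free E L C" using xz(1,2) subsetD[OF free_subset(2)] by metis+
  have hx: "h x = t" and hid: "w \<noteq> x \<Longrightarrow> h w = w" for w by (simp_all add: h_def relabel_def)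
  have h: "h p = p" "h y = y" "h q = q" "h x' = x'" "h r = r" "h y' = y'" "h s = s"
    by (rule hid, use xf in simp)+
  have dE: "diagram ?E L C" and fE: "free ?E L C = insert z (insert x (free E L C))"
    using d xz by (simp_all add: diagram_insert_edge free_insert_edge)
  have dL: "diagram ?E ?L C" using dE f by (intro diagram_insert_link) (simp_all add: fE)
  have fL: "free ?E ?L C = insert x (free E L C - {t})"
    using nf xz(3) zf xf by (simp add: free_insert_link fE insert_Diff_if)
  have tf: "t \<in> free E L C" using f by simp
  have LC: "x \<notin> \<Union>L" "z \<notin> \<Union>L" "x \<notin> \<Union>(\<Union>C)" using diagramD(4,5)[OF d] xz by blast+
  have "pair_sum K b ?E ?L C n x p y q x' r y' s =
    pair_sum K b E L C n (h x) (h p) (h y) (h q) (h x') (h r) (h y') (h s)"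
  proof (rule pair_sum_map)
    show "inj_on h {x, p, y, q}" "inj_on h {x', r, y', s}"
      using dist xf hx h by (auto simp: inj_on_def)
    fix c e assume c: "c \<in> choices b x p y q" and e: "e \<in> choices b x' r y' s"
    let ?X = "kept c {{x, p}, {y, q}}" and ?Y = "kept e {{x', r}, {y', s}}"
    have de: "diagram ?E (e \<union> ?L) (?Y \<union> C)" "free ?E (e \<union> ?L) (?Y \<union> C) = free ?E ?L C - {x', r, y', s}"
      by (rule diagram_choice[OF dL _ _ e]; use f fL dist xf in auto)+
    have dc: "diagram ?E (c \<union> (e \<union> ?L)) (?X \<union> (?Y \<union> C))"
      by (rule diagram_choice[OF de(1) _ _ c]; use f de(2) fL dist xf in auto)
    have U: "\<Union>c \<subseteq> {x, p, y, q}" "\<Union>e \<subseteq> {x', r, y', s}" using choices_subset c e by blast+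
    have hL: "image h ` L = L" "image (image h) ` C = C"
      unfolding h_def by (rule relabel_id(1)[OF LC(1)], rule relabel_id(2)[OF LC(3)])
    have "realizes K ?E (insert {z, t} (c \<union> (e \<union> L))) (?X \<union> (?Y \<union> C)) n \<longleftrightarrow>
      realizes K E (image (relabel x t) ` (c \<union> (e \<union> L))) (image (image (relabel x t)) ` (?X \<union> (?Y \<union> C))) n"
    proof (rule realizes_contract_link)
      show "diagram ?E (insert {z, t} (c \<union> (e \<union> L))) (?X \<union> (?Y \<union> C))" using dc by simp
      show "t \<in> \<Union>E" using freeD(1)[OF tf] .
      show "z \<notin> \<Union>(c \<union> (e \<union> L))" using U zf xz(3) LC(2) unfolding Union_Un_distrib by blast
      show "t \<notin> \<Union>(c \<union> (e \<union> L))" using U xf dist freeD(2)[OF tf] unfolding Union_Un_distrib by auto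
    qed (use xz in auto)
    also have "image (relabel x t) ` (c \<union> (e \<union> L)) = image h ` (c \<union> e) \<union> L"
      unfolding h_def[symmetric] image_Un hL by (rule Un_assoc[symmetric])
    also have "image (image (relabel x t)) ` (?X \<union> (?Y \<union> C)) = image (image h) ` (?X \<union> ?Y) \<union> C"
      unfolding h_def[symmetric] image_Un hL by (rule Un_assoc[symmetric])
    finally show "realizes K ?E (c \<union> (e \<union> ?L)) (?X \<union> (?Y \<union> C)) n \<longleftrightarrow>
      realizes K E (image h ` (c \<union> e) \<union> L) (image (image h) ` (?X \<union> ?Y) \<union> C) n" by simp
  qed
  then show ?thesis unfolding hx h .
qed

text \<open>In the third move this exchanges the two ends of an inner edge while the exterior stays
  fixed.\<close>

lemma pair_sum_rename:
  assumes d: "diagram E L C" and f: "{x, p, y, q, x', r, y', s} \<subseteq> free E L C"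
    and dist: "distinct [x, p, y, q, x', r, y', s]" and h: "inj_on h (\<Union>E)"
    and L: "\<And>z. z \<in> \<Union>L \<Longrightarrow> h z = z" and C: "\<And>z. z \<in> \<Union>(\<Union>C) \<Longrightarrow> h z = z"
  shows "pair_sum K b E L C n x p y q x' r y' s =
    pair_sum K b (image h ` E) L C n (h x) (h p) (h y) (h q) (h x') (h r) (h y') (h s)"
proof (rule pair_sum_map)
  have "{x, p, y, q, x', r, y', s} \<subseteq> \<Union>E" using f free_subset(2) by (rule subset_trans)
  then show "inj_on h {x, p, y, q}" "inj_on h {x', r, y', s}"
    by (rule_tac inj_on_subset[OF h], simp)+
  fix c e assume c: "c \<in> choices b x p y q" and e: "e \<in> choices b x' r y' s"
  let ?X = "kept c {{x, p}, {y, q}}" and ?Y = "kept e {{x', r}, {y', s}}"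
  have de: "diagram E (e \<union> L) (?Y \<union> C)" "free E (e \<union> L) (?Y \<union> C) = free E L C - {x', r, y', s}"
    by (rule diagram_choice[OF d _ _ e]; use f dist in auto)+
  have dc: "diagram E (c \<union> (e \<union> L)) (?X \<union> (?Y \<union> C))"
    by (rule diagram_choice[OF de(1) _ _ c]; use f de(2) dist in auto)
  have "image h ` L = L" using L by (rule image_id_on)
  then have 1: "image h ` (c \<union> (e \<union> L)) = image h ` (c \<union> e) \<union> L"
    unfolding image_Un by (simp add: Un_assoc)
  have "image (image h) ` C = C" using C by (rule image_image_id)
  then have 2: "image (image h) ` (?X \<union> (?Y \<union> C)) = image (image h) ` (?X \<union> ?Y) \<union> C"
    unfolding image_Un by (simp add: Un_assoc)
  show "realizes K E (c \<union> (e \<union> L)) (?X \<union> (?Y \<union> C)) n \<longleftrightarrow>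
      realizes K (image h ` E) (image h ` (c \<union> e) \<union> L) (image (image h) ` (?X \<union> ?Y) \<union> C) n"
    unfolding realizes_rename[OF diagramD(1,2,3)[OF dc] h] 1 2 ..
qed

section \<open>Local form of the moves\<close>

declare [[linarith_neq_limit = 0]]

declare Union_iff [simp del]

lemmas diagram_simps = diagram_insert_edge free_insert_edge diagram_insert_link free_insert_link
  diagram_insert_crossing free_insert_crossing

text \<open>The relabelled links and crossings are given by separate equations, so that each stage
  of a chain of contractions can be written out explicitly.\<close>

lemma contract_link_eq:
  assumes "diagram (insert {x, y} E) (insert {x, p} L) C"
    and "x \<noteq> y" "x \<notin> \<Union>E" "y \<notin> \<Union>E" "p \<in> \<Union>E" "x \<notin> \<Union>L" "p \<notin> \<Union>L"
    and "image (relabel y p) ` L = L'" "image (image (relabel y p)) ` C = C'"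
  shows "realizes K (insert {x, y} E) (insert {x, p} L) C n \<longleftrightarrow> realizes K E L' C' n"
  using realizes_contract_link[OF assms(1-7)] unfolding assms(8,9) .

context irreducible_knot
begin

text \<open>The loop is the edge \<open>x\<close>, \<open>y\<close>. One smoothing splits it off as
  a circle, which \<open>K\<close> excludes; the other one and the straight passage both just join
  \<open>p\<close> to \<open>q\<close>.\<close>

lemma realizes_loop:
  assumes d: "diagram E L C" and m: "matching E" and f: "p \<in> free E L C" "q \<in> free E L C"
    and xy: "x \<notin> \<Union>E" "y \<notin> \<Union>E" and dist: "distinct [x, y, p, q]"
  shows "(\<Sum>c\<in>choices False x p y q. of_bool (realizes K (insert {x, y} E) (c \<union> L) C n) :: nat) =
      of_bool (realizes K E (insert {p, q} L) C n)"
    and "realizes K (insert {x, y} E) (insert {x, p} (insert {y, q} L)) C n \<longleftrightarrow>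
      realizes K E (insert {p, q} L) C n"
proof -
  have nL: "x \<notin> \<Union>L" "y \<notin> \<Union>L" "x \<notin> \<Union>(\<Union>C)" "y \<notin> \<Union>(\<Union>C)"
    using xy diagramD(4,5)[OF d] by metis+
  note pE = f[THEN freeD(1)] and pL = f[THEN freeD(2)]
  note dd = dist distinct_rev[THEN iffD2, OF dist]
  note [simp] = diagram_simps d f xy nL pE pL relabel_simps relabel_id(1)[OF nL(2)] relabel_id(2)[OF nL(4)]
  \<comment> \<open>The smoothing along the loop: link and edge coincide and form a circle.\<close>
  have A: "\<not> realizes K (insert {x, y} E) (insert {x, y} (insert {p, q} L)) C n"
  proof (subst realizes_contract_circle)
    show "\<not> realizes K E (insert {p, q} L) C (Suc n)"
      by (rule not_realizes_circle[of _ _ p]) (use diagramD(1,2)[OF d] pE in simp_all)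
    show "\<Union>(insert {p, q} L) \<subseteq> \<Union>E" using diagramD(2)[OF d] pE by simp
    show "(d, d') \<in> conn E \<longleftrightarrow> d = d' \<or> {d, d'} \<in> E" for d d' by (rule conn_matching[OF m])
  qed (use diagramD(1)[OF d] mates xy in simp_all)
  \<comment> \<open>The smoothing across the loop runs from \<open>q\<close> through
    \<open>x\<close> and \<open>y\<close> to \<open>p\<close>.\<close>
  have B: "realizes K (insert {x, y} E) (insert {x, q} (insert {y, p} L)) C n \<longleftrightarrow>
      realizes K E (insert {q, p} L) C n"
    by (rule contract_link_eq) (use dd in simp_all)
  show "realizes K (insert {x, y} E) (insert {x, p} (insert {y, q} L)) C n \<longleftrightarrow>
      realizes K E (insert {p, q} L) C n"
    by (rule contract_link_eq) (use dd in simp_all)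
  have dist': "distinct [x, p, y, q]" using dist by auto
  show "(\<Sum>c\<in>choices False x p y q. of_bool (realizes K (insert {x, y} E) (c \<union> L) C n) :: nat) =
      of_bool (realizes K E (insert {p, q} L) C n)"
    using A B by (simp add: sum_choices[OF dist'] insert_commute)
qed

text \<open>In the labels below, the letters stand for the two vertices in order: \<open>A\<close>
  joins the two bigon half-edges at the vertex, \<open>B\<close> is the other smoothing, and
  \<open>X\<close> keeps the vertex. Modulo 2 only \<open>BB\<close> remains, and it gives the same
  strands as straight passage, which is the right-hand side.\<close>

lemma realizes_bigon:
  assumes d: "diagram E L C" and m: "matching E" and f: "{p, q, r, s} \<subseteq> free E L C"
    and xy: "x \<notin> \<Union>E" "y \<notin> \<Union>E" "x' \<notin> \<Union>E" "y' \<notin> \<Union>E"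
    and dist: "distinct [x, y, x', y', p, q, r, s]"
  shows "even (pair_sum K b (insert {x, x'} (insert {y, y'} E)) L C n x p y q x' r y' s) \<longleftrightarrow>
      \<not> realizes K E (insert {p, r} (insert {q, s} L)) C n"
    and "realizes K (insert {x, x'} (insert {y, y'} E))
        (insert {x, p} (insert {y, q} (insert {x', r} (insert {y', s} L)))) C n \<longleftrightarrow>
      realizes K E (insert {p, r} (insert {q, s} L)) C n"
proof -
  let ?E1 = "insert {y, y'} E" and ?E1' = "insert {y', y} E"
  let ?E2 = "insert {x, x'} (insert {y, y'} E)" and ?E2' = "insert {x', x} (insert {y', y} E)"
  have f': "p \<in> free E L C" "q \<in> free E L C" "r \<in> free E L C" "s \<in> free E L C" using f by simp_all
  have nL: "x \<notin> \<Union>L" "y \<notin> \<Union>L" "x' \<notin> \<Union>L" "y' \<notin> \<Union>L"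
    and nC: "x \<notin> \<Union>(\<Union>C)" "y \<notin> \<Union>(\<Union>C)" "x' \<notin> \<Union>(\<Union>C)" "y' \<notin> \<Union>(\<Union>C)"
    using xy diagramD(4,5)[OF d] by metis+
  note pE = f'[THEN freeD(1)] and pL = f'[THEN freeD(2)] and pC = f'[THEN freeD(3)]
  note dd = dist distinct_rev[THEN iffD2, OF dist]
  note [simp] = diagram_simps d f' xy nL nC pE pL pC relabel_simps relabel_id(1)[OF nL(1)] relabel_id(1)[OF nL(2)]
    relabel_id(1)[OF nL(3)] relabel_id(1)[OF nL(4)] relabel_id(2)[OF nC(1)]
    relabel_id(2)[OF nC(2)] relabel_id(2)[OF nC(3)] relabel_id(2)[OF nC(4)]
    doubleton_eq_iff
  let ?X = "{{x, p}, {y, q}}" and ?Y = "{{x', r}, {y', s}}"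
  show frame: "realizes K ?E2 (insert {x, p} (insert {y, q} (insert {x', r} (insert {y', s} L)))) C n \<longleftrightarrow>
      realizes K E (insert {p, r} (insert {q, s} L)) C n" (is "?l \<longleftrightarrow> _")
  proof -
    have "?l \<longleftrightarrow>
      realizes K ?E1 (insert {y, q} (insert {p, r} (insert {y', s} L))) C n"
      by (rule contract_link_eq) (use dd in simp_all)
    also have "\<dots> \<longleftrightarrow> realizes K E (insert {p, r} (insert {q, s} L)) C n"
      by (rule contract_link_eq) (use dd in simp_all)
    finally show ?thesis .
  qed
  \<comment> \<open>The two bigon edges close up to a circle.\<close>
  have AA: "\<not> realizes K ?E2 (insert {x, y} (insert {p, q} (insert {x', y'} (insert {r, s} L)))) C n" (is "\<not> ?l")
  proof -
    have "?l \<longleftrightarrow>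
      realizes K ?E1 (insert {y, y'} (insert {p, q} (insert {r, s} L))) C n"
      by (rule contract_link_eq)
        (use dd in \<open>simp_all add: insert_commute\<close>)
    also have "\<dots> \<longleftrightarrow> realizes K E (insert {p, q} (insert {r, s} L)) C (Suc n)"
    proof (rule realizes_contract_circle)
      show "\<Union>(insert {p, q} (insert {r, s} L)) \<subseteq> \<Union>E" using diagramD(2)[OF d] pE by simp
      show "(d, d') \<in> conn E \<longleftrightarrow> d = d' \<or> {d, d'} \<in> E" for d d' by (rule conn_matching[OF m])
    qed (use diagramD(1)[OF d] mates xy in simp_all)
    also have "\<not> \<dots>"
      by (rule not_realizes_circle[of _ _ p]) (use diagramD(1,2)[OF d] pE in simp_all)
    finally show ?thesis .
  qed
  \<comment> \<open>This state and \<open>BA\<close> both turn the tangle into \<open>p\<close>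
    joined to \<open>q\<close> and \<open>r\<close> joined to \<open>s\<close>, so they
    cancel.\<close>
  have AB: "realizes K ?E2 (insert {x, y} (insert {p, q} (insert {x', s} (insert {y', r} L)))) C n \<longleftrightarrow>
    realizes K E (insert {p, q} (insert {r, s} L)) C n" (is "?l \<longleftrightarrow> _")
  proof -
    have "?l \<longleftrightarrow>
      realizes K ?E1 (insert {y', r} (insert {p, q} (insert {y, s} L))) C n"
      by (rule contract_link_eq)
        (use dd in \<open>simp_all add: insert_commute\<close>)
    also have "\<dots> \<longleftrightarrow> realizes K ?E1' (insert {y', r} (insert {p, q} (insert {y, s} L))) C n"
      by (simp only: insert_commute[of y y'])
    also have "\<dots> \<longleftrightarrow> realizes K E (insert {p, q} (insert {r, s} L)) C n"
      by (rule contract_link_eq) (use dd in simp_all)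
    finally show ?thesis .
  qed
  have BA: "realizes K ?E2 (insert {x, q} (insert {y, p} (insert {x', y'} (insert {r, s} L)))) C n \<longleftrightarrow>
    realizes K E (insert {p, q} (insert {r, s} L)) C n" (is "?l \<longleftrightarrow> _")
  proof -
    have "?l \<longleftrightarrow>
      realizes K ?E1 (insert {y, p} (insert {q, y'} (insert {r, s} L))) C n"
      by (rule contract_link_eq) (use dd in simp_all)
    also have "\<dots> \<longleftrightarrow> realizes K E (insert {q, p} (insert {r, s} L)) C n"
      by (rule contract_link_eq) (use dd in simp_all)
    finally show ?thesis by (simp only: insert_commute[of p q])
  qed
  \<comment> \<open>Each strand uses the other bigon edge than in straight passage, but joins the
    same outer half-edges.\<close>
  have BB: "realizes K ?E2 (insert {x, q} (insert {y, p} (insert {x', s} (insert {y', r} L)))) C n \<longleftrightarrow>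
    realizes K E (insert {p, r} (insert {q, s} L)) C n" (is "?l \<longleftrightarrow> _")
  proof -
    have "?l \<longleftrightarrow>
      realizes K ?E1 (insert {y, p} (insert {q, s} (insert {y', r} L))) C n"
      by (rule contract_link_eq) (use dd in simp_all)
    also have "\<dots> \<longleftrightarrow> realizes K E (insert {q, s} (insert {p, r} L)) C n"
      by (rule contract_link_eq) (use dd in simp_all)
    finally show ?thesis by (simp only: insert_commute[of "{p, r}" "{q, s}"])
  qed
  have XX: "\<not> realizes K ?E2 L (insert ?X (insert ?Y C)) n"
  proof (rule not_realizes_bigon[where c = ?X and c' = ?Y])
    have "x \<in> \<Union>?X" "x \<notin> \<Union>?Y" using dist by simp_all
    then show "?X \<noteq> ?Y" by metis
  qed (use dd in simp_all)
  \<comment> \<open>The smoothed vertex closes the bigon edges to a loop at the kept vertex, on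
    half-edges that are not opposite there.\<close>
  have XA: "\<not> realizes K ?E2 (insert {x', y'} (insert {r, s} L)) (insert ?X C) n" (is "\<not> ?l")
  proof -
    have "?l \<longleftrightarrow>
      realizes K ?E2' (insert {x', y'} (insert {r, s} L)) (insert ?X C) n"
      by (simp only: insert_commute[of y y'] insert_commute[of x x'])
    also have "\<dots> \<longleftrightarrow> realizes K ?E1' (insert {r, s} L) (insert {{y', p}, {y, q}} C) n"
      by (rule contract_link_eq) (use dd in simp_all)
    also have "\<not> \<dots>"
      by (rule not_realizes_loop[where c = "{{y', p}, {y, q}}"])
        (use dd in simp_all)
    finally show ?thesis .
  qed
  have AX: "\<not> realizes K ?E2 (insert {x, y} (insert {p, q} L)) (insert ?Y C) n" (is "\<not> ?l")
  proof -
    have "?l \<longleftrightarrow>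
      realizes K ?E1 (insert {p, q} L) (insert {{y, r}, {y', s}} C) n"
      by (rule contract_link_eq) (use dd in simp_all)
    also have "\<not> \<dots>"
      by (rule not_realizes_loop[where c = "{{y, r}, {y', s}}"])
        (use dd in simp_all)
    finally show ?thesis .
  qed
  \<comment> \<open>The bigon edges now lead from the kept vertex to \<open>r\<close> and
    \<open>s\<close>. \<open>BX\<close> gives a crossing with the same opposite pairs, so these two
    states cancel.\<close>
  have XB: "realizes K ?E2 (insert {x', s} (insert {y', r} L)) (insert ?X C) n \<longleftrightarrow>
    realizes K E L (insert {{q, r}, {p, s}} C) n" (is "?l \<longleftrightarrow> _")
  proof -
    have "?l \<longleftrightarrow>
      realizes K ?E2' (insert {x', s} (insert {y', r} L)) (insert ?X C) n"
      by (simp only: insert_commute[of y y'] insert_commute[of x x'])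
    also have "\<dots> \<longleftrightarrow> realizes K ?E1' (insert {y', r} L) (insert {{s, p}, {y, q}} C) n"
      by (rule contract_link_eq) (use dd in simp_all)
    also have "\<dots> \<longleftrightarrow> realizes K E L (insert {{s, p}, {r, q}} C) n"
      by (rule contract_link_eq) (use dd in simp_all)
    finally show ?thesis by (simp only: insert_commute)
  qed
  have BX: "realizes K ?E2 (insert {x, q} (insert {y, p} L)) (insert ?Y C) n \<longleftrightarrow>
    realizes K E L (insert {{q, r}, {p, s}} C) n" (is "?l \<longleftrightarrow> _")
  proof -
    have "?l \<longleftrightarrow>
      realizes K ?E1 (insert {y, p} L) (insert {{q, r}, {y', s}} C) n"
      by (rule contract_link_eq) (use dd in simp_all)
    also have "\<dots> \<longleftrightarrow> realizes K E L (insert {{q, r}, {p, s}} C) n"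
      by (rule contract_link_eq) (use dd in simp_all)
    finally show ?thesis .
  qed
  have dist': "distinct [x, p, y, q]" "distinct [x', r, y', s]" using dd by simp_all
  show "even (pair_sum K b ?E2 L C n x p y q x' r y' s) \<longleftrightarrow>
      \<not> realizes K E (insert {p, r} (insert {q, s} L)) C n"
    unfolding pair_sum_def sum_choices[OF dist'(1)] sum_choices[OF dist'(2)] kept_def
    using AA AB BA BB XX XA AX XB BX
    by (cases b; simp only: Un_insert_left Un_empty_left insert_not_empty if_True if_False simp_thms; simp)
qed

text \<open>
  For the even vertex of a triangle, the smoothing that joins the two triangle edges turns the
  triangle into a bigon; the other one gives a tangle that is symmetric under the third move.
\<close>

lemma even_triangle_sum:
  assumes d: "diagram E L C" and m: "matching E" and f: "{p1, p2, p3, p4, p5, p6} \<subseteq> free E L C"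
    and abc: "a1 \<notin> \<Union>E" "a2 \<notin> \<Union>E" "b1 \<notin> \<Union>E" "b2 \<notin> \<Union>E" "c1 \<notin> \<Union>E" "c2 \<notin> \<Union>E"
    and dist: "distinct [a1, a2, b1, b2, c1, c2, p1, p2, p3, p4, p5, p6]"
  shows "even (\<Sum>c\<in>choices False a1 p1 c2 p6.
      pair_sum K b (insert {a1, a2} (insert {c2, c1} (insert {b1, b2} E))) (c \<union> L) C n
        a2 p2 b1 p3 c1 p5 b2 p4) \<longleftrightarrow>
    (realizes K E (insert {p2, p5} (insert {p3, p4} (insert {p1, p6} L))) C n \<longleftrightarrow>
      odd (pair_sum K b (insert {b1, b2} E) L C n p1 p5 b2 p4 p6 p2 b1 p3))"
proof -
  let ?E1 = "insert {b1, b2} E" and ?E2 = "insert {c2, c1} (insert {b1, b2} E)"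
  let ?E3 = "insert {a1, a2} (insert {c2, c1} (insert {b1, b2} E))"
  have f': "p1 \<in> free E L C" "p2 \<in> free E L C" "p3 \<in> free E L C" "p4 \<in> free E L C"
    "p5 \<in> free E L C" "p6 \<in> free E L C" using f by simp_all
  note dd = dist distinct_rev[THEN iffD2, OF dist]
  note [simp] = diagram_simps d f' abc
  \<comment> \<open>The link between \<open>a1\<close> and \<open>c2\<close> merges two triangle
    edges. Together with the third one they form a bigon, to which the sum for the second move
    applies.\<close>
  have A: "even (pair_sum K b ?E3 (insert {a1, c2} (insert {p1, p6} L)) C n a2 p2 b1 p3 c1 p5 b2 p4) \<longleftrightarrow>
    \<not> realizes K E (insert {p2, p5} (insert {p3, p4} (insert {p1, p6} L))) C n"
  proof -
    have "pair_sum K b ?E3 (insert {a1, c2} (insert {p1, p6} L)) C n a2 p2 b1 p3 c1 p5 b2 p4 =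
      pair_sum K b ?E2 (insert {p1, p6} L) C n c2 p2 b1 p3 c1 p5 b2 p4"
      by (rule pair_sum_contract) (use dd in simp_all)
    moreover have "even (pair_sum K b ?E2 (insert {p1, p6} L) C n c2 p2 b1 p3 c1 p5 b2 p4) \<longleftrightarrow>
      \<not> realizes K E (insert {p2, p5} (insert {p3, p4} (insert {p1, p6} L))) C n"
      by (rule realizes_bigon(1)) (use dd m in simp_all)
    ultimately show ?thesis by simp
  qed
  \<comment> \<open>At one remaining vertex \<open>a2\<close> is replaced by \<open>p6\<close>, at
    the other \<open>c1\<close> by \<open>p1\<close>; only the edge between \<open>b1\<close> and
    \<open>b2\<close> is left inside.\<close>
  have B: "pair_sum K b ?E3 (insert {a1, p6} (insert {c2, p1} L)) C n a2 p2 b1 p3 c1 p5 b2 p4 =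
    pair_sum K b ?E1 L C n p1 p5 b2 p4 p6 p2 b1 p3"
  proof -
    have "pair_sum K b ?E3 (insert {a1, p6} (insert {c2, p1} L)) C n a2 p2 b1 p3 c1 p5 b2 p4 =
      pair_sum K b ?E2 (insert {c2, p1} L) C n p6 p2 b1 p3 c1 p5 b2 p4"
      by (rule pair_sum_contract) (use dd in simp_all)
    also have "\<dots> = pair_sum K b ?E2 (insert {c2, p1} L) C n c1 p5 b2 p4 p6 p2 b1 p3"
      by (rule pair_sum_swap)
    also have "\<dots> = pair_sum K b ?E1 L C n p1 p5 b2 p4 p6 p2 b1 p3"
      by (rule pair_sum_contract) (use dd in simp_all)
    finally show ?thesis .
  qed
  have dist': "distinct [a1, p1, c2, p6]" using dd by simp
  show ?thesis
    unfolding sum_choices[OF dist'] using A B by simp blast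
qed

text \<open>The move interchanges \<open>p1\<close> with \<open>p2\<close>, \<open>p3\<close> with
  \<open>p4\<close> and \<open>p5\<close> with \<open>p6\<close>. The links obtained from the bigon
  form the same set afterwards. The two-crossing tangle has the same outer pairs, only with the
  names \<open>b1\<close> and \<open>b2\<close> of the inner ends exchanged.\<close>

lemma triangle_sum_swap:
  assumes d: "diagram E L C" and m: "matching E" and f: "{p1, p2, p3, p4, p5, p6} \<subseteq> free E L C"
    and abc: "a1 \<notin> \<Union>E" "a2 \<notin> \<Union>E" "b1 \<notin> \<Union>E" "b2 \<notin> \<Union>E" "c1 \<notin> \<Union>E" "c2 \<notin> \<Union>E"
    and dist: "distinct [a1, a2, b1, b2, c1, c2, p1, p2, p3, p4, p5, p6]"
  shows "even (\<Sum>c\<in>choices False a1 p1 c2 p6.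
      pair_sum K b (insert {a1, a2} (insert {c2, c1} (insert {b1, b2} E))) (c \<union> L) C n
        a2 p2 b1 p3 c1 p5 b2 p4) \<longleftrightarrow>
    even (\<Sum>c\<in>choices False a1 p2 c2 p5.
      pair_sum K b (insert {a1, a2} (insert {c2, c1} (insert {b1, b2} E))) (c \<union> L) C n
        a2 p1 b1 p4 c1 p6 b2 p3)"
proof -
  let ?E1 = "insert {b1, b2} E"
  have f': "p1 \<in> free E L C" "p2 \<in> free E L C" "p3 \<in> free E L C" "p4 \<in> free E L C"
    "p5 \<in> free E L C" "p6 \<in> free E L C" using f by simp_all
  note dd = dist distinct_rev[THEN iffD2, OF dist]
  note [simp] = diagram_simps d f' abc
  \<comment> \<open>Once the crossings are reordered and opposite half-edges flipped, only the names
    \<open>b1\<close> and \<open>b2\<close> still differ.\<close>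
  define h where "h = transpose b1 b2"
  have h: "h b1 = b2" "h b2 = b1" by (simp_all add: h_def)
  have hid: "h z = z" if "z \<in> \<Union>E" for z
  proof -
    have "z \<noteq> b1" "z \<noteq> b2" using that abc by metis+
    then show ?thesis by (simp add: h_def)
  qed
  have "image h ` E = E" using hid by (rule image_id_on)
  then have hE: "image h ` ?E1 = ?E1" using h by (simp add: insert_commute)
  have "pair_sum K b ?E1 L C n p2 p6 b2 p3 p5 p1 b1 p4 = pair_sum K b ?E1 L C n p6 p2 b2 p3 p5 p1 b1 p4"
    by (rule pair_sum_flip)
  also have "\<dots> = pair_sum K b ?E1 L C n p5 p1 b1 p4 p6 p2 b2 p3" by (rule pair_sum_swap)
  also have "\<dots> = pair_sum K b ?E1 L C n p1 p5 b1 p4 p6 p2 b2 p3" by (rule pair_sum_flip)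
  also have "\<dots> = pair_sum K b (image h ` ?E1) L C n (h p1) (h p5) (h b1) (h p4) (h p6) (h p2) (h b2) (h p3)"
  proof (rule pair_sum_rename)
    show "inj_on h (\<Union>?E1)" unfolding h_def by (rule inj_on_subset[OF inj_transpose]) simp
    show "h z = z" if "z \<in> \<Union>L" for z using hid diagramD(4)[OF d that] .
    show "h z = z" if "z \<in> \<Union>(\<Union>C)" for z using hid diagramD(5)[OF d that] .
  qed (use dd in simp_all)
  also have "\<dots> = pair_sum K b ?E1 L C n p1 p5 b2 p4 p6 p2 b1 p3"
    unfolding hE h hid[OF freeD(1)[OF f'(1)]] hid[OF freeD(1)[OF f'(2)]] hid[OF freeD(1)[OF f'(3)]]
      hid[OF freeD(1)[OF f'(4)]] hid[OF freeD(1)[OF f'(5)]] hid[OF freeD(1)[OF f'(6)]] ..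
  finally have B: "pair_sum K b ?E1 L C n p2 p6 b2 p3 p5 p1 b1 p4 =
    pair_sum K b ?E1 L C n p1 p5 b2 p4 p6 p2 b1 p3" .
  have A: "insert {p1, p6} (insert {p4, p3} (insert {p2, p5} L)) =
    insert {p2, p5} (insert {p3, p4} (insert {p1, p6} L))" by (simp only: insert_commute)
  have f2: "{p2, p1, p4, p3, p6, p5} \<subseteq> free E L C" using f' by simp
  have dist2: "distinct [a1, a2, b1, b2, c1, c2, p2, p1, p4, p3, p6, p5]" using dist by auto
  show ?thesis
    unfolding even_triangle_sum[OF d m f abc dist] even_triangle_sum[OF d m f2 abc dist2] A B ..
qed

end

text \<open>Passing straight through all three vertices joins the two outer half-edges of each
  strand. These pairs are not changed by the third move, whence the invariance of the number of
  unicursal components.\<close>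

lemma realizes_triangle_frame:
  assumes d: "diagram E L C" and f: "{p1, p2, p3, p4, p5, p6} \<subseteq> free E L C"
    and abc: "a1 \<notin> \<Union>E" "a2 \<notin> \<Union>E" "b1 \<notin> \<Union>E" "b2 \<notin> \<Union>E" "c1 \<notin> \<Union>E" "c2 \<notin> \<Union>E"
    and dist: "distinct [a1, a2, b1, b2, c1, c2, p1, p2, p3, p4, p5, p6]"
  shows "realizes K (insert {a1, a2} (insert {c2, c1} (insert {b1, b2} E)))
      (insert {a1, p1} (insert {c2, p6} (insert {b1, p3} (insert {a2, p2} (insert {c1, p5} (insert {b2, p4} L)))))) C n \<longleftrightarrow>
    realizes K E (insert {p1, p2} (insert {p3, p4} (insert {p5, p6} L))) C n"
proof -
  let ?E1 = "insert {b1, b2} E" and ?E2 = "insert {c2, c1} (insert {b1, b2} E)"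
  have f': "p1 \<in> free E L C" "p2 \<in> free E L C" "p3 \<in> free E L C" "p4 \<in> free E L C"
    "p5 \<in> free E L C" "p6 \<in> free E L C" using f by simp_all
  have nL: "a2 \<notin> \<Union>L" "b2 \<notin> \<Union>L" "c1 \<notin> \<Union>L" "a1 \<notin> \<Union>L" "b1 \<notin> \<Union>L" "c2 \<notin> \<Union>L"
    and nC: "a2 \<notin> \<Union>(\<Union>C)" "b2 \<notin> \<Union>(\<Union>C)" "c1 \<notin> \<Union>(\<Union>C)"
    using abc diagramD(4,5)[OF d] by metis+
  note dd = dist distinct_rev[THEN iffD2, OF dist]
  note [simp] = diagram_simps d f' abc nL nC f'[THEN freeD(1)] f'[THEN freeD(2)] relabel_simps relabel_id(1)[OF nL(1)]
    relabel_id(1)[OF nL(2)] relabel_id(1)[OF nL(3)] relabel_id(2)[OF nC(1)]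
    relabel_id(2)[OF nC(2)] relabel_id(2)[OF nC(3)]
  have "realizes K (insert {a1, a2} ?E2)
      (insert {a1, p1} (insert {c2, p6} (insert {b1, p3} (insert {a2, p2} (insert {c1, p5} (insert {b2, p4} L)))))) C n \<longleftrightarrow>
    realizes K ?E2
      (insert {c2, p6} (insert {b1, p3} (insert {p1, p2} (insert {c1, p5} (insert {b2, p4} L))))) C n"
    by (rule contract_link_eq) (use dd in simp_all)
  also have "\<dots> \<longleftrightarrow> realizes K ?E1
      (insert {b1, p3} (insert {p1, p2} (insert {p6, p5} (insert {b2, p4} L)))) C n"
    by (rule contract_link_eq) (use dd in simp_all)
  also have "\<dots> \<longleftrightarrow> realizes K E (insert {p1, p2} (insert {p6, p5} (insert {p3, p4} L))) C n"
    by (rule contract_link_eq) (use dd in simp_all)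
  finally show ?thesis by (simp only: insert_commute)
qed

declare Union_iff [simp]

section \<open>The state count\<close>

text \<open>Two non-opposite half-edges and their opposites exhaust the vertex. A smoothing is
  determined by the partner of \<open>x\<close>, for which two half-edges remain.\<close>

lemma four_halves:
  assumes G: "framed_4_graph G" and v: "v \<in> verts G"
    and xy: "x \<in> halves_at G {v}" "y \<in> halves_at G {v}" "y \<noteq> x" "y \<noteq> opp G x"
  shows "distinct [x, opp G x, y, opp G y]" and "halves_at G {v} = {x, opp G x, y, opp G y}"
    and "crossing G v = {{x, opp G x}, {y, opp G y}}"
    and "smoothings G v = {{{x, y}, {opp G x, opp G y}}, {{x, opp G y}, {y, opp G x}}}"
proof -
  let ?A = "halves_at G {v}" and ?p = "opp G x" and ?q = "opp G y"
  have po: "\<And>d. d \<in> ?A \<Longrightarrow> opp G d \<in> ?A" "\<And>d. d \<in> ?A \<Longrightarrow> opp G d \<noteq> d"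
    "\<And>d. d \<in> ?A \<Longrightarrow> opp G (opp G d) = d"
    using framed_opp[OF G v] by (simp_all add: pairing_on_def)
  have pq: "?p \<in> ?A" "?q \<in> ?A" "?p \<noteq> x" "?q \<noteq> y" "opp G ?p = x" "opp G ?q = y"
    using po xy by simp_all
  have "?p \<noteq> ?q" using pq(5,6) xy(3) by metis
  moreover have "?q \<noteq> x" using pq(6) xy(4) by metis
  ultimately show dist: "distinct [x, ?p, y, ?q]" using pq xy by simp
  have fin: "finite ?A" using framed_card[OF G v] card_ge_0_finite[of ?A] by simp
  have "card {x, ?p, y, ?q} = 4" using dist by (simp add: card_insert_if)
  then have "{x, ?p, y, ?q} = ?A"
    using card_subset_eq[OF fin, of "{x, ?p, y, ?q}"] pq xy framed_card[OF G v] by simp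
  then show A: "?A = {x, ?p, y, ?q}" by simp
  show "crossing G v = {{x, ?p}, {y, ?q}}"
    unfolding crossing_def A links_def using pq by (simp add: insert_commute)
  show "smoothings G v = {{{x, y}, {?p, ?q}}, {{x, ?q}, {y, ?p}}}" (is "_ = {?L1, ?L2}")
  proof (intro equalityI subsetI)
    fix L assume "L \<in> smoothings G v"
    then obtain s where s: "L = links ?A s" "pairing_on ?A s" "\<forall>d\<in>?A. s d \<noteq> opp G d"
      by (rule smoothingsE)
    have sA: "\<And>d. d \<in> ?A \<Longrightarrow> s d \<in> ?A" "\<And>d. d \<in> ?A \<Longrightarrow> s d \<noteq> d" "\<And>d. d \<in> ?A \<Longrightarrow> s (s d) = d"
      using s(2) by (simp_all add: pairing_on_def)
    have L: "L = {{x, s x}, {?p, s ?p}, {y, s y}, {?q, s ?q}}"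
      unfolding s(1) A links_def by simp
    have "s x \<in> {x, ?p, y, ?q}" using sA(1)[OF xy(1)] unfolding A .
    moreover have "s x \<noteq> x" "s x \<noteq> ?p" using sA(2)[OF xy(1)] s(3) xy(1) by simp_all
    ultimately have "s x = y \<or> s x = ?q" by simp
    moreover have sp: "s ?p \<in> {x, ?p, y, ?q}" "s ?p \<noteq> ?p" "s ?p \<noteq> x"
      using sA(1)[OF pq(1)] sA(2)[OF pq(1)] bspec[OF s(3) pq(1)] pq(5) unfolding A[symmetric] by simp_all
    ultimately show "L \<in> {?L1, ?L2}"
    proof (elim disjE)
      assume a: "s x = y"
      then have y: "s y = x" using sA(3)[OF xy(1)] by simp
      have "s ?p \<noteq> y" using sA(3)[OF pq(1)] y pq(3) by metis
      then have p: "s ?p = ?q" using sp by simp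
      then have "s ?q = ?p" using sA(3)[OF pq(1)] by simp
      then have "L = ?L1" unfolding L a y p by (simp add: insert_commute)
      then show ?thesis by simp
    next
      assume a: "s x = ?q"
      then have q: "s ?q = x" using sA(3)[OF xy(1)] by simp
      have "s ?p \<noteq> ?q" using sA(3)[OF pq(1)] q pq(3) by metis
      then have p: "s ?p = y" using sp by simp
      then have y: "s y = ?p" using sA(3)[OF pq(1)] by simp
      have "L = ?L2" unfolding L a y p q by (simp add: insert_commute)
      then show ?thesis by simp
    qed
  next
    fix L assume L: "L \<in> {?L1, ?L2}"
    have dd: "?p \<noteq> x" "y \<noteq> x" "?q \<noteq> x" "y \<noteq> ?p" "?q \<noteq> ?p" "?q \<noteq> y" using dist by auto
    note dd = dd dd[symmetric]
    have mem: "{{x, r}, {?p, t}} \<in> smoothings G v" if rt: "r = y \<and> t = ?q \<or> r = ?q \<and> t = y" for r t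
      unfolding smoothings_def
    proof (intro CollectI exI conjI)
      \<comment> \<open>The pairing exchanges \<open>x\<close> with \<open>r\<close> and
        \<open>opp G x\<close> with \<open>t\<close>; on these four half-edges the last branch is
        reached only by \<open>t\<close>.\<close>
      define s where "s = (\<lambda>d. if d = x then r else if d = r then x else if d = ?p then t else ?p)"
      have s: "s x = r" "s r = x" "s ?p = t" "s t = ?p" using dd rt by (auto simp: s_def)
      have A': "?A = {x, ?p, r, t}" using rt unfolding A by auto
      show "{{x, r}, {?p, t}} = links ?A s" unfolding A' links_def by (simp add: s insert_commute)
      show "pairing_on ?A s" unfolding A' pairing_on_def using dd rt by (auto simp: s)
      show "\<forall>d\<in>?A. s d \<noteq> opp G d" unfolding A' using dd rt by (auto simp: s pq)
    qed
    have "?L1 \<in> smoothings G v" "?L2 \<in> smoothings G v"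
      using mem[of y ?q] mem[of ?q y] by (simp_all add: insert_commute)
    then show "L \<in> smoothings G v" using L by auto
  qed
qed

definition node_states :: "(fgraph \<Rightarrow> nat \<Rightarrow> bool) \<Rightarrow> fgraph \<Rightarrow> nat \<Rightarrow> nat set set set" where
  "node_states odd_at G v = smoothings G v \<union> (if odd_at G v then {{}} else {})"

text \<open>States are extensional, so that two states with the same values at the vertices are
  counted as one.\<close>

definition states :: "(fgraph \<Rightarrow> nat \<Rightarrow> bool) \<Rightarrow> fgraph \<Rightarrow> (nat \<Rightarrow> nat set set) set" where
  "states odd_at G = PiE (verts G) (node_states odd_at G)"

definition state_count :: "fgraph \<Rightarrow> (fgraph \<Rightarrow> nat \<Rightarrow> bool) \<Rightarrow> fgraph \<Rightarrow> nat" where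
  "state_count K odd_at G = (\<Sum>l\<in>states odd_at G. of_bool (resolves K G l))"

lemma node_states_choices:
  assumes "framed_4_graph G" "v \<in> verts G"
    and "x \<in> halves_at G {v}" "y \<in> halves_at G {v}" "y \<noteq> x" "y \<noteq> opp G x"
  shows "node_states odd_at G v = choices (odd_at G v) x (opp G x) y (opp G y)"
  unfolding node_states_def choices_def four_halves(4)[OF assms] ..

lemma exists_halves:
  assumes G: "framed_4_graph G" and v: "v \<in> verts G"
  obtains x y where "x \<in> halves_at G {v}" "y \<in> halves_at G {v}" "y \<noteq> x" "y \<noteq> opp G x"
proof -
  let ?A = "halves_at G {v}"
  obtain x where x: "x \<in> ?A" using halves_at_nonempty[OF G v] by blast
  have "\<not> ?A \<subseteq> {x, opp G x}"
  proof
    assume "?A \<subseteq> {x, opp G x}"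
    then have "card ?A \<le> card {x, opp G x}" by (intro card_mono) simp_all
    also have "\<dots> \<le> 2" by (simp add: card_insert_if)
    finally show False using framed_card[OF G v] by simp
  qed
  then show thesis using that x by blast
qed

text \<open>Separates the choice at one vertex from the rest: the outer sum runs over exterior
  states, the inner one over local states.\<close>

lemma sum_PiE_insert:
  fixes f :: "('a \<Rightarrow> 'b) \<Rightarrow> nat"
  assumes "i \<notin> I"
  shows "(\<Sum>l\<in>PiE (insert i I) A. f l) = (\<Sum>l\<in>PiE I A. \<Sum>c\<in>A i. f (l(i := c)))"
proof -
  have "(\<Sum>l\<in>PiE (insert i I) A. f l) =
      (\<Sum>z\<in>A i \<times> PiE I A. f ((\<lambda>(c, l). l(i := c)) z))"
    unfolding PiE_insert_eq by (subst sum.reindex[OF inj_combinator[OF assms]]) simp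
  also have "\<dots> = (\<Sum>c\<in>A i. \<Sum>l\<in>PiE I A. f (l(i := c)))"
    by (simp add: sum.cartesian_product case_prod_unfold)
  finally show ?thesis by (simp only: sum.swap[of _ "PiE I A"])
qed

lemma even_sum_cong:
  fixes f g :: "'a \<Rightarrow> nat"
  assumes "\<And>x. x \<in> A \<Longrightarrow> even (f x) \<longleftrightarrow> even (g x)"
  shows "even (sum f A) \<longleftrightarrow> even (sum g A)"
  using assms by (induction A rule: infinite_finite_induct) simp_all

definition kept_crossings :: "fgraph \<Rightarrow> nat set \<Rightarrow> (nat \<Rightarrow> nat set set) \<Rightarrow> nat set set set" where
  "kept_crossings G I l = crossing G ` {v \<in> I. l v = {}}"

lemma Union_update: "u \<notin> I \<Longrightarrow> \<Union>((l(u := c)) ` insert u I) = c \<union> \<Union>(l ` I)"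
proof -
  assume "u \<notin> I"
  then have "(l(u := c)) ` I = l ` I" by (intro image_cong) auto
  then show ?thesis by (simp only: image_insert fun_upd_same Union_insert)
qed

lemma kept_crossings_update:
  assumes "u \<notin> I"
  shows "kept_crossings G (insert u I) (l(u := c)) = kept c (crossing G u) \<union> kept_crossings G I l"
proof -
  have "{v \<in> insert u I. (l(u := c)) v = {}} = (if c = {} then {u} else {}) \<union> {v \<in> I. l v = {}}"
    using assms by auto
  then show ?thesis by (simp add: kept_crossings_def kept_def)
qed

lemma resolves_alt:
  "resolves K G l \<longleftrightarrow> realizes K (edges G) (\<Union>(l ` verts G)) (kept_crossings G (verts G) l) (circles G)"
  by (simp add: resolves_def kept_crossings_def)

text \<open>Resolving only the vertices in \<open>I\<close> leaves a valid diagram; the half-edges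
  of \<open>E\<close> at other vertices remain available for the local computation. \<open>E\<close>
  may omit the edges inside the move.\<close>

lemma exterior_diagram:
  assumes G: "framed_4_graph G" and I: "I \<subseteq> verts G"
    and l: "\<And>v. v \<in> I \<Longrightarrow> \<Union>(l v) \<subseteq> halves_at G {v}"
    and dbl: "\<And>v e. v \<in> I \<Longrightarrow> e \<in> l v \<Longrightarrow> \<exists>a b. e = {a, b}"
    and E: "E \<subseteq> edges G" and IE: "halves_at G I \<subseteq> \<Union>E"
  shows "diagram E (\<Union>(l ` I)) (kept_crossings G I l)"
    and "\<Union>E - halves_at G I \<subseteq> free E (\<Union>(l ` I)) (kept_crossings G I l)"
proof -
  have L: "\<exists>v\<in>I. x \<in> \<Union>(l v) \<and> x \<in> halves_at G {v}" if x: "x \<in> \<Union>(\<Union>(l ` I))" for x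
  proof -
    obtain v where "v \<in> I" "x \<in> \<Union>(l v)" using x by auto
    then show ?thesis using l[of v] by (intro bexI[of _ v]) auto
  qed
  have C: "\<exists>v\<in>I. l v = {} \<and> x \<in> halves_at G {v}" if x: "x \<in> \<Union>(\<Union>(kept_crossings G I l))" for x
  proof -
    obtain v where v: "v \<in> I" "l v = {}" "x \<in> \<Union>(crossing G v)"
      using x by (auto simp: kept_crossings_def)
    then show ?thesis using Union_crossing[OF G, of v] I by (intro bexI[of _ v]) auto
  qed
  have at: "x \<in> halves_at G I" if "v \<in> I" "x \<in> halves_at G {v}" for v x
    using that by (simp add: halves_at_def)
  have uniq: "v = w" if "x \<in> halves_at G {v}" "x \<in> halves_at G {w}" for v w x
    using that by (simp add: halves_at_def)
  show "diagram E (\<Union>(l ` I)) (kept_crossings G I l)"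
  proof (rule diagramI)
    have "finite (\<Union>(edges G))" using framed_finite[OF G] by (simp add: Union_edges[OF G])
    then show "finite (\<Union>E)" by (rule rev_finite_subset) (use E in auto)
    show "\<exists>a b. e = {a, b}" if e: "e \<in> \<Union>(l ` I)" for e
    proof -
      obtain v where "v \<in> I" "e \<in> l v" using e by auto
      then show ?thesis by (rule dbl)
    qed
    show "\<Union>(\<Union>(l ` I)) \<subseteq> \<Union>E"
      by (rule subsetI, drule L) (use at IE in blast)
    show "\<Union>(\<Union>(kept_crossings G I l)) \<subseteq> \<Union>E - \<Union>(\<Union>(l ` I))"
    proof
      fix x assume "x \<in> \<Union>(\<Union>(kept_crossings G I l))"
      then obtain v where v: "v \<in> I" "l v = {}" "x \<in> halves_at G {v}" using C by blast
      have "x \<notin> \<Union>(\<Union>(l ` I))"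
      proof
        assume "x \<in> \<Union>(\<Union>(l ` I))"
        then obtain w where w: "w \<in> I" "x \<in> \<Union>(l w)" "x \<in> halves_at G {w}" using L by blast
        then have "w = v" using uniq v(3) by blast
        then show False using w(2) v(2) by simp
      qed
      moreover have "x \<in> \<Union>E" using at[OF v(1,3)] IE by blast
      ultimately show "x \<in> \<Union>E - \<Union>(\<Union>(l ` I))" by (rule_tac DiffI)
    qed
  qed
  show "\<Union>E - halves_at G I \<subseteq> free E (\<Union>(l ` I)) (kept_crossings G I l)"
  proof
    fix x assume x: "x \<in> \<Union>E - halves_at G I"
    have "x \<notin> \<Union>(\<Union>(l ` I))"
    proof
      assume "x \<in> \<Union>(\<Union>(l ` I))"
      from L[OF this] show False using at x by auto
    qed
    moreover have "x \<notin> \<Union>(\<Union>(kept_crossings G I l))"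
    proof
      assume "x \<in> \<Union>(\<Union>(kept_crossings G I l))"
      from C[OF this] show False using at x by auto
    qed
    ultimately show "x \<in> free E (\<Union>(l ` I)) (kept_crossings G I l)"
      using x unfolding free_def by (intro DiffI) simp_all
  qed
qed

lemma node_states_links:
  assumes "c \<in> node_states odd_at G v"
  shows "\<Union>c \<subseteq> halves_at G {v}" and "e \<in> c \<Longrightarrow> \<exists>a b. e = {a, b}"
proof -
  have c: "c \<in> smoothings G v \<or> c = {}"
    using assms by (simp add: node_states_def split: if_splits)
  show "\<Union>c \<subseteq> halves_at G {v}" using c
  proof
    assume "c \<in> smoothings G v"
    then show ?thesis using smoothings_Union by simp
  qed simp
  show "\<exists>a b. e = {a, b}" if e: "e \<in> c"
    using c
  proof
    assume "c \<in> smoothings G v"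
    then obtain s where "c = links (halves_at G {v}) s" by (rule smoothingsE)
    then obtain d where "e = {d, s d}" using e by (auto simp: links_def)
    then show ?thesis by (intro exI)
  qed (use e in simp)
qed

lemma exterior_states:
  assumes G: "framed_4_graph G" and I: "I \<subseteq> verts G" and l: "l \<in> PiE I (node_states odd_at G)"
    and E: "E \<subseteq> edges G" and IE: "halves_at G I \<subseteq> \<Union>E"
  shows "diagram E (\<Union>(l ` I)) (kept_crossings G I l)"
    and "\<Union>E - halves_at G I \<subseteq> free E (\<Union>(l ` I)) (kept_crossings G I l)"
proof -
  have *: "\<And>v. v \<in> I \<Longrightarrow> l v \<in> node_states odd_at G v" using l by (rule PiE_mem)
  show "diagram E (\<Union>(l ` I)) (kept_crossings G I l)"
    by (rule exterior_diagram(1)[OF G I node_states_links(1)[OF *] node_states_links(2)[OF *] E IE])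
  show "\<Union>E - halves_at G I \<subseteq> free E (\<Union>(l ` I)) (kept_crossings G I l)"
    by (rule exterior_diagram(2)[OF G I node_states_links(1)[OF *] node_states_links(2)[OF *] E IE])
qed

lemma smoothings_cong:
  "halves_at H {v} = halves_at G {v} \<Longrightarrow> opp H = opp G \<Longrightarrow> smoothings H v = smoothings G v"
  by (simp add: smoothings_def)

text \<open>The count after a decreasing move, written as a sum over the states of \<open>G\<close>
  away from \<open>T\<close>. It can then be compared with the count of \<open>G\<close> for each
  exterior state separately.\<close>

lemma state_count_splice:
  assumes G: "framed_4_graph G" and K: "framed_4_graph K" and T: "T \<subseteq> verts G"
    and od: "\<And>v. v \<in> verts G - T \<Longrightarrow> odd_at (splice T (opp G) G) v = odd_at G v"
  shows "state_count K odd_at (splice T (opp G) G) =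
    (\<Sum>l\<in>PiE (verts G - T) (node_states odd_at G).
      of_bool (resolves K G (\<lambda>v. if v \<in> T then crossing G v else l v)))"
proof -
  interpret splicing G T "opp G" by (rule splicing_opp) fact+
  have "node_states odd_at H v = node_states odd_at G v" if "v \<in> verts G - T" for v
    using that od smoothings_cong[OF halves_at_H opp_H, of v] by (simp add: node_states_def)
  then have "states odd_at H = PiE (verts G - T) (node_states odd_at G)"
    unfolding states_def verts_H by (rule PiE_cong)
  moreover have "resolves K H l \<longleftrightarrow> resolves K G (\<lambda>v. if v \<in> T then crossing G v else l v)"
    if "l \<in> PiE (verts G - T) (node_states odd_at G)" for l
    by (rule resolves_splice[OF G T K]) (use PiE_mem[OF that] node_states_links(1) in blast)
  ultimately show ?thesis unfolding state_count_def by simp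
qed

lemma pair_sum_alt:
  "(\<Sum>c\<in>choices b x p y q. \<Sum>d\<in>choices b x' r y' s.
      of_bool (realizes K E (d \<union> (c \<union> L)) (kept d {{x', r}, {y', s}} \<union> (kept c {{x, p}, {y, q}} \<union> C)) n)) =
    pair_sum K b E L C n x p y q x' r y' s"
  unfolding pair_sum_def by (simp only: Un_left_commute)

context irreducible_knot
begin

text \<open>Here the counts agree exactly, not only modulo 2, since one smoothing of the even vertex
  contributes nothing and the other equals the straight passage.\<close>

lemma state_count_move1:
  assumes G: "framed_4_graph G" and mv: "move1 v G H"
    and ev: "\<not> odd_at G v" and od: "\<And>x. x \<in> verts G - {v} \<Longrightarrow> odd_at H x = odd_at G x"
  shows "state_count K odd_at G = state_count K odd_at H"
proof -
  let ?I = "verts G - {v}"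
  obtain x where x: "x \<in> halves G" "vertex G x = v" "vertex G (mate G x) = v" "mate G x \<noteq> opp G x"
    and H: "H = splice {v} (opp G) G"
    using mv unfolding move1_def by blast
  define y where "y = mate G x"
  define p where "p = opp G x"
  define q where "q = opp G y"
  have v: "v \<in> verts G" using framed_vertex[OF G x(1)] x(2) by simp
  have y: "y \<in> halves G" "y \<noteq> x" using framed_mate[OF G] x(1) by (simp_all add: pairing_on_def y_def)
  have A: "x \<in> halves_at G {v}" "y \<in> halves_at G {v}" "y \<noteq> opp G x"
    using x y by (simp_all add: halves_at_def y_def)
  note four = four_halves[OF G v A(1,2) y(2) A(3), folded p_def q_def]
  have dist: "distinct [x, y, p, q]" using four(1) by auto
  \<comment> \<open>The loop edge is set aside; its ends are resolved locally, while
    \<open>E\<close> is left to the exterior.\<close>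
  define E where "E = edges G - {{x, y}}"
  have xyE: "{x, y} \<in> edges G" using edges_iff[OF G] x by (simp add: y_def)
  then have EG: "edges G = insert {x, y} E" by (auto simp: E_def)
  have UE: "\<Union>E = halves G - {x, y}"
    unfolding E_def using matching_remove_Union[OF matching_edges[OF G] xyE] Union_edges[OF G] by simp
  have m: "matching E" by (rule matching_subset[OF matching_edges[OF G]]) (simp add: E_def)
  have pqG: "p \<in> halves G" "q \<in> halves G" "vertex G p = v" "vertex G q = v"
    using four(2) by (auto simp: halves_at_def)
  have pqE: "p \<in> \<Union>E - halves_at G ?I" "q \<in> \<Union>E - halves_at G ?I"
    using dist pqG unfolding UE by (auto simp: halves_at_def)
  have xy: "x \<notin> \<Union>E" "y \<notin> \<Union>E" unfolding UE by simp_all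
  have IE: "halves_at G ?I \<subseteq> \<Union>E"
    unfolding UE using x(2,3) by (auto simp: halves_at_def y_def)
  have V: "verts G = insert v ?I" using v by auto
  have val: "resolves K G (l(v := c)) \<longleftrightarrow>
      realizes K (insert {x, y} E) (c \<union> \<Union>(l ` ?I)) (kept c (crossing G v) \<union> kept_crossings G ?I l) (circles G)"
    for l c
    unfolding resolves_alt EG
    by (subst (1 2) V) (simp only: Union_update kept_crossings_update Diff_iff singletonI simp_thms not_False_eq_True)
  have ns: "node_states odd_at G v = choices False x p y q"
    using node_states_choices[OF G v A(1,2) y(2) A(3), folded p_def q_def] ev by simp
  have "state_count K odd_at G =
      (\<Sum>l\<in>PiE (insert v ?I) (node_states odd_at G). of_bool (resolves K G l))"
    unfolding state_count_def states_def V[symmetric] ..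
  also have "\<dots> = (\<Sum>l\<in>PiE ?I (node_states odd_at G). \<Sum>c\<in>choices False x p y q. of_bool (resolves K G (l(v := c))))"
    unfolding ns[symmetric] by (rule sum_PiE_insert) simp
  also have "\<dots> = (\<Sum>l\<in>PiE ?I (node_states odd_at G).
      of_bool (resolves K G (\<lambda>w. if w \<in> {v} then crossing G w else l w)))"
  proof (rule sum.cong[OF refl])
    fix l assume l: "l \<in> PiE ?I (node_states odd_at G)"
    let ?L = "\<Union>(l ` ?I)" and ?C = "kept_crossings G ?I l"
    have d: "diagram E ?L ?C" and f: "\<Union>E - halves_at G ?I \<subseteq> free E ?L ?C"
      by (rule exterior_states[OF G _ l _ IE]; simp add: E_def)+
    note loop = realizes_loop[OF d m subsetD[OF f pqE(1)] subsetD[OF f pqE(2)] xy dist, of "circles G"]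
    have "(\<Sum>c\<in>choices False x p y q. of_bool (resolves K G (l(v := c)))) =
      (\<Sum>c\<in>choices False x p y q. of_bool (realizes K (insert {x, y} E) (c \<union> ?L) ?C (circles G)) :: nat)"
    proof (rule sum.cong[OF refl])
      fix c assume "c \<in> choices False x p y q"
      \<comment> \<open>The vertex is even, so its state is never the empty one.\<close>
      then have "kept c (crossing G v) = {}" by (cases rule: choices_cases) (simp_all add: kept_def)
      then show "(of_bool (resolves K G (l(v := c))) :: nat) =
          of_bool (realizes K (insert {x, y} E) (c \<union> ?L) ?C (circles G))"
        unfolding val by simp
    qed
    also have "\<dots> = of_bool (realizes K E (insert {p, q} ?L) ?C (circles G))" by (rule loop(1))
    also have "\<dots> = of_bool (resolves K G (l(v := crossing G v)))"
      unfolding val using loop(2) four(3) by (simp add: kept_def)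
    also have "l(v := crossing G v) = (\<lambda>w. if w \<in> {v} then crossing G w else l w)"
      by (simp add: fun_eq_iff)
    finally show "(\<Sum>c\<in>choices False x p y q. of_bool (resolves K G (l(v := c)))) =
      (of_bool (resolves K G (\<lambda>w. if w \<in> {v} then crossing G w else l w)) :: nat)" .
  qed
  also have "\<dots> = state_count K odd_at H"
    unfolding H by (rule state_count_splice[symmetric, OF G framed]) (use v od H in auto)
  finally show ?thesis .
qed

text \<open>Only the parity is preserved: for each exterior state the bigon sum may exceed the
  contribution of the straight passage by cancelling pairs.\<close>

lemma state_count_move2:
  assumes G: "framed_4_graph G" and mv: "move2 u v G H"
    and uv: "odd_at G u = odd_at G v" and od: "\<And>x. x \<in> verts G - {u, v} \<Longrightarrow> odd_at H x = odd_at G x"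
  shows "even (state_count K odd_at G) \<longleftrightarrow> even (state_count K odd_at H)"
proof -
  let ?I = "verts G - {u, v}"
  have H: "H = splice {u, v} (opp G) G" and ne: "u \<noteq> v"
    using mv by (simp_all add: move2_def bigon_def)
  obtain x y where x: "x \<in> halves G" "vertex G x = u" "vertex G (mate G x) = v"
    and y: "y \<in> halves G" "vertex G y = u" "vertex G (mate G y) = v"
    and xy: "x \<noteq> y" "y \<noteq> opp G x" "mate G y \<noteq> opp G (mate G x)"
    using mv unfolding move2_def bigon_def by blast
  define x' where "x' = mate G x"
  define y' where "y' = mate G y"
  define p where "p = opp G x"
  define q where "q = opp G y"
  define r where "r = opp G x'"
  define s where "s = opp G y'"
  have mt: "\<And>d. d \<in> halves G \<Longrightarrow> mate G d \<in> halves G \<and> mate G (mate G d) = d"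
    using framed_mate[OF G] by (simp add: pairing_on_def)
  have u: "u \<in> verts G" and v: "v \<in> verts G"
    using framed_vertex[OF G] x mt by auto
  have x'y': "x' \<noteq> y'" using mt x(1) y(1) xy(1) unfolding x'_def y'_def by metis
  have A: "x \<in> halves_at G {u}" "y \<in> halves_at G {u}" "y \<noteq> x" "y \<noteq> opp G x"
    and B: "x' \<in> halves_at G {v}" "y' \<in> halves_at G {v}" "y' \<noteq> x'" "y' \<noteq> opp G x'"
    using x y xy x'y' mt by (simp_all add: halves_at_def x'_def y'_def)
  note fu = four_halves[OF G u A, folded p_def q_def]
  note fv = four_halves[OF G v B, folded r_def s_def]
  have pqG: "{x, p, y, q} \<subseteq> halves G" "vertex G ` {x, p, y, q} \<subseteq> {u}"
    and rsG: "{x', r, y', s} \<subseteq> halves G" "vertex G ` {x', r, y', s} \<subseteq> {v}"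
    using fu(2) fv(2) by (auto simp: halves_at_def)
  have "{x, p, y, q} \<inter> {x', r, y', s} = {}" using pqG(2) rsG(2) ne by auto
  then have dist: "distinct [x, y, x', y', p, q, r, s]" using fu(1) fv(1) by auto
  define E where "E = edges G - {{x, x'}} - {{y, y'}}"
  have e1: "{x, x'} \<in> edges G" and e2: "{y, y'} \<in> edges G"
    using edges_iff[OF G] x y by (simp_all add: x'_def y'_def)
  then have EG: "edges G = insert {x, x'} (insert {y, y'} E)" by (auto simp: E_def)
  have m1: "matching (edges G - {{x, x'}})" by (rule matching_subset[OF matching_edges[OF G]]) auto
  have m: "matching E" by (rule matching_subset[OF m1]) (auto simp: E_def)
  have "{y, y'} \<in> edges G - {{x, x'}}" using e2 dist by (auto simp: doubleton_eq_iff)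
  from matching_remove_Union[OF m1 this] matching_remove_Union[OF matching_edges[OF G] e1]
  have UE: "\<Union>E = halves G - {x, x'} - {y, y'}" unfolding E_def Union_edges[OF G] by simp
  have fr: "{p, q, r, s} \<subseteq> \<Union>E - halves_at G ?I"
    using dist pqG rsG unfolding UE by (auto simp: halves_at_def)
  have nE: "x \<notin> \<Union>E" "y \<notin> \<Union>E" "x' \<notin> \<Union>E" "y' \<notin> \<Union>E" unfolding UE by simp_all
  have IE: "halves_at G ?I \<subseteq> \<Union>E"
    unfolding UE using pqG rsG by (auto simp: halves_at_def)
  have V: "verts G = insert v (insert u ?I)" using u v by auto
  have val: "resolves K G (l(u := c, v := d)) \<longleftrightarrow>
      realizes K (insert {x, x'} (insert {y, y'} E)) (d \<union> (c \<union> \<Union>(l ` ?I)))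
        (kept d {{x', r}, {y', s}} \<union> (kept c {{x, p}, {y, q}} \<union> kept_crossings G ?I l)) (circles G)"
    for l c d
  proof -
    have n: "v \<notin> insert u ?I" "u \<notin> ?I" using ne by auto
    show ?thesis
      unfolding resolves_alt EG fu(3)[symmetric] fv(3)[symmetric]
      by (subst (1 2) V) (simp only: Union_update[OF n(1)] kept_crossings_update[OF n(1)]
          Union_update[OF n(2)] kept_crossings_update[OF n(2)])
  qed
  let ?b = "odd_at G v"
  have nu: "node_states odd_at G u = choices ?b x p y q"
    using node_states_choices[OF G u A, folded p_def q_def] uv by simp
  have nv: "node_states odd_at G v = choices ?b x' r y' s"
    using node_states_choices[OF G v B, folded r_def s_def] by simp
  have "state_count K odd_at G =
      (\<Sum>l\<in>PiE (insert v (insert u ?I)) (node_states odd_at G). of_bool (resolves K G l))"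
    unfolding state_count_def states_def V[symmetric] ..
  also have "\<dots> = (\<Sum>l\<in>PiE (insert u ?I) (node_states odd_at G).
      \<Sum>d\<in>node_states odd_at G v. of_bool (resolves K G (l(v := d))))"
    by (rule sum_PiE_insert) (use ne in simp)
  also have "\<dots> = (\<Sum>l\<in>PiE ?I (node_states odd_at G). \<Sum>c\<in>node_states odd_at G u.
      \<Sum>d\<in>node_states odd_at G v. of_bool (resolves K G (l(u := c, v := d))))"
    by (rule sum_PiE_insert) simp
  also have "even \<dots> \<longleftrightarrow> even (\<Sum>l\<in>PiE ?I (node_states odd_at G).
      (of_bool (resolves K G (\<lambda>w. if w \<in> {u, v} then crossing G w else l w)) :: nat))"
  proof (rule even_sum_cong)
    fix l assume l: "l \<in> PiE ?I (node_states odd_at G)"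
    let ?L = "\<Union>(l ` ?I)" and ?C = "kept_crossings G ?I l"
    have d: "diagram E ?L ?C" and f: "\<Union>E - halves_at G ?I \<subseteq> free E ?L ?C"
      by (rule exterior_states[OF G _ l _ IE]; auto simp: E_def)+
    note bigon = realizes_bigon[OF d m subset_trans[OF fr f] nE dist]
    \<comment> \<open>The smaller diagram is the exterior state with both bigon vertices passed
      straight through.\<close>
    have "l(u := crossing G u, v := crossing G v) = (\<lambda>w. if w \<in> {u, v} then crossing G w else l w)"
      by (simp add: fun_eq_iff)
    then have "resolves K G (\<lambda>w. if w \<in> {u, v} then crossing G w else l w) \<longleftrightarrow>
      resolves K G (l(u := crossing G u, v := crossing G v))" by simp
    also have "\<dots> \<longleftrightarrow> realizes K E (insert {p, r} (insert {q, s} ?L)) ?C (circles G)"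
      unfolding val bigon(2)[symmetric] unfolding fu(3) fv(3) kept_def
      by (simp add: insert_commute)
    finally show "even (\<Sum>c\<in>node_states odd_at G u. \<Sum>d\<in>node_states odd_at G v.
          (of_bool (resolves K G (l(u := c, v := d))) :: nat)) \<longleftrightarrow>
        even (of_bool (resolves K G (\<lambda>w. if w \<in> {u, v} then crossing G w else l w)) :: nat)"
      unfolding val nu nv pair_sum_alt bigon(1) by simp
  qed
  also have "\<dots> \<longleftrightarrow> even (state_count K odd_at H)"
    unfolding H by (subst state_count_splice[OF G framed]) (use u v od H in auto)
  finally show ?thesis .
qed

end

section \<open>Third move and the theorem\<close>

lemma finite_states:
  assumes G: "framed_4_graph G"
  shows "finite (states odd_at G)"
  unfolding states_def
proof (rule finite_PiE[OF framed_finite(1)[OF G]])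
  fix v assume v: "v \<in> verts G"
  obtain x y where "x \<in> halves_at G {v}" "y \<in> halves_at G {v}" "y \<noteq> x" "y \<noteq> opp G x"
    by (rule exists_halves[OF G v])
  then show "finite (node_states odd_at G v)"
    by (simp add: node_states_choices[OF G v] choices_def)
qed

lemma state_count_card:
  assumes "framed_4_graph G"
  shows "state_count K odd_at G = card {l \<in> states odd_at G. resolves K G l}"
  unfolding state_count_def using finite_states[OF assms]
  by (simp add: of_bool_def sum.If_cases Int_def)

text \<open>An isomorphism carries resolving states injectively to resolving states; applied to its
  inverse as well, this gives equality.\<close>

lemma state_count_iso_le:
  assumes G: "framed_4_graph G" and H: "framed_4_graph H" and i: "graph_iso f g G H"
    and od: "\<And>v. v \<in> verts G \<Longrightarrow> odd_at H (f v) = odd_at G v"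
  shows "state_count K odd_at G \<le> state_count K odd_at H"
proof -
  have f: "bij_betw f (verts G) (verts H)" and g: "inj_on g (halves G)"
    using i by (auto simp: graph_iso_def bij_betw_def)
  have go: "opp H (g d) = g (opp G d)" if "d \<in> halves G" for d
    using i that by (simp add: graph_iso_def)
  \<comment> \<open>The restriction makes the transported state extensional.\<close>
  define F where "F = (\<lambda>l. restrict (\<lambda>x. image g ` l (inv_into (verts G) f x)) (verts H))"
  have F: "F l (f v) = image g ` l v" if "v \<in> verts G" for l v
    using f that by (simp add: F_def bij_betw_inv_into_left[OF f] bij_betwE[OF f])
  have ns: "node_states odd_at H (f v) = image (image g) ` node_states odd_at G v \<and>
      inj_on (image (image g)) (node_states odd_at G v)" if v: "v \<in> verts G" for v
  proof -
    obtain x y where xy: "x \<in> halves_at G {v}" "y \<in> halves_at G {v}" "y \<noteq> x" "y \<noteq> opp G x"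
      by (rule exists_halves[OF G v])
    have A: "halves_at G {v} = {x, opp G x, y, opp G y}" by (rule four_halves(2)[OF G v xy])
    have sub: "{x, opp G x, y, opp G y} \<subseteq> halves G" unfolding A[symmetric] by (auto simp: halves_at_def)
    have fv: "f v \<in> verts H" using bij_betwE[OF f] v by simp
    have gxy: "g x \<in> halves_at H {f v}" "g y \<in> halves_at H {f v}"
      unfolding halves_at_iso[OF G i v] using xy by simp_all
    have "g y \<noteq> g x" "g y \<noteq> g (opp G x)"
      using inj_on_eq_iff[OF g] sub xy(3,4) by simp_all
    then have gne: "g y \<noteq> g x" "g y \<noteq> opp H (g x)" using go sub by simp_all
    have "node_states odd_at H (f v) = choices (odd_at G v) (g x) (g (opp G x)) (g y) (g (opp G y))"
      using node_states_choices[OF H fv gxy gne] go sub od[OF v] by simp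
    then show ?thesis
      unfolding node_states_choices[OF G v xy] choices_image
      using inj_choices[OF inj_on_subset[OF g sub]] by simp
  qed
  show ?thesis
    unfolding state_count_card[OF G] state_count_card[OF H]
  proof (rule card_inj_on_le[where f = F])
    show "inj_on F {l \<in> states odd_at G. resolves K G l}"
    proof (rule inj_onI)
      fix l l' assume l: "l \<in> {l \<in> states odd_at G. resolves K G l}"
        "l' \<in> {l \<in> states odd_at G. resolves K G l}" and eq: "F l = F l'"
      have lP: "l \<in> PiE (verts G) (node_states odd_at G)" "l' \<in> PiE (verts G) (node_states odd_at G)"
        using l by (simp_all add: states_def)
      have "l v = l' v" if v: "v \<in> verts G" for v
      proof -
        have "image g ` l v = image g ` l' v" using eq F[OF v] by metis
        moreover have "l v \<in> node_states odd_at G v" "l' v \<in> node_states odd_at G v"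
          using PiE_mem[OF lP(1) v] PiE_mem[OF lP(2) v] .
        ultimately show ?thesis by (rule inj_onD[OF conjunct2[OF ns[OF v]]])
      qed
      then show "l = l'" by (rule PiE_ext[OF lP])
    qed
    show "F ` {l \<in> states odd_at G. resolves K G l} \<subseteq> {l \<in> states odd_at H. resolves K H l}"
    proof clarify
      fix l assume l: "l \<in> states odd_at G" "resolves K G l"
      have lv: "l v \<in> node_states odd_at G v" if "v \<in> verts G" for v
        using l(1) that unfolding states_def by (rule PiE_mem)
      have "F l \<in> states odd_at H"
        unfolding states_def
      proof (rule PiE_I)
        fix w assume "w \<in> verts H"
        then obtain v where v: "v \<in> verts G" "w = f v" using f by (auto simp: bij_betw_def)
        show "F l w \<in> node_states odd_at H w"
          using ns[OF v(1)] lv[OF v(1)] F[OF v(1)] v(2) by simp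
      qed (simp add: F_def)
      moreover have "resolves K G l \<longleftrightarrow> resolves K H (F l)"
        by (rule resolves_iso[OF G i]) (use node_states_links(1)[OF lv] F in auto)
      ultimately show "F l \<in> states odd_at H \<and> resolves K H (F l)" using l(2) by simp
    qed
    show "finite {l \<in> states odd_at H. resolves K H l}" using finite_states[OF H] by simp
  qed
qed

lemma state_count_iso:
  assumes G: "framed_4_graph G" and H: "framed_4_graph H" and i: "graph_iso f g G H"
    and od: "\<And>v. v \<in> verts G \<Longrightarrow> odd_at H (f v) = odd_at G v"
  shows "state_count K odd_at G = state_count K odd_at H"
proof (rule antisym)
  have f: "bij_betw f (verts G) (verts H)" using i by (simp add: graph_iso_def)
  show "state_count K odd_at H \<le> state_count K odd_at G"
  proof (rule state_count_iso_le[OF H G graph_iso_sym[OF G i]])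
    fix w assume w: "w \<in> verts H"
    then have "inv_into (verts G) f w \<in> verts G" "f (inv_into (verts G) f w) = w"
      using f by (simp_all add: bij_betw_inv_into_right bij_betwE[OF bij_betw_inv_into])
    then show "odd_at G (inv_into (verts G) f w) = odd_at H w" using od by metis
  qed
  show "state_count K odd_at G \<le> state_count K odd_at H"
    by (rule state_count_iso_le[OF G H i]) (rule od)
qed

section \<open>Triangles and the third move\<close>

lemma sum_choices_image:
  fixes g :: "nat set set \<Rightarrow> nat"
  assumes "inj h"
  shows "(\<Sum>c\<in>choices b x p y q. g (image h ` c)) = (\<Sum>c\<in>choices b (h x) (h p) (h y) (h q). g c)"
  unfolding choices_image
  by (subst sum.reindex[OF inj_choices[OF inj_on_subset[OF assms subset_UNIV]]]) simp

lemma kept_image: "image (image h) ` kept c X = kept (image h ` c) (image h ` X)"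
  by (simp add: kept_def)

text \<open>The first vertex is even and hence never kept, so the nested sum is a sum of
  two-crossing sums over its two smoothings.\<close>

lemma triangle_sum_alt:
  "(\<Sum>c\<in>choices False a q1 c' q6. \<Sum>e\<in>choices \<beta> c0 q5 b' q4. \<Sum>d\<in>choices \<beta> a' q2 b q3.
      of_bool (realizes K E (d \<union> (e \<union> (c \<union> L)))
        (kept d {{a', q2}, {b, q3}} \<union> (kept e {{c0, q5}, {b', q4}} \<union> (kept c {{a, q1}, {c', q6}} \<union> C))) n)) =
    (\<Sum>c\<in>choices False a q1 c' q6. pair_sum K \<beta> E (c \<union> L) C n a' q2 b q3 c0 q5 b' q4)"
proof (rule sum.cong[OF refl])
  fix c assume "c \<in> choices False a q1 c' q6"
  then have k: "kept c {{a, q1}, {c', q6}} = {}"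
    by (cases rule: choices_cases) (simp_all add: kept_def)
  show "(\<Sum>e\<in>choices \<beta> c0 q5 b' q4. \<Sum>d\<in>choices \<beta> a' q2 b q3.
      of_bool (realizes K E (d \<union> (e \<union> (c \<union> L)))
        (kept d {{a', q2}, {b, q3}} \<union> (kept e {{c0, q5}, {b', q4}} \<union> (kept c {{a, q1}, {c', q6}} \<union> C))) n)) =
    pair_sum K \<beta> E (c \<union> L) C n a' q2 b q3 c0 q5 b' q4"
    unfolding k Un_empty_left pair_sum_alt by (rule pair_sum_swap)
qed

text \<open>Primes denote the far ends of the triangle edges. The strands through \<open>a\<close>,
  \<open>b\<close>, \<open>c\<close> leave the triangle at \<open>p1\<close>, \<open>p2\<close>, at
  \<open>p3\<close>, \<open>p4\<close> and at \<open>p5\<close>, \<open>p6\<close>.\<close>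

locale triangle_move =
  fixes G u v w a b c
  assumes G: "framed_4_graph G" and tri: "triangle G u v w a b c"
begin

definition "a' = mate G a"
definition "b' = mate G b"
definition "c' = mate G c"
definition "p1 = opp G a"
definition "p2 = opp G a'"
definition "p3 = opp G b"
definition "p4 = opp G b'"
definition "p5 = opp G c"
definition "p6 = opp G c'"

definition "swap = outer_swap G a b c"
definition "H = G\<lparr>mate := swap \<circ> mate G \<circ> swap\<rparr>"
definition "I = verts G - {u, v, w}"
definition "E = edges G - {{a, a'}} - {{c', c}} - {{b, b'}}"

abbreviation "E3 \<equiv> insert {a, a'} (insert {c', c} (insert {b, b'} E))"

lemma mates: "d \<in> halves G \<Longrightarrow> mate G d \<in> halves G" "d \<in> halves G \<Longrightarrow> mate G (mate G d) = d"
  using framed_mate[OF G] by (simp_all add: pairing_on_def)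

lemma abc:
  "u \<noteq> v" "v \<noteq> w" "w \<noteq> u" "a \<in> halves G" "b \<in> halves G" "c \<in> halves G"
  "a' \<in> halves G" "b' \<in> halves G" "c' \<in> halves G"
  "vertex G a = u" "vertex G a' = v" "vertex G b = v" "vertex G b' = w" "vertex G c = w" "vertex G c' = u"
  "a \<noteq> opp G c'" "b \<noteq> opp G a'" "c \<noteq> opp G b'"
  using tri mates by (simp_all add: triangle_def a'_def b'_def c'_def)

lemma verts: "u \<in> verts G" "v \<in> verts G" "w \<in> verts G"
  using framed_vertex[OF G] abc by metis+

lemma neq: "c' \<noteq> a" "b \<noteq> a'" "b' \<noteq> c"
  using abc mates(2) unfolding a'_def b'_def c'_def by metis+

lemma oppopp: "x \<in> verts G \<Longrightarrow> d \<in> halves_at G {x} \<Longrightarrow> opp G (opp G d) = d"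
  using framed_opp[OF G] by (simp add: pairing_on_def)

lemma at_u: "a \<in> halves_at G {u}" "c' \<in> halves_at G {u}" "c' \<noteq> a" "c' \<noteq> opp G a"
proof -
  show 1: "a \<in> halves_at G {u}" "c' \<in> halves_at G {u}" using abc by (simp_all add: halves_at_def)
  show "c' \<noteq> a" by (rule neq)
  show "c' \<noteq> opp G a" using oppopp[OF verts(1) 1(1)] abc(16) by metis
qed

lemma at_v: "a' \<in> halves_at G {v}" "b \<in> halves_at G {v}" "b \<noteq> a'" "b \<noteq> opp G a'"
  using abc neq by (simp_all add: halves_at_def)

lemma at_w: "c \<in> halves_at G {w}" "b' \<in> halves_at G {w}" "b' \<noteq> c" "b' \<noteq> opp G c"
proof -
  show 1: "c \<in> halves_at G {w}" "b' \<in> halves_at G {w}" using abc by (simp_all add: halves_at_def)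
  show "b' \<noteq> c" by (rule neq)
  show "b' \<noteq> opp G c" using oppopp[OF verts(3) 1(1)] abc(18) by metis
qed

lemmas four_u = four_halves[OF G verts(1) at_u, folded p1_def p6_def]
lemmas four_v = four_halves[OF G verts(2) at_v, folded p2_def p3_def]
lemmas four_w = four_halves[OF G verts(3) at_w, folded p5_def p4_def]

lemma halves:
  "{a, p1, c', p6} \<subseteq> halves G" "vertex G ` {a, p1, c', p6} \<subseteq> {u}"
  "{a', p2, b, p3} \<subseteq> halves G" "vertex G ` {a', p2, b, p3} \<subseteq> {v}"
  "{c, p5, b', p4} \<subseteq> halves G" "vertex G ` {c, p5, b', p4} \<subseteq> {w}"
  unfolding four_u(2)[symmetric] four_v(2)[symmetric] four_w(2)[symmetric]
  by (auto simp: halves_at_def)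

lemma dist: "distinct [a, a', b, b', c, c', p1, p2, p3, p4, p5, p6]"
proof -
  have "{a, p1, c', p6} \<inter> {a', p2, b, p3} = {}" "{a, p1, c', p6} \<inter> {c, p5, b', p4} = {}"
    "{a', p2, b, p3} \<inter> {c, p5, b', p4} = {}"
    using halves(2,4,6) abc(1-3) by auto
  then show ?thesis using four_u(1) four_v(1) four_w(1) by auto
qed

lemmas dd = dist distinct_rev[THEN iffD2, OF dist]

lemma swap_def': "swap = transpose p1 p2 \<circ> transpose p3 p4 \<circ> transpose p5 p6"
  by (simp add: swap_def outer_swap_def p1_def p2_def p3_def p4_def p5_def p6_def a'_def b'_def c'_def)

lemma swap_simps:
  "swap p1 = p2" "swap p2 = p1" "swap p3 = p4" "swap p4 = p3" "swap p5 = p6" "swap p6 = p5"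
  "swap a = a" "swap a' = a'" "swap b = b" "swap b' = b'" "swap c = c" "swap c' = c'"
  using dd by (simp_all add: swap_def' transpose_def)

lemma swap_other: "z \<notin> {p1, p2, p3, p4, p5, p6} \<Longrightarrow> swap z = z"
  by (simp add: swap_def' transpose_def)

lemma swap_swap: "swap (swap z) = z"
proof (cases "z \<in> {p1, p2, p3, p4, p5, p6}")
  case True
  then show ?thesis using swap_simps by auto
qed (simp add: swap_other)

lemma inj_swap: "inj swap"
  by (rule inj_on_inverseI) (rule swap_swap)

lemma swap_halves: "swap z \<in> halves G \<longleftrightarrow> z \<in> halves G"
proof (cases "z \<in> {p1, p2, p3, p4, p5, p6}")
  case True
  then show ?thesis using swap_simps halves by auto
qed (simp add: swap_other)

lemma image_swap_swap: "image swap ` image swap ` X = X"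
  by (simp add: image_image swap_swap)

lemma H_simps: "verts H = verts G" "halves H = halves G" "vertex H = vertex G" "opp H = opp G"
    "circles H = circles G"
  by (simp_all add: H_def)

lemma crossing_H: "crossing H = crossing G"
  by (rule ext) (simp add: crossing_def halves_at_def H_simps)

text \<open>Since \<open>swap\<close> is an involution, conjugating \<open>mate\<close> by it
  amounts to renaming the ends of all edges.\<close>

lemma edges_H: "edges H = image swap ` edges G"
proof -
  have "halves G = swap ` halves G"
    using swap_halves swap_swap by (auto simp: image_iff) metis
  then have "edges H = (\<lambda>d. {d, mate H d}) ` swap ` halves G"
    unfolding edges_def links_def H_simps by simp
  also have "\<dots> = image swap ` edges G"
    unfolding edges_def links_def image_image by (simp add: H_def swap_swap)
  finally show ?thesis .
qed

lemma edges_E: "edges G = E3"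
proof -
  have "{a, a'} \<in> edges G" "{c', c} \<in> edges G" "{b, b'} \<in> edges G"
    using edges_iff[OF G] abc mates by (simp_all add: a'_def b'_def c'_def)
  then show ?thesis by (auto simp: E_def)
qed

lemma matching_E: "matching E"
  by (rule matching_subset[OF matching_edges[OF G]]) (auto simp: E_def)

lemma Union_E: "\<Union>E = halves G - {a, a', b, b', c, c'}"
proof -
  have m: "matching (edges G - {{a, a'}})" "matching (edges G - {{a, a'}} - {{c', c}})"
    by (rule matching_subset[OF matching_edges[OF G]], auto)+
  have "{a, a'} \<in> edges G" "{c', c} \<in> edges G - {{a, a'}}" "{b, b'} \<in> edges G - {{a, a'}} - {{c', c}}"
    using edges_iff[OF G] abc mates dist by (auto simp: a'_def b'_def c'_def doubleton_eq_iff)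
  from matching_remove_Union[OF matching_edges[OF G] this(1)] matching_remove_Union[OF m(1) this(2)]
    matching_remove_Union[OF m(2) this(3)]
  show ?thesis unfolding E_def Union_edges[OF G] by auto
qed

lemma not_E: "a \<notin> \<Union>E" "a' \<notin> \<Union>E" "b \<notin> \<Union>E" "b' \<notin> \<Union>E" "c \<notin> \<Union>E" "c' \<notin> \<Union>E"
  unfolding Union_E by simp_all

lemma outer: "{p1, p2, p3, p4, p5, p6} \<subseteq> \<Union>E - halves_at G I"
  using dd halves unfolding Union_E I_def by (auto simp: halves_at_def)

lemma inner: "halves_at G I \<subseteq> \<Union>E"
  using abc unfolding Union_E I_def by (auto simp: halves_at_def)

lemma verts_I: "verts G = insert v (insert w (insert u I))" "u \<notin> I" "w \<notin> insert u I" "v \<notin> insert w (insert u I)"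
  using verts abc(1-3) by (auto simp: I_def)

lemma I_sub: "I \<subseteq> verts G" and E_sub: "E \<subseteq> edges G"
  by (auto simp: I_def E_def)

lemma resolves_G:
  "resolves K G (l(u := x, w := z, v := y)) \<longleftrightarrow>
    realizes K E3 (y \<union> (z \<union> (x \<union> \<Union>(l ` I))))
      (kept y {{a', p2}, {b, p3}} \<union> (kept z {{c, p5}, {b', p4}} \<union>
        (kept x {{a, p1}, {c', p6}} \<union> kept_crossings G I l))) (circles G)"
  unfolding resolves_alt edges_E[symmetric] four_u(3)[symmetric] four_v(3)[symmetric] four_w(3)[symmetric]
  by (subst (1 2) verts_I(1)) (simp only: Union_update[OF verts_I(2)] kept_crossings_update[OF verts_I(2)]
      Union_update[OF verts_I(3)] kept_crossings_update[OF verts_I(3)]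
      Union_update[OF verts_I(4)] kept_crossings_update[OF verts_I(4)])

text \<open>Renaming by \<open>swap\<close> restores the edges of \<open>G\<close>. The effect of
  the move is shifted to the links and crossings at \<open>u\<close>, \<open>v\<close>,
  \<open>w\<close>, where the outer half-edges of each strand are interchanged, and both sides of
  the move have the same edges.\<close>

lemma resolves_H:
  assumes H: "framed_4_graph H" and l: "\<And>x. x \<in> I \<Longrightarrow> \<Union>(l x) \<subseteq> halves_at G {x}"
    and xyz: "\<Union>x \<subseteq> halves_at G {u}" "\<Union>z \<subseteq> halves_at G {w}" "\<Union>y \<subseteq> halves_at G {v}"
  shows "resolves K H (l(u := x, w := z, v := y)) \<longleftrightarrow>
    realizes K E3 (image swap ` y \<union> (image swap ` z \<union> (image swap ` x \<union> \<Union>(l ` I))))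
      (kept (image swap ` y) {{a', p1}, {b, p4}} \<union> (kept (image swap ` z) {{c, p6}, {b', p3}} \<union>
        (kept (image swap ` x) {{a, p2}, {c', p5}} \<union> kept_crossings G I l))) (circles G)"
proof -
  let ?l = "l(u := x, w := z, v := y)"
  have at: "halves_at H = halves_at G" by (intro ext) (simp add: halves_at_def H_simps)
  have l': "\<Union>(?l i) \<subseteq> halves_at H {i}" if "i \<in> verts H" for i
    using that l xyz abc(1-3) unfolding H_simps verts_I(1) at by auto
  note U = Union_kept_crossings[OF H l']
  have fin: "finite (\<Union>(edges H))" using framed_finite[OF H] by (simp add: Union_edges[OF H])
  \<comment> \<open>None of \<open>p1\<close> to \<open>p6\<close> belongs to a vertex of
    \<open>I\<close>, so the exterior is fixed by \<open>swap\<close>.\<close>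
  have ext: "\<And>e. e \<in> halves_at G I \<Longrightarrow> swap e = e" using outer by (intro swap_other) auto
  have L0: "image swap ` \<Union>(l ` I) = \<Union>(l ` I)"
  proof (rule image_id_on)
    fix d assume "d \<in> \<Union>(\<Union>(l ` I))"
    then obtain i where i: "i \<in> I" "d \<in> \<Union>(l i)" by auto
    then have "d \<in> halves_at G {i}" using l by blast
    then show "swap d = d" using i(1) by (intro ext) (simp add: halves_at_def)
  qed
  have C0: "image (image swap) ` kept_crossings G I l = kept_crossings G I l"
  proof (rule image_image_id)
    fix d assume "d \<in> \<Union>(\<Union>(kept_crossings G I l))"
    then obtain i where i: "i \<in> I" "d \<in> \<Union>(crossing G i)" by (auto simp: kept_crossings_def)
    then have "d \<in> halves_at G {i}" using Union_crossing[OF G, of i] I_sub by auto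
    then show "swap d = d" using i(1) by (intro ext) (simp add: halves_at_def)
  qed
  have "resolves K H ?l \<longleftrightarrow> realizes K (edges H) (\<Union>(?l ` verts H)) (crossing H ` {i \<in> verts H. ?l i = {}}) (circles H)"
    by (rule resolves_def)
  also have "\<dots> \<longleftrightarrow> realizes K (edges G) (image swap ` \<Union>(?l ` verts G))
      (image (image swap) ` kept_crossings G (verts G) ?l) (circles G)"
    using realizes_rename[OF fin U(2) U(1) inj_on_subset[OF inj_swap subset_UNIV], of K "circles G"]
    unfolding edges_H image_swap_swap kept_crossings_def crossing_H H_simps .
  also have "\<Union>(?l ` verts G) = y \<union> (z \<union> (x \<union> \<Union>(l ` I)))"
    by (subst verts_I(1)) (simp only: Union_update[OF verts_I(2)] Union_update[OF verts_I(3)]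
        Union_update[OF verts_I(4)])
  also have "kept_crossings G (verts G) ?l = kept y {{a', p2}, {b, p3}} \<union> (kept z {{c, p5}, {b', p4}} \<union>
        (kept x {{a, p1}, {c', p6}} \<union> kept_crossings G I l))"
    unfolding four_u(3)[symmetric] four_v(3)[symmetric] four_w(3)[symmetric]
    by (subst verts_I(1)) (simp only: kept_crossings_update[OF verts_I(2)]
        kept_crossings_update[OF verts_I(3)] kept_crossings_update[OF verts_I(4)])
  finally show ?thesis
    unfolding image_Un kept_image L0 C0 edges_E image_insert image_empty swap_simps .
qed


text \<open>Straight passage reduces both graphs to the same three outer pairs, since
  \<open>swap\<close> preserves each of them as a set.\<close>

lemma unicursal_components_H:
  assumes H: "framed_4_graph H"
  shows "unicursal_components H = unicursal_components G"
proof -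
  let ?l = "crossing G"
  let ?L = "\<Union>(?l ` I)" and ?C = "kept_crossings G I ?l"
  have UX: "\<Union>(?l x) \<subseteq> halves_at G {x}" if "x \<in> verts G" for x
    using Union_crossing[OF G that] by simp
  have dbl: "\<exists>y z. e = {y, z}" if "x \<in> verts G" "e \<in> ?l x" for x e
    using that(2) unfolding crossing_def links_def by auto
  have d: "diagram E ?L ?C" and f: "\<Union>E - halves_at G I \<subseteq> free E ?L ?C"
    by (rule exterior_diagram[OF G I_sub UX dbl E_sub inner]; use I_sub in blast)+
  have f1: "{p1, p2, p3, p4, p5, p6} \<subseteq> free E ?L ?C" by (rule subset_trans[OF outer f])
  then have f2: "{p2, p1, p4, p3, p6, p5} \<subseteq> free E ?L ?C" by simp
  have dist2: "distinct [a, a', b, b', c, c', p2, p1, p4, p3, p6, p5]" using dd by simp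
  have l: "?l(u := ?l u, w := ?l w, v := ?l v) = ?l" by simp
  have k: "kept {{s, t}, {q, r}} X = {}" for s t q r X by (simp add: kept_def)
  have G': "resolves (circle_graph n) G ?l \<longleftrightarrow>
      realizes (circle_graph n) E (insert {p1, p2} (insert {p3, p4} (insert {p5, p6} ?L))) ?C (circles G)" for n
  proof -
    have "resolves (circle_graph n) G ?l \<longleftrightarrow>
        realizes (circle_graph n) E3 ({{a', p2}, {b, p3}} \<union> ({{c, p5}, {b', p4}} \<union>
          ({{a, p1}, {c', p6}} \<union> ?L))) ?C (circles G)"
      using resolves_G[of "circle_graph n" ?l "?l u" "?l w" "?l v", unfolded l]
      unfolding four_u(3) four_v(3) four_w(3) k Un_empty_left .
    also have "{{a', p2}, {b, p3}} \<union> ({{c, p5}, {b', p4}} \<union> ({{a, p1}, {c', p6}} \<union> ?L)) =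
      insert {a, p1} (insert {c', p6} (insert {b, p3} (insert {a', p2} (insert {c, p5} (insert {b', p4} ?L)))))"
      by (simp only: Un_insert_left Un_empty_left insert_commute)
    finally show ?thesis using realizes_triangle_frame[OF d f1 not_E dist] by simp
  qed
  have H': "resolves (circle_graph n) H ?l \<longleftrightarrow>
      realizes (circle_graph n) E (insert {p1, p2} (insert {p3, p4} (insert {p5, p6} ?L))) ?C (circles G)" for n
  proof -
    have UI: "\<And>x. x \<in> I \<Longrightarrow> \<Union>(?l x) \<subseteq> halves_at G {x}" using UX I_sub by blast
    have i: "image swap ` ?l u = {{a, p2}, {c', p5}}" "image swap ` ?l v = {{a', p1}, {b, p4}}"
      "image swap ` ?l w = {{c, p6}, {b', p3}}"
      unfolding four_u(3) four_v(3) four_w(3) by (simp_all only: image_insert image_empty swap_simps)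
    have "resolves (circle_graph n) H ?l \<longleftrightarrow>
        realizes (circle_graph n) E3 ({{a', p1}, {b, p4}} \<union> ({{c, p6}, {b', p3}} \<union>
          ({{a, p2}, {c', p5}} \<union> ?L))) ?C (circles G)"
      using resolves_H[OF H UI UX[OF verts(1)] UX[OF verts(3)] UX[OF verts(2)], of "circle_graph n", unfolded l]
      unfolding i k Un_empty_left .
    also have "{{a', p1}, {b, p4}} \<union> ({{c, p6}, {b', p3}} \<union> ({{a, p2}, {c', p5}} \<union> ?L)) =
      insert {a, p2} (insert {c', p5} (insert {b, p4} (insert {a', p1} (insert {c, p6} (insert {b', p3} ?L)))))"
      by (simp only: Un_insert_left Un_empty_left insert_commute)
    finally show ?thesis
      using realizes_triangle_frame[OF d f2 not_E dist2]
      by (simp only: insert_commute[of p2 p1] insert_commute[of p4 p3] insert_commute[of p6 p5])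
  qed
  have "resolves (circle_graph n) G (crossing G) \<longleftrightarrow> resolves (circle_graph n) H (crossing H)" for n
    unfolding crossing_H G' H' ..
  then show ?thesis
    using unicursal_components_resolves[OF G] unicursal_components_resolves[OF H] by blast
qed

text \<open>For a fixed exterior state the two local sums are those of
  \<open>triangle_sum_swap\<close>; summing over all exterior states preserves the
  congruence.\<close>

lemma even_state_count_H:
  assumes K: "irreducible_knot K" and H: "framed_4_graph H"
    and u: "\<not> odd_at G u" and vw: "odd_at G v = odd_at G w"
    and od: "\<And>x. x \<in> verts G \<Longrightarrow> odd_at H x = odd_at G x"
  shows "even (state_count K odd_at G) \<longleftrightarrow> even (state_count K odd_at H)"
proof -
  let ?N = "node_states odd_at G" and ?b = "odd_at G v"
  have nu: "?N u = choices False a p1 c' p6"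
    using node_states_choices[OF G verts(1) at_u, folded p1_def p6_def] u by simp
  have nv: "?N v = choices ?b a' p2 b p3"
    using node_states_choices[OF G verts(2) at_v, folded p2_def p3_def] by simp
  have nw: "?N w = choices ?b c p5 b' p4"
    using node_states_choices[OF G verts(3) at_w, folded p5_def p4_def] vw by simp
  have split: "(\<Sum>l\<in>PiE (verts G) ?N. F l) =
      (\<Sum>l\<in>PiE I ?N. \<Sum>x\<in>?N u. \<Sum>z\<in>?N w. \<Sum>y\<in>?N v. F (l(u := x, w := z, v := y)))"
    for F :: "(nat \<Rightarrow> nat set set) \<Rightarrow> nat"
    unfolding verts_I(1) sum_PiE_insert[OF verts_I(4)] sum_PiE_insert[OF verts_I(3)]
      sum_PiE_insert[OF verts_I(2)] ..
  have "smoothings H x = smoothings G x" for x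
    by (rule smoothings_cong) (simp_all add: halves_at_def H_simps)
  then have "node_states odd_at H x = ?N x" if "x \<in> verts G" for x
    using od[OF that] by (simp add: node_states_def)
  then have S: "states odd_at H = PiE (verts G) ?N"
    unfolding states_def H_simps by (rule PiE_cong)
  have H': "state_count K odd_at H = (\<Sum>l\<in>PiE I ?N. \<Sum>x\<in>?N u. \<Sum>z\<in>?N w. \<Sum>y\<in>?N v.
      of_bool (resolves K H (l(u := x, w := z, v := y))))"
    unfolding state_count_def S by (rule split[where F = "\<lambda>l. of_bool (resolves K H l)"])
  have G': "state_count K odd_at G = (\<Sum>l\<in>PiE I ?N. \<Sum>x\<in>?N u. \<Sum>z\<in>?N w. \<Sum>y\<in>?N v.
      of_bool (resolves K G (l(u := x, w := z, v := y))))"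
    unfolding state_count_def states_def by (rule split[where F = "\<lambda>l. of_bool (resolves K G l)"])
  show ?thesis
    unfolding G' H'
  proof (rule even_sum_cong)
    fix l assume l: "l \<in> PiE I ?N"
    let ?L = "\<Union>(l ` I)" and ?C = "kept_crossings G I l" and ?n = "circles G"
    have d: "diagram E ?L ?C" and f: "\<Union>E - halves_at G I \<subseteq> free E ?L ?C"
      by (rule exterior_states[OF G I_sub l E_sub inner])+
    have f1: "{p1, p2, p3, p4, p5, p6} \<subseteq> free E ?L ?C" by (rule subset_trans[OF outer f])
    have UI: "\<And>x. x \<in> I \<Longrightarrow> \<Union>(l x) \<subseteq> halves_at G {x}"
      using PiE_mem[OF l] node_states_links(1) by blast
    have left: "(\<Sum>x\<in>?N u. \<Sum>z\<in>?N w. \<Sum>y\<in>?N v. of_bool (resolves K G (l(u := x, w := z, v := y)))) =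
        (\<Sum>x\<in>choices False a p1 c' p6. pair_sum K ?b E3 (x \<union> ?L) ?C ?n a' p2 b p3 c p5 b' p4)"
      unfolding resolves_G nu nv nw by (rule triangle_sum_alt)
    define R where "R = (\<lambda>x z y. of_bool (realizes K E3 (y \<union> (z \<union> (x \<union> ?L)))
        (kept y {{a', p1}, {b, p4}} \<union> (kept z {{c, p6}, {b', p3}} \<union>
          (kept x {{a, p2}, {c', p5}} \<union> ?C))) ?n) :: nat)"
    have "(\<Sum>x\<in>?N u. \<Sum>z\<in>?N w. \<Sum>y\<in>?N v. of_bool (resolves K H (l(u := x, w := z, v := y)))) =
        (\<Sum>x\<in>?N u. \<Sum>z\<in>?N w. \<Sum>y\<in>?N v. R (image swap ` x) (image swap ` z) (image swap ` y))"
    proof (intro sum.cong refl)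
      fix x z y assume xzy: "x \<in> ?N u" "z \<in> ?N w" "y \<in> ?N v"
      show "of_bool (resolves K H (l(u := x, w := z, v := y))) =
        R (image swap ` x) (image swap ` z) (image swap ` y)"
        unfolding R_def
        by (rule arg_cong[where f = of_bool], rule resolves_H[OF H UI])
          (use xzy node_states_links(1) in blast)+
    qed
    \<comment> \<open>The local states are reindexed by \<open>swap\<close>, which permutes the
      half-edges at the triangle and hence maps the states of each crossing bijectively.\<close>
    also have "\<dots> = (\<Sum>x\<in>choices False a p2 c' p5. \<Sum>z\<in>choices ?b c p6 b' p3. \<Sum>y\<in>choices ?b a' p1 b p4. R x z y)"
    proof -
      have 1: "(\<Sum>y\<in>choices ?b a' p2 b p3. R x z (image swap ` y)) = (\<Sum>y\<in>choices ?b a' p1 b p4. R x z y)"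
        for x z
        using sum_choices_image[OF inj_swap, of "R x z" ?b a' p2 b p3] unfolding swap_simps .
      have 2: "(\<Sum>z\<in>choices ?b c p5 b' p4. \<Sum>y\<in>choices ?b a' p1 b p4. R x (image swap ` z) y) =
          (\<Sum>z\<in>choices ?b c p6 b' p3. \<Sum>y\<in>choices ?b a' p1 b p4. R x z y)" for x
        using sum_choices_image[OF inj_swap,
            of "\<lambda>z. \<Sum>y\<in>choices ?b a' p1 b p4. R x z y" ?b c p5 b' p4] unfolding swap_simps .
      show ?thesis
        unfolding nu nv nw 1 2
        using sum_choices_image[OF inj_swap, of "\<lambda>x. \<Sum>z\<in>choices ?b c p6 b' p3.
            \<Sum>y\<in>choices ?b a' p1 b p4. R x z y" False a p1 c' p6] unfolding swap_simps .
    qed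
    also have "\<dots> = (\<Sum>x\<in>choices False a p2 c' p5. pair_sum K ?b E3 (x \<union> ?L) ?C ?n a' p1 b p4 c p6 b' p3)"
      unfolding R_def by (rule triangle_sum_alt)
    finally show "even (\<Sum>x\<in>?N u. \<Sum>z\<in>?N w. \<Sum>y\<in>?N v.
          (of_bool (resolves K G (l(u := x, w := z, v := y))) :: nat)) \<longleftrightarrow>
        even (\<Sum>x\<in>?N u. \<Sum>z\<in>?N w. \<Sum>y\<in>?N v.
          (of_bool (resolves K H (l(u := x, w := z, v := y))) :: nat))"
      unfolding left
      using irreducible_knot.triangle_sum_swap[OF K d matching_E f1 not_E dist] by simp
  qed
qed

end

lemma triangle_rotate: "triangle G u v w a b c \<Longrightarrow> triangle G v w u b c a"
  by (simp add: triangle_def)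

lemma transpose_commute:
  "{x, y} \<inter> {z, t} = {} \<Longrightarrow> transpose x y \<circ> transpose z t = transpose z t \<circ> transpose x y"
  by (auto simp: fun_eq_iff transpose_def)

text \<open>The three transpositions have disjoint supports and commute, so the moved graph does not
  depend on the vertex from which the triangle is read.\<close>

lemma outer_swap_rotate:
  assumes "framed_4_graph G" "triangle G u v w a b c"
  shows "outer_swap G a b c = outer_swap G b c a"
proof -
  interpret triangle_move G u v w a b c using assms by unfold_locales
  have "{p1, p2} \<inter> {p3, p4} = {}" "{p1, p2} \<inter> {p5, p6} = {}" using dd by auto
  note c = transpose_commute[OF this(1)] transpose_commute[OF this(2)]
  have "outer_swap G a b c = transpose p3 p4 \<circ> (transpose p1 p2 \<circ> transpose p5 p6)"
    unfolding swap_def[symmetric] swap_def' c(1) by (simp only: comp_assoc)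
  also have "\<dots> = transpose p3 p4 \<circ> transpose p5 p6 \<circ> transpose p1 p2"
    unfolding c(2) by (simp only: comp_assoc)
  finally show ?thesis
    by (simp add: outer_swap_def p1_def p2_def p3_def p4_def p5_def p6_def a'_def b'_def c'_def)
qed

lemma unicursal_components_move3:
  assumes G: "framed_4_graph G" and H: "framed_4_graph H" and mv: "move3 u v w G H"
  shows "unicursal_components H = unicursal_components G"
proof -
  obtain a b c where t: "triangle G u v w a b c"
    and h: "H = G\<lparr>mate := outer_swap G a b c \<circ> mate G \<circ> outer_swap G a b c\<rparr>"
    using mv unfolding move3_def by blast
  interpret tm: triangle_move G u v w a b c using G t by unfold_locales
  have "tm.H = H" unfolding tm.H_def tm.swap_def h ..
  then show ?thesis using tm.unicursal_components_H H by simp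
qed

text \<open>The local computation expects the even vertex in the first position; rotating the
  triangle brings it there.\<close>

lemma state_count_move3:
  assumes K: "irreducible_knot K" and G: "framed_4_graph G" and H: "framed_4_graph H"
    and mv: "move3 u v w G H" and ev: "even (card {x \<in> {u, v, w}. odd_at G x})"
    and od: "\<And>x. x \<in> verts G \<Longrightarrow> odd_at H x = odd_at G x"
  shows "even (state_count K odd_at G) \<longleftrightarrow> even (state_count K odd_at H)"
proof -
  obtain a b c where t: "triangle G u v w a b c"
    and h: "H = G\<lparr>mate := outer_swap G a b c \<circ> mate G \<circ> outer_swap G a b c\<rparr>"
    using mv unfolding move3_def by blast
  have main: "even (state_count K odd_at G) \<longleftrightarrow> even (state_count K odd_at H)"
    if t: "triangle G u v w a b c"
      and h: "H = G\<lparr>mate := outer_swap G a b c \<circ> mate G \<circ> outer_swap G a b c\<rparr>"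
      and o: "\<not> odd_at G u" "odd_at G v = odd_at G w" for u v w a b c
  proof -
    interpret tm: triangle_move G u v w a b c using G t by unfold_locales
    have eq: "tm.H = H" unfolding tm.H_def tm.swap_def h ..
    show ?thesis using tm.even_state_count_H[of K odd_at] K H o od unfolding eq by blast
  qed
  note t2 = triangle_rotate[OF t]
  note t3 = triangle_rotate[OF t2]
  note s2 = outer_swap_rotate[OF G t]
  note s3 = trans[OF s2 outer_swap_rotate[OF G t2]]
  have ne: "u \<noteq> v" "v \<noteq> w" "w \<noteq> u" using t by (simp_all add: triangle_def)
  have "{x \<in> {u, v, w}. odd_at G x} =
      (if odd_at G u then {u} else {}) \<union> ((if odd_at G v then {v} else {}) \<union> (if odd_at G w then {w} else {}))"
    by auto
  \<comment> \<open>An even number among three is zero or two.\<close>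
  then have "(\<not> odd_at G u \<and> odd_at G v = odd_at G w) \<or> (\<not> odd_at G v \<and> odd_at G w = odd_at G u) \<or>
      (\<not> odd_at G w \<and> odd_at G u = odd_at G v)"
    using ev ne ne[symmetric] by (auto split: if_splits)
  then show ?thesis
    using main[OF t h] main[OF t2 h[unfolded s2]] main[OF t3 h[unfolded s3]] by blast
qed

text \<open>All vertices are odd, so keeping all of them is an admissible state, realized by the
  identity. Any other state smooths a vertex and loses half-edges, so it cannot give a graph of the
  size of \<open>K\<close>.\<close>

lemma state_count_self:
  assumes K: "framed_4_graph K" and all: "\<forall>v\<in>verts K. odd_at K v"
  shows "state_count K odd_at K = 1"
proof -
  let ?l = "\<lambda>v\<in>verts K. {}"
  have lS: "?l \<in> states odd_at K"
    using all unfolding states_def by (intro PiE_I) (simp_all add: node_states_def)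
  have e: "?l ` verts K \<subseteq> {{}}" "{v \<in> verts K. ?l v = {}} = verts K" by auto
  have "\<Union>(?l ` verts K) \<subseteq> \<Union>{{}}" using e(1) by (rule Union_mono)
  then have U: "\<Union>(?l ` verts K) = {}" by simp
  have "{Q \<in> \<Union>(edges K) // conn (edges K \<union> {}). Q \<subseteq> \<Union>{}} = {}"
    by (auto elim!: quotientE)
  then have c: "closed_arcs (edges K) {} = 0" unfolding closed_arcs_def by (metis card.empty)
  have conn: "(d, mate K d) \<in> conn (edges K)" if "d \<in> halves K" for d
    using edges_iff[OF K] that by (intro conn_edge) simp
  have "resolves K K ?l"
    unfolding resolves_def realizes_def U e(2)
    using c conn by (intro exI[of _ id]) (simp add: Union_edges[OF K])
  moreover have "l = ?l" if l: "l \<in> states odd_at K" "resolves K K l" for l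
  proof -
    have ns: "\<And>v. v \<in> verts K \<Longrightarrow> l v \<in> node_states odd_at K v"
      using l(1) PiE_mem unfolding states_def by metis
    obtain g where "bij_betw g (halves K) (\<Union>(edges K) - \<Union>(\<Union>(l ` verts K)))"
      using l(2) unfolding resolves_def realizes_def by blast
    \<comment> \<open>Finiteness turns equality of numbers into equality of sets: no half-edge is
      linked.\<close>
    then have "card (halves K - \<Union>(\<Union>(l ` verts K))) = card (halves K)"
      unfolding Union_edges[OF K] by (metis bij_betw_same_card)
    then have eq: "halves K - \<Union>(\<Union>(l ` verts K)) = halves K"
      using card_subset_eq[OF framed_finite(2)[OF K]] by blast
    have "l v = {}" if v: "v \<in> verts K" for v
    proof (rule ccontr)
      assume "l v \<noteq> {}"
      then have "l v \<in> smoothings K v" using ns[OF v] by (simp add: node_states_def split: if_splits)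
      then have "\<Union>(l v) = halves_at K {v}" by (rule smoothings_Union)
      moreover have "\<Union>(l v) \<subseteq> \<Union>(\<Union>(l ` verts K))" using v by blast
      moreover obtain d where "d \<in> halves_at K {v}" using halves_at_nonempty[OF K v] by blast
      moreover from this have "d \<in> halves K" by (simp add: halves_at_def)
      ultimately show False using eq by blast
    qed
    then show "l = ?l" using l(1) unfolding states_def by (intro extensionalityI[of l "verts K"]) (auto simp: PiE_def)
  qed
  ultimately have "{l \<in> states odd_at K. resolves K K l} = {?l}" using lS by blast
  then show ?thesis unfolding state_count_card[OF K] by simp
qed

section \<open>Parity along chains of moves\<close>

lemma parity_iso:
  assumes "parity odd_at" "knot_graph G" "knot_graph H" "graph_iso f g G H" "x \<in> verts G"
  shows "odd_at H (f x) = odd_at G x"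
proof -
  have "\<forall>x\<in>verts G. odd_at H (f x) = odd_at G x"
    by (rule conjunct1[OF assms(1)[unfolded parity_def], THEN spec, THEN spec, THEN spec, THEN spec, THEN mp])
      (rule conjI assms)+
  then show ?thesis using assms(5) by (rule bspec)
qed

lemma parity_moves:
  assumes "parity odd_at" "knot_graph G" "knot_graph H"
  shows "move1 v G H \<Longrightarrow> \<not> odd_at G v \<and> (\<forall>x\<in>verts G - {v}. odd_at H x = odd_at G x)"
      (is "_ \<Longrightarrow> ?A")
    and "move2 u v G H \<Longrightarrow>
      odd_at G u = odd_at G v \<and> (\<forall>x\<in>verts G - {u, v}. odd_at H x = odd_at G x)"
      (is "_ \<Longrightarrow> ?B")
    and "move3 u v w G H \<Longrightarrow>
      even (card {x \<in> {u, v, w}. odd_at G x}) \<and> (\<forall>x\<in>verts G. odd_at H x = odd_at G x)"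
      (is "_ \<Longrightarrow> ?C")
proof -
  note par = assms(1)[unfolded parity_def, THEN conjunct2]
  show "move1 v G H \<Longrightarrow> ?A"
    by (rule par[THEN conjunct1, THEN spec, THEN spec, THEN spec, THEN mp]) (simp add: assms)
  show "move2 u v G H \<Longrightarrow> ?B"
    by (rule par[THEN conjunct2, THEN conjunct1, THEN spec, THEN spec, THEN spec, THEN spec, THEN mp])
      (simp add: assms)
  show "move3 u v w G H \<Longrightarrow> ?C"
    by (rule par[THEN conjunct2, THEN conjunct2, THEN spec, THEN spec, THEN spec, THEN spec, THEN spec,
          THEN mp]) (simp add: assms)
qed

text \<open>The parity axioms speak only of graphs with one unicursal component, whereas the steps
  of \<open>free_equivalent\<close> range over all framed graphs. This lemma keeps the whole chain
  among knots.\<close>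

lemma unicursal_components_move:
  assumes "move_step G H"
  shows "unicursal_components H = unicursal_components G"
proof -
  have G: "framed_4_graph G" and H: "framed_4_graph H" using assms by (simp_all add: move_step_def)
  consider "isomorphic G H" | v where "move1 v G H" | u v where "move2 u v G H" | u v w where "move3 u v w G H"
    using assms unfolding move_step_def by blast
  then show ?thesis
  proof cases
    case 1
    then show ?thesis unfolding isomorphic_def using unicursal_components_iso[OF G H] by metis
  next
    case 2
    then obtain e where "e \<in> halves G" "vertex G e = v" "H = splice {v} (opp G) G"
      unfolding move1_def by blast
    then show ?thesis using unicursal_components_splice[OF G, of "{v}"] framed_vertex[OF G] by auto
  next
    case 3
    then obtain e where e: "e \<in> halves G" "vertex G e = u" "vertex G (mate G e) = v"
      and H: "H = splice {u, v} (opp G) G"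
      unfolding move2_def bigon_def by blast
    have "mate G e \<in> halves G" using framed_mate[OF G] e(1) by (simp add: pairing_on_def)
    then have "{u, v} \<subseteq> verts G" using framed_vertex[OF G] e by auto
    then show ?thesis unfolding H by (rule unicursal_components_splice[OF G])
  next
    case 4
    then show ?thesis by (rule unicursal_components_move3[OF G H])
  qed
qed

lemma even_state_count_move:
  assumes K: "irreducible_knot K" and par: "parity odd_at" and mv: "move_step G H"
    and kG: "knot_graph G" and kH: "knot_graph H"
  shows "even (state_count K odd_at G) \<longleftrightarrow> even (state_count K odd_at H)"
proof -
  interpret irreducible_knot K by (rule K)
  have G: "framed_4_graph G" and H: "framed_4_graph H" using mv by (simp_all add: move_step_def)
  consider "isomorphic G H" | v where "move1 v G H" | u v where "move2 u v G H" | u v w where "move3 u v w G H"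
    using mv unfolding move_step_def by blast
  then show ?thesis
  proof cases
    case 1
    then obtain f g where i: "graph_iso f g G H" unfolding isomorphic_def by blast
    have "state_count K odd_at G = state_count K odd_at H"
      by (rule state_count_iso[OF G H i]) (rule parity_iso[OF par kG kH i])
    then show ?thesis by simp
  next
    case 2
    have "state_count K odd_at G = state_count K odd_at H"
      by (rule state_count_move1[OF G 2]) (use parity_moves(1)[OF par kG kH 2] in auto)
    then show ?thesis by simp
  next
    case 3
    show ?thesis
      by (rule state_count_move2[OF G 3]) (use parity_moves(2)[OF par kG kH 3] in auto)
  next
    case 4
    show ?thesis
      by (rule state_count_move3[OF K G H 4]) (use parity_moves(3)[OF par kG kH 4] in auto)
  qed
qed

text \<open>A forbidden loop would admit a first move. Its result is again a knot, so the parity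
  axiom applies and makes the vertex even, against the assumption that all vertices are odd.\<close>

lemma irreducible_knotI:
  assumes par: "parity odd_at" and K: "knot_graph K" and all: "\<forall>v\<in>verts K. odd_at K v"
    and nb: "\<not> (\<exists>u v. bigon K u v)"
  shows "irreducible_knot K"
proof
  have fK: "framed_4_graph K" using K by (simp add: knot_graph_def)
  show "knot_graph K" "\<And>u v. \<not> bigon K u v" using K nb by simp_all
  fix e assume e: "e \<in> halves K" "vertex K (mate K e) = vertex K e"
  let ?H = "splice {vertex K e} (opp K) K"
  have v: "vertex K e \<in> verts K" using framed_vertex[OF fK e(1)] .
  show "mate K e = opp K e"
  proof (rule ccontr)
    assume "mate K e \<noteq> opp K e"
    then have "move1 (vertex K e) K ?H" unfolding move1_def using e by blast
    moreover have "knot_graph ?H" using knot_graph_splice[OF K] v by simp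
    ultimately show False using parity_moves(1)[OF par K] all v by blast
  qed
qed

theorem theorem3:
  fixes odd_at :: "fgraph \<Rightarrow> nat \<Rightarrow> bool" and K K' :: fgraph
  assumes "parity odd_at"
    and "knot_graph K"
    and "\<forall>v\<in>verts K. odd_at K v"
    and "\<not> (\<exists>u v. bigon K u v)"
    and "framed_4_graph K'"
    and "free_equivalent K K'"
  shows "\<exists>H. smoothing_of H K' \<and> isomorphic H K"
proof -
  have K: "irreducible_knot K" by (rule irreducible_knotI[OF assms(1-4)])
  have fK: "framed_4_graph K" using assms(2) by (simp add: knot_graph_def)
  \<comment> \<open>Being a knot is carried along because the invariance of the parity of the count
    is available only between knots.\<close>
  have "knot_graph K' \<and> odd (state_count K odd_at K')"
    using assms(6) unfolding free_equivalent_def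
  proof (induction rule: equivclp_induct)
    case base
    have "state_count K odd_at K = 1" by (rule state_count_self[OF fK]) (rule assms(3))
    then show ?case using assms(2) by simp
  next
    case (step G H)
    then have G: "knot_graph G" and odd: "odd (state_count K odd_at G)" by simp_all
    from step(2) show ?case
    proof
      assume mv: "move_step G H"
      then have "knot_graph H"
        using G unicursal_components_move[OF mv] by (simp add: knot_graph_def move_step_def)
      then show ?thesis using even_state_count_move[OF K assms(1) mv G] odd by blast
    next
      assume mv: "move_step H G"
      then have "knot_graph H"
        using G unicursal_components_move[OF mv] by (simp add: knot_graph_def move_step_def)
      then show ?thesis using even_state_count_move[OF K assms(1) mv _ G] odd by blast
    qed
  qed
  \<comment> \<open>An odd count is not zero, which yields a resolving state of
    \<open>K'\<close>.\<close>
  then have "state_count K odd_at K' \<noteq> 0" by (metis even_zero)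
  then have "{l \<in> states odd_at K'. resolves K K' l} \<noteq> {}"
    unfolding state_count_card[OF assms(5)] by (metis card.empty)
  then obtain l where l: "l \<in> states odd_at K'" "resolves K K' l" by blast
  have "l v = {} \<or> l v \<in> smoothings K' v" if "v \<in> verts K'" for v
  proof -
    have "l v \<in> node_states odd_at K' v" using l(1) that unfolding states_def by (rule PiE_mem)
    then show ?thesis by (auto simp: node_states_def split: if_splits)
  qed
  then show ?thesis by (rule resolves_smoothing[OF fK assms(5) l(2)])
qed

end
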